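(* Let $\kappa\in\mathbb{R}$ with $\kappa>0$ be a constant, and set $c_1=\dfrac{1}{8\pi^{3/2}}$ and $c_2=\dfrac{1}{12\pi^2}$. If $\beta\in\mathbb{R}$ is positive and satisfies $$\kappa>\frac{c_1}{\beta^{3/2}},$$ then there exists $\mu\in\mathbb{R}$ such that the pair $(\varphi,\mu)=(0,\mu)\in\mathbb{R}\times\mathbb{R}$ is a solution of the reduced Hartree-Fock equation $$-\frac{1}{4\pi}\Delta\varphi=\kappa-\operatorname{den} f_{\rm FD}(\beta(-\Delta-\varphi-\mu))$$ on $\mathbb{R}^3$. Moreover, $$0<\frac{1}{\beta}\log\big(\kappa\beta^{3/2}/c_1\big)<\mu<(\kappa/c_2)^{2/3}.$$
   Context: $f_{\rm FD}(x)=\dfrac{1}{1+e^x}$ is the Fermi-Dirac distribution, and $-\Delta$ is the Laplacian on $L^2(\mathbb{R}^3)$. For an operator $A$ on $L^2(\mathbb{R}^3)$ with integral kernel $A(x,y)$, its density is the function $(\operatorname{den}A)(x)=A(x,x)$. *)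

theory Defs
  imports "HOL-Analysis.Analysis"
begin

subsection \<open>The Hilbert space of square integrable functions\<close>

text \<open>
  Elements of L2 are represented by Borel measurable functions; equality of the corresponding
  classes is the relation \<open>ae_eq\<close>.
\<close>

type_synonym R3 = "real ^ 3"
type_synonym wavefun = "R3 \<Rightarrow> complex"

definition L2 :: "wavefun set" where
  "L2 = {f. f \<in> borel_measurable borel \<and> integrable lborel (\<lambda>x. (cmod (f x))\<^sup>2)}"

definition ae_eq :: "wavefun \<Rightarrow> wavefun \<Rightarrow> bool" where
  "ae_eq f g \<longleftrightarrow> (AE x in lborel. f x = g x)"

definition l2_inner :: "wavefun \<Rightarrow> wavefun \<Rightarrow> complex" where
  "l2_inner f g = (LINT x|lborel. f x * cnj (g x))"

definition l2_norm :: "wavefun \<Rightarrow> real" where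
  "l2_norm f = sqrt (LINT x|lborel. (cmod (f x))\<^sup>2)"


subsection \<open>Unbounded operators\<close>

text \<open>
  A (possibly unbounded) operator is given by its graph, which is closed under changing
  representatives; its domain is \<open>Domain A\<close>.
\<close>

type_synonym l2_op = "(wavefun \<times> wavefun) set"

definition linear_operator :: "l2_op \<Rightarrow> bool" where
  "linear_operator A \<longleftrightarrow>
     A \<subseteq> L2 \<times> L2 \<and>
     (\<forall>f g f' g'. (f, g) \<in> A \<longrightarrow> f' \<in> L2 \<longrightarrow> g' \<in> L2 \<longrightarrow> ae_eq f f' \<longrightarrow> ae_eq g g' \<longrightarrow> (f', g') \<in> A) \<and>
     (\<forall>f g g'. (f, g) \<in> A \<longrightarrow> (f, g') \<in> A \<longrightarrow> ae_eq g g') \<and>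
     (\<lambda>x. 0, \<lambda>x. 0) \<in> A \<and>
     (\<forall>f g f' g'. (f, g) \<in> A \<longrightarrow> (f', g') \<in> A \<longrightarrow> (\<lambda>x. f x + f' x, \<lambda>x. g x + g' x) \<in> A) \<and>
     (\<forall>c f g. (f, g) \<in> A \<longrightarrow> (\<lambda>x. c * f x, \<lambda>x. c * g x) \<in> A)"

definition mult_op :: "(R3 \<Rightarrow> real) \<Rightarrow> l2_op" where
  "mult_op v = {(f, g). f \<in> L2 \<and> g \<in> L2 \<and> ae_eq g (\<lambda>x. of_real (v x) * f x)}"

definition op_diff :: "l2_op \<Rightarrow> l2_op \<Rightarrow> l2_op" where
  "op_diff A B =
     {(f, h). h \<in> L2 \<and> (\<exists>g k. (f, g) \<in> A \<and> (f, k) \<in> B \<and> ae_eq h (\<lambda>x. g x - k x))}"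

definition op_scale :: "real \<Rightarrow> l2_op \<Rightarrow> l2_op" where
  "op_scale c A = {(f, h). h \<in> L2 \<and> (\<exists>g. (f, g) \<in> A \<and> ae_eq h (\<lambda>x. of_real c * g x))}"


subsection \<open>The Laplacian\<close>

definition partial :: "3 \<Rightarrow> (R3 \<Rightarrow> 'b::real_normed_vector) \<Rightarrow> R3 \<Rightarrow> 'b" where
  "partial i f x = frechet_derivative f (at x) (axis i 1)"

primrec C_k :: "nat \<Rightarrow> (R3 \<Rightarrow> 'b::real_normed_vector) \<Rightarrow> bool" where
  "C_k 0 f \<longleftrightarrow> continuous_on UNIV f"
| "C_k (Suc n) f \<longleftrightarrow> (\<forall>x. f differentiable (at x)) \<and> (\<forall>i. C_k n (partial i f))"

definition laplacian :: "(R3 \<Rightarrow> 'b::real_normed_vector) \<Rightarrow> R3 \<Rightarrow> 'b" where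
  "laplacian f x = (\<Sum>i\<in>UNIV. partial i (partial i f) x)"

definition test_function :: "wavefun \<Rightarrow> bool" where
  "test_function \<eta> \<longleftrightarrow> (\<forall>n. C_k n \<eta>) \<and> compact (closure {x. \<eta> x \<noteq> 0})"

text \<open>
  The self-adjoint operator \<open>-\<Delta>\<close>: the distributional Laplacian on its maximal domain of all
  \<open>f \<in> L2\<close> whose distributional Laplacian lies in \<open>L2\<close>, that is, on the Sobolev space \<open>H\<^sup>2\<close>.
\<close>

definition neg_laplacian :: l2_op where
  "neg_laplacian =
     {(f, g). f \<in> L2 \<and> g \<in> L2 \<and>
        (\<forall>\<eta>. test_function \<eta> \<longrightarrow>
           (LINT x|lborel. f x * (- laplacian \<eta> x)) = (LINT x|lborel. g x * \<eta> x))}"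


subsection \<open>Functional calculus of self-adjoint operators\<close>

definition orthogonal_projection :: "(wavefun \<Rightarrow> wavefun) \<Rightarrow> bool" where
  "orthogonal_projection P \<longleftrightarrow>
     (\<forall>f\<in>L2. P f \<in> L2) \<and>
     (\<forall>f\<in>L2. \<forall>g\<in>L2. ae_eq f g \<longrightarrow> ae_eq (P f) (P g)) \<and>
     (\<forall>f\<in>L2. \<forall>g\<in>L2. ae_eq (P (\<lambda>x. f x + g x)) (\<lambda>x. P f x + P g x)) \<and>
     (\<forall>c. \<forall>f\<in>L2. ae_eq (P (\<lambda>x. c * f x)) (\<lambda>x. c * P f x)) \<and>
     (\<forall>f\<in>L2. ae_eq (P (P f)) (P f)) \<and>
     (\<forall>f\<in>L2. \<forall>g\<in>L2. l2_inner (P f) g = l2_inner f (P g))"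

text \<open>
  Projection-valued measures on the Borel sets of the real line; the last condition is countable
  additivity in the strong operator topology.
\<close>

definition projection_valued_measure :: "(real set \<Rightarrow> wavefun \<Rightarrow> wavefun) \<Rightarrow> bool" where
  "projection_valued_measure E \<longleftrightarrow>
     (\<forall>B\<in>sets borel. orthogonal_projection (E B)) \<and>
     (\<forall>f\<in>L2. ae_eq (E {} f) (\<lambda>x. 0)) \<and>
     (\<forall>f\<in>L2. ae_eq (E UNIV f) f) \<and>
     (\<forall>B\<in>sets borel. \<forall>C\<in>sets borel. \<forall>f\<in>L2. ae_eq (E (B \<inter> C) f) (E B (E C f))) \<and>
     (\<forall>B. range B \<subseteq> sets borel \<longrightarrow> disjoint_family B \<longrightarrow>
        (\<forall>f\<in>L2. (\<lambda>N. l2_norm (\<lambda>x. E (\<Union>i::nat. B i) f x - (\<Sum>i<N. E (B i) f x)))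
                   \<longlonglongrightarrow> 0))"

text \<open>The scalar measure \<open>B \<mapsto> \<langle>E B f, f\<rangle> = \<parallel>E B f\<parallel>\<^sup>2\<close>.\<close>

definition scalar_measure :: "(real set \<Rightarrow> wavefun \<Rightarrow> wavefun) \<Rightarrow> wavefun \<Rightarrow> real measure" where
  "scalar_measure E f = measure_of UNIV (sets borel) (\<lambda>B. ennreal ((l2_norm (E B f))\<^sup>2))"

text \<open>
  \<open>A = \<integral> g dE\<close>. The quadratic form determines the linear operator \<open>A\<close> on its domain, by
  polarization.
\<close>

definition is_spectral_integral ::
    "(real set \<Rightarrow> wavefun \<Rightarrow> wavefun) \<Rightarrow> (real \<Rightarrow> real) \<Rightarrow> l2_op \<Rightarrow> bool" where
  "is_spectral_integral E g A \<longleftrightarrow>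
     linear_operator A \<and>
     Domain A = {f \<in> L2. integrable (scalar_measure E f) (\<lambda>t. (g t)\<^sup>2)} \<and>
     (\<forall>(f, h)\<in>A. l2_inner h f = of_real (LINT t|scalar_measure E f. g t))"

text \<open>
  \<open>T = g(A)\<close> for a self-adjoint operator \<open>A\<close> with spectral measure \<open>E\<close>, i.e. \<open>A = \<integral> t dE(t)\<close>. By
  the spectral theorem such an \<open>E\<close> exists exactly when \<open>A\<close> is self-adjoint, and is then unique.
\<close>

definition is_function_of_op :: "(real \<Rightarrow> real) \<Rightarrow> l2_op \<Rightarrow> l2_op \<Rightarrow> bool" where
  "is_function_of_op g A T \<longleftrightarrow>
     (\<exists>E. projection_valued_measure E \<and>
          is_spectral_integral E (\<lambda>t. t) A \<and> is_spectral_integral E g T)"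


subsection \<open>Integral kernels and densities\<close>

definition is_integral_kernel :: "l2_op \<Rightarrow> (R3 \<Rightarrow> R3 \<Rightarrow> complex) \<Rightarrow> bool" where
  "is_integral_kernel T K \<longleftrightarrow>
     (\<forall>(f, g)\<in>T. AE x in lborel.
        integrable lborel (\<lambda>y. K x y * f y) \<and> g x = (LINT y|lborel. K x y * f y))"

text \<open>
  An integral kernel is determined only almost everywhere, whereas the diagonal is a null set, so
  the density is read off from the (unique) continuous kernel.
\<close>

definition is_density :: "l2_op \<Rightarrow> (R3 \<Rightarrow> real) \<Rightarrow> bool" where
  "is_density T \<rho> \<longleftrightarrow>
     (\<exists>K. continuous_on UNIV (\<lambda>(x, y). K x y) \<and> is_integral_kernel T K \<and>
          (\<forall>x. K x x = of_real (\<rho> x)))"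


subsection \<open>The reduced Hartree-Fock equation\<close>

definition f_FD :: "real \<Rightarrow> real" where
  "f_FD x = 1 / (1 + exp x)"

definition rhf_hamiltonian :: "(R3 \<Rightarrow> real) \<Rightarrow> real \<Rightarrow> l2_op" where
  "rhf_hamiltonian \<phi> \<mu> = op_diff (op_diff neg_laplacian (mult_op \<phi>)) (mult_op (\<lambda>x. \<mu>))"

definition rhf_solution :: "real \<Rightarrow> real \<Rightarrow> (R3 \<Rightarrow> real) \<Rightarrow> real \<Rightarrow> bool" where
  "rhf_solution \<kappa> \<beta> \<phi> \<mu> \<longleftrightarrow>
     C_k 2 \<phi> \<and>
     (\<exists>T \<rho>. is_function_of_op f_FD (op_scale \<beta> (rhf_hamiltonian \<phi> \<mu>)) T \<and> is_density T \<rho> \<and>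
        (\<forall>x. - (1 / (4 * pi)) * laplacian \<phi> x = \<kappa> - \<rho> x))"

end

theory Submission
  imports Defs "HOL-Probability.Probability"
begin

text \<open>
  For \<open>\<phi> = 0\<close> everything is diagonal in Fourier space: \<open>-\<Delta>\<close> is unitarily equivalent to multiplication by
  \<open>|\<xi>|\<^sup>2\<close>, so \<open>f_FD (\<beta> (-\<Delta> - \<mu>))\<close> is the Fourier multiplier with symbol \<open>f_FD (\<beta> (|\<xi>|\<^sup>2 - \<mu>))\<close>. This is
  convolution with a continuous function, hence its density is the constant
  \<open>\<rho> \<mu> = (2 \<pi>)\<^sup>-\<^sup>3 \<integral> f_FD (\<beta> (|\<xi>|\<^sup>2 - \<mu>)) d\<xi>\<close>, and the equation reduces to \<open>\<rho> \<mu> = \<kappa>\<close>.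
  The function \<open>\<rho>\<close> is continuous and increasing. The bound \<open>f_FD x < exp (- x)\<close> and a Gaussian integral give
  \<open>\<rho> \<mu> < c\<^sub>1 \<beta>\<^sup>-\<^sup>3\<^sup>/\<^sup>2 exp (\<beta> \<mu>)\<close>; the bound \<open>f_FD x > 1/2\<close> for \<open>x < 0\<close> and the volume of the ball of radius
  \<open>\<mu>\<^sup>1\<^sup>/\<^sup>2\<close> give \<open>\<rho> \<mu> > c\<^sub>2 \<mu>\<^sup>3\<^sup>/\<^sup>2\<close> for \<open>\<mu> > 0\<close>. The intermediate value theorem concludes.
\<close>


subsection \<open>Gaussian integrals\<close>

text \<open>\<open>neg_laplacian\<close> is a graph on its maximal domain, tested against smooth
  functions. Being diagonal in Fourier space therefore means an equality of graphs, and it rests on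
  a unitary transform of all of \<open>L2\<close>. The isometry is proved for continuous functions
  of compact support and spreads by density. Surjectivity comes from the symmetry of the kernel
  \<open>cis (- (x \<bullet> y))\<close>: conjugation turns the transform into its own adjoint,
  which is isometric as well, and an isometry with isometric adjoint is unitary. The harder
  inclusion for the Laplacian asks for sufficiently many test functions, hence the explicit smooth
  bumps. On the constants: \<open>(2 pi)^(-3)\<close> is the square of the normalization of the
  transform. It turns the Gaussian integral \<open>(pi / \<beta>) powr (3/2)\<close> into
  \<open>c\<^sub>1 / \<beta> powr (3/2)\<close>, and half the volume of the ball,
  \<open>2/3 pi \<mu> powr (3/2)\<close>, into \<open>c\<^sub>2 \<mu> powr (3/2)\<close>. Both
  comparisons are strict at every point, which is what makes the bounds on \<mu> strict.\<close>

lemma lborel_integral_affine: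
  fixes f :: "'a::euclidean_space \<Rightarrow> 'b::{banach, second_countable_topology}"
  assumes c: "c \<noteq> 0"
  shows "integrable lborel (\<lambda>x. f (t + c *\<^sub>R x)) \<longleftrightarrow> integrable lborel f" (is ?A)
    and "f \<in> borel_measurable borel \<Longrightarrow> (LINT x|lborel. f x) = \<bar>c\<bar> ^ DIM('a) *\<^sub>R (LINT x|lborel. f (t + c *\<^sub>R x))"
proof -
  have 1: "integrable lborel (\<lambda>x. f (t + c *\<^sub>R x))" if "integrable lborel f" "c \<noteq> 0" for f :: "'a \<Rightarrow> 'b" and c t
  proof -
    from that have m[measurable]: "f \<in> borel_measurable borel" by auto
    have "integrable (density (distr lborel borel (\<lambda>x. t + c *\<^sub>R x)) (\<lambda>_. \<bar>c\<bar>^DIM('a))) f"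
      using that lborel_affine[of c t] by simp
    then have "integrable lborel (\<lambda>x. \<bar>c\<bar> ^ DIM('a) *\<^sub>R f (t + c *\<^sub>R x))"
      using that by (subst (asm) integrable_density) (auto simp: integrable_distr_eq)
    then have "integrable lborel (\<lambda>x. (1 / \<bar>c\<bar> ^ DIM('a)) *\<^sub>R (\<bar>c\<bar> ^ DIM('a) *\<^sub>R f (t + c *\<^sub>R x)))"
      by (rule integrable_scaleR_right)
    then show ?thesis using that by simp
  qed
  have 2: "integrable lborel f" if "integrable lborel (\<lambda>x. f (t + c *\<^sub>R x))"
  proof -
    \<comment> \<open>The converse is the forward direction for the inverse affine map
      \<open>x \<mapsto> (x - t) / c\<close>.\<close>
    have "integrable lborel (\<lambda>x. f (t + c *\<^sub>R ((- t) /\<^sub>R c + (1/c) *\<^sub>R x)))"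
      using 1[OF that, of "1/c" "(- t) /\<^sub>R c"] c by simp
    then show ?thesis using c by (simp add: algebra_simps)
  qed
  show ?A using 1[of f c t] 2 c by blast
  assume m[measurable]: "f \<in> borel_measurable borel"
  have "(LINT x|lborel. f x) = (LINT x|density (distr lborel borel (\<lambda>x. t + c *\<^sub>R x)) (\<lambda>_. \<bar>c\<bar>^DIM('a)). f x)"
    using lborel_affine[of c t] c by simp
  also have "\<dots> = (LINT x|lborel. \<bar>c\<bar> ^ DIM('a) *\<^sub>R f (t + c *\<^sub>R x))"
    by (subst integral_density) (auto simp: integral_distr)
  finally show "(LINT x|lborel. f x) = \<bar>c\<bar> ^ DIM('a) *\<^sub>R (LINT x|lborel. f (t + c *\<^sub>R x))" by simp
qed

lemma borel_measurable_cis [measurable (raw)]: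
  "f \<in> borel_measurable M \<Longrightarrow> (\<lambda>x. cis (f x)) \<in> borel_measurable M"
  by (rule measurable_compose[of f M borel cis]) (auto intro!: borel_measurable_continuous_onI continuous_intros)

text \<open>Up to the factor \<open>sqrt (2*pi)\<close> this is the characteristic function of the
  standard normal distribution.\<close>

lemma gauss_fourier_1:
  fixes t :: real
  shows "integrable lborel (\<lambda>x::real. cis (t * x) * of_real (exp (- x\<^sup>2 / 2)))"
    and "(LINT x|lborel. cis (t * x) * of_real (exp (- x\<^sup>2 / 2))) = of_real (sqrt (2*pi) * exp (- t\<^sup>2 / 2))"
proof -
  have i: "integrable lborel (\<lambda>x. std_normal_density x)" by simp
  have e: "exp (- x\<^sup>2 / 2) = sqrt (2*pi) * std_normal_density x" for x :: real
    by (simp add: std_normal_density_def)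
  have "integrable lborel (\<lambda>x. exp (- x\<^sup>2 / 2 :: real))" unfolding e using i by simp
  then show "integrable lborel (\<lambda>x::real. cis (t * x) * of_real (exp (- x\<^sup>2 / 2)))"
    by (rule Bochner_Integration.integrable_bound) (auto simp: norm_mult cis_conv_exp)
  have "char std_normal_distribution t = (LINT x|lborel. std_normal_density x *\<^sub>R iexp (t * x))"
    unfolding char_def by (subst integral_density) (auto simp: normal_density_nonneg)
  then have c: "(LINT x|lborel. std_normal_density x *\<^sub>R iexp (t * x)) = complex_of_real (exp (- t\<^sup>2 / 2))"
    by (simp add: char_std_normal_distribution)
  have "(LINT x|lborel. cis (t * x) * of_real (exp (- x\<^sup>2 / 2)))
     = (LINT x|lborel. sqrt (2*pi) *\<^sub>R (std_normal_density x *\<^sub>R iexp (t * x)))"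
    unfolding e by (intro Bochner_Integration.integral_cong) (auto simp: cis_conv_exp scaleR_conv_of_real mult_ac)
  also have "\<dots> = sqrt (2*pi) *\<^sub>R complex_of_real (exp (- t\<^sup>2 / 2))" by (simp only: integral_scaleR_right c)
  finally show "(LINT x|lborel. cis (t * x) * of_real (exp (- x\<^sup>2 / 2))) = of_real (sqrt (2*pi) * exp (- t\<^sup>2 / 2))"
    by (simp add: scaleR_conv_of_real)
qed

lemma cis_sum: "finite A \<Longrightarrow> cis (\<Sum>x\<in>A. f x) = (\<Prod>x\<in>A. cis (f x))"
  by (induction rule: finite_induct) (auto simp: cis_mult[symmetric])

text \<open>In coordinates both the character and the Gaussian factorize over \<open>Basis\<close>,
  and \<open>lborel\<close> is the image of a product measure, so the one-dimensional transform
  applies in each coordinate.\<close>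

lemma gauss_fourier_std:
  fixes t :: "'a::euclidean_space"
  shows "integrable lborel (\<lambda>x::'a. cis (t \<bullet> x) * of_real (exp (- (norm x)\<^sup>2 / 2)))"
    and "(LINT x|lborel. cis (t \<bullet> x) * of_real (exp (- (norm x)\<^sup>2 / 2)))
        = of_real (sqrt (2*pi) ^ DIM('a) * exp (- (norm t)\<^sup>2 / 2))"
proof -
  interpret P: product_sigma_finite "\<lambda>b::'a. lborel :: real measure" ..
  let ?S = "\<lambda>f. (\<Sum>b\<in>Basis. f b *\<^sub>R (b::'a))"
  let ?F = "\<lambda>x::'a. cis (t \<bullet> x) * complex_of_real (exp (- (norm x)\<^sup>2 / 2))"
  let ?g = "\<lambda>(b::'a) (x::real). cis ((t \<bullet> b) * x) * complex_of_real (exp (- x\<^sup>2 / 2))"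
  have F: "?F (?S f) = (\<Prod>b\<in>Basis. ?g b (f b))" for f :: "'a \<Rightarrow> real"
  proof -
    have "t \<bullet> ?S f = (\<Sum>b\<in>Basis. (t \<bullet> b) * f b)" by (simp add: inner_sum_right mult.commute)
    moreover have "(norm (?S f))\<^sup>2 = (\<Sum>b\<in>Basis. (f b)\<^sup>2)"
      unfolding power2_norm_eq_inner by (subst euclidean_inner) (simp add: power2_eq_square)
    ultimately show ?thesis
      by (simp add: cis_sum prod.distrib exp_sum sum_negf[symmetric] sum_divide_distrib of_real_prod[symmetric]
          del: of_real_prod)
  qed
  have [measurable]: "?F \<in> borel_measurable borel" by (intro borel_measurable_times) measurable
  have S[measurable]: "?S \<in> (\<Pi>\<^sub>M b\<in>Basis. lborel) \<rightarrow>\<^sub>M borel" by measurable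
  have i: "integrable (\<Pi>\<^sub>M b\<in>Basis. lborel) (\<lambda>f. \<Prod>b\<in>(Basis::'a set). ?g b (f b))"
    by (intro P.product_integrable_prod gauss_fourier_1) auto
  show "integrable lborel ?F"
    unfolding lborel_eq[where 'a='a] by (subst integrable_distr_eq) (use F i in auto)
  have "(LINT x|lborel. ?F x) = (LINT f|(\<Pi>\<^sub>M b\<in>Basis. lborel). ?F (?S f))"
    unfolding lborel_eq[where 'a='a] by (subst integral_distr) auto
  also have "\<dots> = (LINT f|(\<Pi>\<^sub>M b\<in>Basis. lborel). (\<Prod>b\<in>(Basis::'a set). ?g b (f b)))" by (simp only: F)
  also have "\<dots> = (\<Prod>b\<in>(Basis::'a set). LINT x|lborel. ?g b x)"
    by (rule P.product_integral_prod) (rule finite_Basis, rule gauss_fourier_1)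
  also have "\<dots> = (\<Prod>b\<in>(Basis::'a set). of_real (sqrt (2*pi) * exp (- (t \<bullet> b)\<^sup>2 / 2)))"
    by (simp only: gauss_fourier_1)
  also have "\<dots> = of_real (\<Prod>b\<in>(Basis::'a set). (sqrt (2*pi) * exp (- (t \<bullet> b)\<^sup>2 / 2)))" by simp
  also have "(\<Prod>b\<in>(Basis::'a set). (sqrt (2*pi) * exp (- (t \<bullet> b)\<^sup>2 / 2)))
     = sqrt (2*pi) ^ DIM('a) * exp (- (norm t)\<^sup>2 / 2)"
  proof -
    have "(norm t)\<^sup>2 = (\<Sum>b\<in>Basis. (t \<bullet> b)\<^sup>2)"
      unfolding power2_norm_eq_inner by (subst euclidean_inner) (simp add: power2_eq_square)
    then show ?thesis by (simp add: prod.distrib exp_sum[symmetric] sum_negf sum_divide_distrib)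
  qed
  finally show "(LINT x|lborel. ?F x) = of_real (sqrt (2*pi) ^ DIM('a) * exp (- (norm t)\<^sup>2 / 2))" .
qed

lemma gauss_fourier:
  fixes z :: "'a::euclidean_space"
  assumes s: "s > 0"
  shows "integrable lborel (\<lambda>x::'a. cis (z \<bullet> x) * of_real (exp (- s\<^sup>2 * (norm x)\<^sup>2 / 2)))"
    and "(LINT x|lborel. cis (z \<bullet> x) * of_real (exp (- s\<^sup>2 * (norm x)\<^sup>2 / 2)))
        = of_real ((sqrt (2*pi) / s) ^ DIM('a) * exp (- (norm z)\<^sup>2 / (2 * s\<^sup>2)))"
proof -
  \<comment> \<open>Rescaling by s reduces to the standard Gaussian at frequency
    \<open>z /\<^sub>R s\<close>; the Jacobian puts the power of s into the denominator.\<close>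
  let ?F = "\<lambda>x::'a. cis ((z /\<^sub>R s) \<bullet> x) * complex_of_real (exp (- (norm x)\<^sup>2 / 2))"
  have e: "cis (z \<bullet> x) * complex_of_real (exp (- s\<^sup>2 * (norm x)\<^sup>2 / 2)) = ?F (0 + s *\<^sub>R x)" for x
    using s by (simp add: power_mult_distrib mult.assoc[symmetric])
  show "integrable lborel (\<lambda>x::'a. cis (z \<bullet> x) * complex_of_real (exp (- s\<^sup>2 * (norm x)\<^sup>2 / 2)))"
    unfolding e using s lborel_integral_affine(1)[of s ?F 0] gauss_fourier_std(1)[of "z /\<^sub>R s"] by blast
  have "(LINT x|lborel. ?F x) = \<bar>s\<bar> ^ DIM('a) *\<^sub>R (LINT x|lborel. ?F (0 + s *\<^sub>R x))"
    using s by (intro lborel_integral_affine) auto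
  then have "(LINT x|lborel. ?F (0 + s *\<^sub>R x)) = (LINT x|lborel. ?F x) /\<^sub>R s ^ DIM('a)"
    using s by simp
  then show "(LINT x|lborel. cis (z \<bullet> x) * of_real (exp (- s\<^sup>2 * (norm x)\<^sup>2 / 2)))
        = of_real ((sqrt (2*pi) / s) ^ DIM('a) * exp (- (norm z)\<^sup>2 / (2 * s\<^sup>2)))"
    unfolding e gauss_fourier_std using s
    by (simp add: scaleR_conv_of_real power_divide power_mult_distrib field_simps)
qed


subsection \<open>Square integrable functions\<close>

lemma borel_measurable_cnj [measurable (raw)]:
  "f \<in> borel_measurable M \<Longrightarrow> (\<lambda>x. cnj (f x)) \<in> borel_measurable M"
  by (rule measurable_compose[of f M borel cnj]) (auto intro!: borel_measurable_continuous_onI continuous_intros)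

lemma L2_measurable [measurable_dest]: "f \<in> L2 \<Longrightarrow> f \<in> borel_measurable borel"
  by (simp add: L2_def)

lemma L2_integrable_square: "f \<in> L2 \<Longrightarrow> integrable lborel (\<lambda>x. (cmod (f x))\<^sup>2)"
  by (simp add: L2_def)

lemma L2I: "f \<in> borel_measurable borel \<Longrightarrow> integrable lborel (\<lambda>x. (cmod (f x))\<^sup>2) \<Longrightarrow> f \<in> L2"
  by (simp add: L2_def)

lemma L2_bound:
  assumes g: "g \<in> L2" and [measurable]: "f \<in> borel_measurable borel"
    and le: "AE x in lborel. cmod (f x) \<le> C * cmod (g x)"
  shows "f \<in> L2"
proof (rule L2I)
  have "integrable lborel (\<lambda>x. C\<^sup>2 * (cmod (g x))\<^sup>2)" using L2_integrable_square[OF g] by simp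
  then show "integrable lborel (\<lambda>x. (cmod (f x))\<^sup>2)"
  proof (rule Bochner_Integration.integrable_bound)
    show "AE x in lborel. norm ((cmod (f x))\<^sup>2) \<le> norm (C\<^sup>2 * (cmod (g x))\<^sup>2)"
      using le
    proof eventually_elim
      case (elim x)
      then have "(cmod (f x))\<^sup>2 \<le> (C * cmod (g x))\<^sup>2" by (rule power_mono) simp
      then show ?case by (simp add: power_mult_distrib)
    qed
  qed measurable
qed fact

lemma L2_zero [simp]: "(\<lambda>x. 0) \<in> L2" by (simp add: L2_def)

lemma L2_add: assumes "f \<in> L2" "g \<in> L2" shows "(\<lambda>x. f x + g x) \<in> L2"
proof (rule L2I)
  note [measurable] = assms[THEN L2_measurable]
  show "(\<lambda>x. f x + g x) \<in> borel_measurable borel" by measurable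
  have "integrable lborel (\<lambda>x. 2 * (cmod (f x))\<^sup>2 + 2 * (cmod (g x))\<^sup>2)"
    using assms[THEN L2_integrable_square] by simp
  then show "integrable lborel (\<lambda>x. (cmod (f x + g x))\<^sup>2)"
  proof (rule Bochner_Integration.integrable_bound)
    show "AE x in lborel. norm ((cmod (f x + g x))\<^sup>2) \<le> norm (2 * (cmod (f x))\<^sup>2 + 2 * (cmod (g x))\<^sup>2)"
    proof (rule AE_I2)
      fix x
      have "(cmod (f x + g x))\<^sup>2 \<le> (cmod (f x) + cmod (g x))\<^sup>2"
        by (rule power_mono) (auto intro: norm_triangle_ineq)
      also have "\<dots> \<le> 2 * (cmod (f x))\<^sup>2 + 2 * (cmod (g x))\<^sup>2"
        using zero_le_power2[of "cmod (f x) - cmod (g x)"] by (simp add: power2_eq_square algebra_simps)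
      finally show "norm ((cmod (f x + g x))\<^sup>2) \<le> norm (2 * (cmod (f x))\<^sup>2 + 2 * (cmod (g x))\<^sup>2)" by simp
    qed
  qed measurable
qed

lemma L2_mult_bounded:
  assumes "g \<in> L2" "h \<in> borel_measurable borel" "\<And>x. cmod (h x) \<le> C"
  shows "(\<lambda>x. h x * g x) \<in> L2"
  using assms by (intro L2_bound[OF assms(1), of _ C]) (auto simp: norm_mult intro!: mult_right_mono)

lemma L2_scale: "f \<in> L2 \<Longrightarrow> (\<lambda>x. c * f x) \<in> L2"
  by (rule L2_mult_bounded[of f "\<lambda>_. c" "cmod c"]) auto

lemma L2_uminus: "f \<in> L2 \<Longrightarrow> (\<lambda>x. - f x) \<in> L2" using L2_scale[of f "-1"] by simp

lemma L2_diff: "f \<in> L2 \<Longrightarrow> g \<in> L2 \<Longrightarrow> (\<lambda>x. f x - g x) \<in> L2"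
  using L2_add[of f "\<lambda>x. - g x"] L2_uminus[of g] by simp

lemma L2_cnj: "f \<in> L2 \<Longrightarrow> (\<lambda>x. cnj (f x)) \<in> L2"
  by (rule L2_bound[of f _ 1]) auto

lemma L2_sum: "(\<And>i. i \<in> A \<Longrightarrow> f i \<in> L2) \<Longrightarrow> (\<lambda>x. \<Sum>i\<in>A. f i x) \<in> L2"
  by (induction A rule: infinite_finite_induct) (auto intro: L2_add)

lemma L2_indicator: "f \<in> L2 \<Longrightarrow> S \<in> sets borel \<Longrightarrow> (\<lambda>x. of_real (indicator S x) * f x) \<in> L2"
  by (rule L2_mult_bounded[of f _ 1]) (auto simp: indicator_def)

lemma L2_ae_eq: "f \<in> L2 \<Longrightarrow> g \<in> borel_measurable borel \<Longrightarrow> ae_eq f g \<Longrightarrow> g \<in> L2"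
  by (rule L2_bound[of f g 1]) (auto simp: ae_eq_def)

lemma ae_eq_refl [simp]: "ae_eq f f" by (simp add: ae_eq_def)
lemma ae_eq_sym: "ae_eq f g \<Longrightarrow> ae_eq g f" by (auto simp: ae_eq_def)
lemma ae_eq_trans [trans]: "ae_eq f g \<Longrightarrow> ae_eq g h \<Longrightarrow> ae_eq f h"
  by (auto simp: ae_eq_def elim: eventually_elim2)

lemma L2_integrable_norm_mult:
  assumes "f \<in> L2" "g \<in> L2" shows "integrable lborel (\<lambda>x. cmod (f x) * cmod (g x))"
proof -
  note [measurable] = assms[THEN L2_measurable]
  have "integrable lborel (\<lambda>x. (cmod (f x))\<^sup>2 + (cmod (g x))\<^sup>2)"
    using assms[THEN L2_integrable_square] by simp
  then show ?thesis
  proof (rule Bochner_Integration.integrable_bound)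
    show "AE x in lborel. norm (cmod (f x) * cmod (g x)) \<le> norm ((cmod (f x))\<^sup>2 + (cmod (g x))\<^sup>2)"
    proof (rule AE_I2)
      fix x
      show "norm (cmod (f x) * cmod (g x)) \<le> norm ((cmod (f x))\<^sup>2 + (cmod (g x))\<^sup>2)"
        using sum_squares_bound[of "cmod (f x)" "cmod (g x)"]
          mult_nonneg_nonneg[OF norm_ge_zero[of "f x"] norm_ge_zero[of "g x"]]
        unfolding mult.assoc real_norm_def by linarith
    qed
  qed measurable
qed

lemma L2_integrable_mult:
  assumes "f \<in> L2" "g \<in> L2" shows "integrable lborel (\<lambda>x. f x * g x)"
proof -
  note [measurable] = assms[THEN L2_measurable]
  show ?thesis
    by (rule Bochner_Integration.integrable_bound[OF L2_integrable_norm_mult[OF assms]]) (auto simp: norm_mult)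
qed

lemma l2_norm_nonneg [simp]: "l2_norm f \<ge> 0" by (simp add: l2_norm_def)

lemma l2_norm_square: "(l2_norm f)\<^sup>2 = (LINT x|lborel. (cmod (f x))\<^sup>2)"
  by (simp add: l2_norm_def)

lemma nn_integral_l2_norm:
  "f \<in> L2 \<Longrightarrow> (\<integral>\<^sup>+x. ennreal ((cmod (f x))\<^sup>2) \<partial>lborel) = ennreal ((l2_norm f)\<^sup>2)"
  by (simp add: l2_norm_square nn_integral_eq_integral L2_integrable_square)

lemma l2_norm_cong: "ae_eq f g \<Longrightarrow> f \<in> borel_measurable borel \<Longrightarrow> g \<in> borel_measurable borel \<Longrightarrow> l2_norm f = l2_norm g"
  unfolding l2_norm_def ae_eq_def by (auto intro!: integral_cong_AE)

lemma l2_inner_cong: "ae_eq f f' \<Longrightarrow> ae_eq g g' \<Longrightarrow> f \<in> borel_measurable borel \<Longrightarrow> g \<in> borel_measurable borel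
   \<Longrightarrow> f' \<in> borel_measurable borel \<Longrightarrow> g' \<in> borel_measurable borel \<Longrightarrow> l2_inner f g = l2_inner f' g'"
  unfolding l2_inner_def ae_eq_def by (intro integral_cong_AE) (auto elim: eventually_elim2)

lemma l2_norm_eq_0_iff: "f \<in> L2 \<Longrightarrow> l2_norm f = 0 \<longleftrightarrow> ae_eq f (\<lambda>x. 0)"
  unfolding l2_norm_def ae_eq_def
  by (simp add: integral_nonneg_eq_0_iff_AE L2_integrable_square)

lemma l2_cauchy_schwarz_norm:
  assumes "f \<in> L2" "g \<in> L2"
  shows "(LINT x|lborel. cmod (f x) * cmod (g x)) \<le> l2_norm f * l2_norm g"
proof -
  note [measurable] = assms[THEN L2_measurable]
  note int = assms[THEN L2_integrable_square] L2_integrable_norm_mult[OF assms]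
  show ?thesis
  proof (cases "l2_norm f = 0 \<or> l2_norm g = 0")
    case True
    then have "AE x in lborel. f x = 0 \<or> g x = 0"
      using assms by (auto simp: l2_norm_eq_0_iff ae_eq_def)
    then have "AE x in lborel. cmod (f x) * cmod (g x) = 0" by eventually_elim auto
    then have "(LINT x|lborel. cmod (f x) * cmod (g x)) = 0"
      by (rule integral_eq_zero_AE)
    then show ?thesis by simp
  next
    case False
    let ?a = "l2_norm f" and ?b = "l2_norm g"
    have pos: "?a > 0" "?b > 0" using False by (simp_all add: less_le)
    \<comment> \<open>Weighted inequality of the arithmetic and geometric mean: the weights
      \<open>?b / ?a\<close> and \<open>?a / ?b\<close> make each term integrate to half of
      \<open>?a * ?b\<close>. They require positive norms, hence the case distinction.\<close>
    have le: "cmod (f x) * cmod (g x) \<le> (?b / ?a * (cmod (f x))\<^sup>2 + ?a / ?b * (cmod (g x))\<^sup>2) / 2" for x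
    proof -
      have "0 \<le> (?b * cmod (f x) - ?a * cmod (g x))\<^sup>2 / (2 * ?a * ?b)" using pos by simp
      also have "\<dots> = (?b / ?a * (cmod (f x))\<^sup>2 + ?a / ?b * (cmod (g x))\<^sup>2) / 2 - cmod (f x) * cmod (g x)"
        using pos by (simp add: field_simps power2_eq_square)
      finally show ?thesis by simp
    qed
    have "(LINT x|lborel. cmod (f x) * cmod (g x))
        \<le> (LINT x|lborel. (?b / ?a * (cmod (f x))\<^sup>2 + ?a / ?b * (cmod (g x))\<^sup>2) / 2)"
      by (rule integral_mono) (use int le in auto)
    also have "\<dots> = (?b / ?a * ?a\<^sup>2 + ?a / ?b * ?b\<^sup>2) / 2"
      using int by (simp add: l2_norm_square)
    also have "\<dots> = ?a * ?b" using pos by (simp add: power2_eq_square)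
    finally show ?thesis .
  qed
qed

lemma l2_cauchy_schwarz:
  assumes "f \<in> L2" "g \<in> L2"
  shows "cmod (LINT x|lborel. f x * g x) \<le> l2_norm f * l2_norm g"
proof -
  have "cmod (LINT x|lborel. f x * g x) \<le> (LINT x|lborel. cmod (f x * g x))" by (rule integral_norm_bound)
  also have "\<dots> \<le> l2_norm f * l2_norm g"
    using l2_cauchy_schwarz_norm[OF assms] by (simp add: norm_mult)
  finally show ?thesis .
qed

lemma l2_norm_triangle:
  assumes "f \<in> L2" "g \<in> L2"
  shows "l2_norm (\<lambda>x. f x + g x) \<le> l2_norm f + l2_norm g"
proof (rule power2_le_imp_le)
  note int = assms[THEN L2_integrable_square] L2_integrable_norm_mult[OF assms]
  have "(l2_norm (\<lambda>x. f x + g x))\<^sup>2 \<le> (LINT x|lborel. (cmod (f x))\<^sup>2 + (cmod (g x))\<^sup>2 + 2 * (cmod (f x) * cmod (g x)))"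
    unfolding l2_norm_square
  proof (rule integral_mono)
    fix x
    have "(cmod (f x + g x))\<^sup>2 \<le> (cmod (f x) + cmod (g x))\<^sup>2"
      by (rule power_mono) (auto intro: norm_triangle_ineq)
    then show "(cmod (f x + g x))\<^sup>2 \<le> (cmod (f x))\<^sup>2 + (cmod (g x))\<^sup>2 + 2 * (cmod (f x) * cmod (g x))"
      by (simp add: power2_eq_square algebra_simps)
  qed (use int L2_integrable_square[OF L2_add[OF assms]] in auto)
  also have "\<dots> = (l2_norm f)\<^sup>2 + (l2_norm g)\<^sup>2 + 2 * (LINT x|lborel. cmod (f x) * cmod (g x))"
    using int by (simp add: l2_norm_square)
  also have "\<dots> \<le> (l2_norm f + l2_norm g)\<^sup>2"
    using l2_cauchy_schwarz_norm[OF assms] by (simp add: power2_eq_square algebra_simps)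
  finally show "(l2_norm (\<lambda>x. f x + g x))\<^sup>2 \<le> (l2_norm f + l2_norm g)\<^sup>2" .
qed (auto intro: add_nonneg_nonneg)

lemma l2_norm_scale: "l2_norm (\<lambda>x. c * f x) = cmod c * l2_norm f"
  by (simp add: l2_norm_def norm_mult power_mult_distrib real_sqrt_mult)

lemma l2_norm_minus_commute: "l2_norm (\<lambda>x. f x - g x) = l2_norm (\<lambda>x. g x - f x)"
  by (simp add: l2_norm_def norm_minus_commute)

lemma l2_norm_cnj: "l2_norm (\<lambda>x. cnj (f x)) = l2_norm f" by (simp add: l2_norm_def)

lemma l2_norm_triangle_diff:
  assumes "f \<in> L2" "g \<in> L2" "h \<in> L2"
  shows "l2_norm (\<lambda>x. f x - h x) \<le> l2_norm (\<lambda>x. f x - g x) + l2_norm (\<lambda>x. g x - h x)"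
  using l2_norm_triangle[OF L2_diff[OF assms(1,2)] L2_diff[OF assms(2,3)]] by simp

lemma l2_norm_diff_ge:
  assumes "f \<in> L2" "g \<in> L2"
  shows "\<bar>l2_norm f - l2_norm g\<bar> \<le> l2_norm (\<lambda>x. f x - g x)"
  using l2_norm_triangle[OF L2_diff[OF assms] assms(2)]
    l2_norm_triangle[OF L2_diff[OF assms(2,1)] assms(1)] l2_norm_minus_commute[of f g] by simp

lemma l2_norm_tendsto:
  assumes "\<And>n. f n \<in> L2" "g \<in> L2" "(\<lambda>n. l2_norm (\<lambda>x. f n x - g x)) \<longlonglongrightarrow> 0"
  shows "(\<lambda>n. l2_norm (f n)) \<longlonglongrightarrow> l2_norm g"
proof -
  have "(\<lambda>n. l2_norm (f n) - l2_norm g) \<longlonglongrightarrow> 0"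
    by (rule Lim_null_comparison[OF _ assms(3)]) (use l2_norm_diff_ge assms in auto)
  then show ?thesis by (simp add: LIM_zero_iff)
qed

lemma l2_limit_unique:
  assumes "\<And>n. f n \<in> L2" "g \<in> L2" "h \<in> L2"
    "(\<lambda>n. l2_norm (\<lambda>x. f n x - g x)) \<longlonglongrightarrow> 0" "(\<lambda>n. l2_norm (\<lambda>x. f n x - h x)) \<longlonglongrightarrow> 0"
  shows "ae_eq g h"
proof -
  have "l2_norm (\<lambda>x. g x - h x) \<le> 0"
  proof (rule tendsto_lowerbound)
    show "(\<lambda>n. l2_norm (\<lambda>x. f n x - g x) + l2_norm (\<lambda>x. f n x - h x)) \<longlonglongrightarrow> 0"
      using tendsto_add[OF assms(4,5)] by simp
    show "\<forall>\<^sub>F n in sequentially. l2_norm (\<lambda>x. g x - h x) \<le> l2_norm (\<lambda>x. f n x - g x) + l2_norm (\<lambda>x. f n x - h x)"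
      using l2_norm_triangle_diff[OF assms(2) assms(1) assms(3)] by (auto simp: l2_norm_minus_commute[of g])
  qed simp
  then have "l2_norm (\<lambda>x. g x - h x) = 0" using l2_norm_nonneg[of "\<lambda>x. g x - h x"] by linarith
  then have "ae_eq (\<lambda>x. g x - h x) (\<lambda>x. 0)" using l2_norm_eq_0_iff[OF L2_diff[OF assms(2,3)]] by simp
  then show ?thesis by (auto simp: ae_eq_def)
qed

lemma l2_pairing_tendsto:
  assumes "\<And>n. f n \<in> L2" "f' \<in> L2" "(\<lambda>n. l2_norm (\<lambda>x. f n x - f' x)) \<longlonglongrightarrow> 0"
    and "\<And>n. g n \<in> L2" "g' \<in> L2" "(\<lambda>n. l2_norm (\<lambda>x. g n x - g' x)) \<longlonglongrightarrow> 0"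
  shows "(\<lambda>n. LINT x|lborel. f n x * g n x) \<longlonglongrightarrow> (LINT x|lborel. f' x * g' x)"
proof -
  have "(\<lambda>n. (LINT x|lborel. f n x * g n x) - (LINT x|lborel. f' x * g' x)) \<longlonglongrightarrow> 0"
  proof (rule Lim_null_comparison)
    show "(\<lambda>n. l2_norm (\<lambda>x. f n x - f' x) * l2_norm (g n) + l2_norm f' * l2_norm (\<lambda>x. g n x - g' x)) \<longlonglongrightarrow> 0"
      using tendsto_add[OF tendsto_mult[OF assms(3) l2_norm_tendsto[OF assms(4-6)]]
          tendsto_mult[OF tendsto_const assms(6)]] by simp
    show "\<forall>\<^sub>F n in sequentially. norm ((LINT x|lborel. f n x * g n x) - (LINT x|lborel. f' x * g' x))
       \<le> l2_norm (\<lambda>x. f n x - f' x) * l2_norm (g n) + l2_norm f' * l2_norm (\<lambda>x. g n x - g' x)"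
    proof (rule always_eventually, rule allI)
      fix n
      have "(LINT x|lborel. f n x * g n x) - (LINT x|lborel. f' x * g' x)
        = (LINT x|lborel. (f n x - f' x) * g n x) + (LINT x|lborel. f' x * (g n x - g' x))"
        using assms(1,2,4,5) L2_integrable_mult
        by (simp add: algebra_simps Bochner_Integration.integral_diff Bochner_Integration.integral_add L2_diff)
      then have "norm ((LINT x|lborel. f n x * g n x) - (LINT x|lborel. f' x * g' x))
       \<le> cmod (LINT x|lborel. (f n x - f' x) * g n x) + cmod (LINT x|lborel. f' x * (g n x - g' x))"
        by (simp only: norm_triangle_ineq)
      also have "\<dots> \<le> l2_norm (\<lambda>x. f n x - f' x) * l2_norm (g n) + l2_norm f' * l2_norm (\<lambda>x. g n x - g' x)"
        by (intro add_mono l2_cauchy_schwarz L2_diff assms)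
      finally show "norm ((LINT x|lborel. f n x * g n x) - (LINT x|lborel. f' x * g' x))
       \<le> l2_norm (\<lambda>x. f n x - f' x) * l2_norm (g n) + l2_norm f' * l2_norm (\<lambda>x. g n x - g' x)" .
    qed
  qed
  then show ?thesis by (simp add: LIM_zero_iff)
qed

lemma l2_inner_commute: "l2_inner g f = cnj (l2_inner f g)"
  unfolding l2_inner_def Bochner_Integration.integral_cnj[symmetric] by (simp add: mult.commute)

lemma l2_inner_self: "l2_inner f f = of_real ((l2_norm f)\<^sup>2)"
  unfolding l2_inner_def l2_norm_square integral_complex_of_real[symmetric] complex_norm_square ..

lemma l2_inner_add_left: "f \<in> L2 \<Longrightarrow> g \<in> L2 \<Longrightarrow> h \<in> L2 \<Longrightarrow>
   l2_inner (\<lambda>x. f x + g x) h = l2_inner f h + l2_inner g h"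
  unfolding l2_inner_def by (simp add: distrib_right L2_integrable_mult L2_cnj)

lemma l2_inner_add_right: "f \<in> L2 \<Longrightarrow> g \<in> L2 \<Longrightarrow> h \<in> L2 \<Longrightarrow>
   l2_inner h (\<lambda>x. f x + g x) = l2_inner h f + l2_inner h g"
  unfolding l2_inner_def by (simp add: distrib_left L2_integrable_mult L2_cnj)

lemma l2_inner_scale_right: "l2_inner h (\<lambda>x. c * f x) = cnj c * l2_inner h f"
  unfolding l2_inner_def by (simp add: mult.left_commute)

lemma l2_norm_add_square:
  assumes "f \<in> L2" "g \<in> L2"
  shows "(l2_norm (\<lambda>x. f x + g x))\<^sup>2 = (l2_norm f)\<^sup>2 + 2 * Re (l2_inner f g) + (l2_norm g)\<^sup>2"
proof -
  have "complex_of_real ((l2_norm (\<lambda>x. f x + g x))\<^sup>2)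
    = of_real ((l2_norm f)\<^sup>2) + (l2_inner f g + cnj (l2_inner f g)) + of_real ((l2_norm g)\<^sup>2)"
    unfolding l2_inner_self[symmetric] using assms
    by (simp add: l2_inner_add_left l2_inner_add_right L2_add l2_inner_commute[of g f])
  also have "\<dots> = complex_of_real ((l2_norm f)\<^sup>2 + 2 * Re (l2_inner f g) + (l2_norm g)\<^sup>2)"
    by (simp add: complex_add_cnj)
  finally show ?thesis using of_real_eq_iff by blast
qed

lemma l2_norm_diff_square:
  assumes "f \<in> L2" "g \<in> L2"
  shows "(l2_norm (\<lambda>x. f x - g x))\<^sup>2 = (l2_norm f)\<^sup>2 - 2 * Re (l2_inner f g) + (l2_norm g)\<^sup>2"
  using l2_norm_add_square[OF assms(1) L2_scale[OF assms(2), of "-1"]]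
  unfolding l2_norm_scale l2_inner_scale_right by simp

section \<open>Fatou's lemma and the completeness of \<open>L2\<close>\<close>

text \<open>Fatou's lemma for the squared moduli. Membership of the limit in \<open>L2\<close> is
  part of the conclusion, so it serves limits that are at first known only pointwise.\<close>

lemma l2_fatou:
  assumes f: "\<And>n. f n \<in> L2" and [measurable]: "g \<in> borel_measurable borel"
    and lim: "AE x in lborel. (\<lambda>n. f n x) \<longlonglongrightarrow> g x" and le: "\<forall>\<^sub>F n in sequentially. l2_norm (f n) \<le> C"
  shows "g \<in> L2" "l2_norm g \<le> C"
proof -
  note [measurable] = f[THEN L2_measurable]
  obtain n where "l2_norm (f n) \<le> C" using eventually_happens[OF le] by auto
  then have C: "C \<ge> 0" using l2_norm_nonneg[of "f n"] by linarith
  have "(\<integral>\<^sup>+x. ennreal ((cmod (g x))\<^sup>2) \<partial>lborel) = (\<integral>\<^sup>+x. liminf (\<lambda>n. ennreal ((cmod (f n x))\<^sup>2)) \<partial>lborel)"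
  proof (rule nn_integral_cong_AE)
    show "AE x in lborel. ennreal ((cmod (g x))\<^sup>2) = liminf (\<lambda>n. ennreal ((cmod (f n x))\<^sup>2))"
      using lim
    proof eventually_elim
      case (elim x)
      have "(\<lambda>n. ennreal ((cmod (f n x))\<^sup>2)) \<longlonglongrightarrow> ennreal ((cmod (g x))\<^sup>2)"
        by (intro tendsto_intros tendsto_ennrealI elim)
      from lim_imp_Liminf[OF _ this] show ?case by simp
    qed
  qed
  also have "\<dots> \<le> liminf (\<lambda>n. \<integral>\<^sup>+x. ennreal ((cmod (f n x))\<^sup>2) \<partial>lborel)"
    by (rule nn_integral_liminf) measurable
  also have "\<dots> = liminf (\<lambda>n. ennreal ((l2_norm (f n))\<^sup>2))" by (simp add: nn_integral_l2_norm f)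
  also have "\<dots> \<le> liminf (\<lambda>n. ennreal (C\<^sup>2))"
  proof (rule Liminf_mono)
    show "\<forall>\<^sub>F n in sequentially. ennreal ((l2_norm (f n))\<^sup>2) \<le> ennreal (C\<^sup>2)"
      using le by eventually_elim (intro ennreal_leI power_mono l2_norm_nonneg)
  qed
  also have "\<dots> = ennreal (C\<^sup>2)" by (simp add: Liminf_const)
  finally have *: "(\<integral>\<^sup>+x. ennreal ((cmod (g x))\<^sup>2) \<partial>lborel) \<le> ennreal (C\<^sup>2)" .
  show g: "g \<in> L2"
  proof (rule L2I)
    show "integrable lborel (\<lambda>x. (cmod (g x))\<^sup>2)"
      using le_less_trans[OF *] by (intro integrableI_bounded) auto
  qed fact
  have "(l2_norm g)\<^sup>2 \<le> C\<^sup>2" using * nn_integral_l2_norm[OF g] by simp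
  then show "l2_norm g \<le> C" using C power2_le_imp_le by blast
qed

text \<open>The weight \<open>(3/2) ^ n\<close> has two purposes. Against the squared bounds
  \<open>(1/4) ^ n\<close> it leaves the convergent series of \<open>(3/8) ^ n\<close>. Its inverse
  is summable, so \<open>2 * ?a \<le> ?d n x + (2/3) ^ n\<close> turns weighted summable squares
  into absolutely summable increments.\<close>

lemma l2_subseq_AE_convergent:
  assumes f: "\<And>n. f n \<in> L2" and step: "\<And>n. l2_norm (\<lambda>x. f (Suc n) x - f n x) \<le> (1/2) ^ n"
  shows "AE x in lborel. convergent (\<lambda>n. f n x)"
proof -
  note [measurable] = f[THEN L2_measurable]
  let ?d = "\<lambda>n x. (3/2) ^ n * (cmod (f (Suc n) x - f n x))\<^sup>2"
  have "(\<integral>\<^sup>+x. (\<Sum>n. ennreal (?d n x)) \<partial>lborel) = (\<Sum>n. \<integral>\<^sup>+x. ennreal (?d n x) \<partial>lborel)"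
    by (rule nn_integral_suminf) measurable
  also have "\<dots> \<le> (\<Sum>n. ennreal ((3/8) ^ n))"
  proof (rule suminf_le)
    fix n
    have "(\<integral>\<^sup>+x. ennreal (?d n x) \<partial>lborel) = ennreal ((3/2) ^ n * (l2_norm (\<lambda>x. f (Suc n) x - f n x))\<^sup>2)"
      using nn_integral_l2_norm[OF L2_diff[OF f f], of "Suc n" n]
      by (simp add: ennreal_mult nn_integral_cmult)
    also have "\<dots> \<le> ennreal ((3/2) ^ n * ((1/2) ^ n)\<^sup>2)"
      by (intro ennreal_leI mult_left_mono power_mono step) auto
    also have "(3/2) ^ n * ((1/2) ^ n)\<^sup>2 = (3/8 :: real) ^ n"
      by (simp add: power_mult_distrib[symmetric] power2_eq_square)
    finally show "(\<integral>\<^sup>+x. ennreal (?d n x) \<partial>lborel) \<le> ennreal ((3/8) ^ n)" .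
  qed auto
  also have "\<dots> < \<infinity>"
    by (subst suminf_ennreal2) (auto intro!: summable_geometric)
  finally have "AE x in lborel. (\<Sum>n. ennreal (?d n x)) \<noteq> \<infinity>"
    by (intro nn_integral_noteq_infinite) auto
  then show ?thesis
  proof eventually_elim
    case (elim x)
    have s: "summable (\<lambda>n. ?d n x)"
      by (rule summable_suminf_not_top) (use elim in auto)
    have "summable (\<lambda>n. cmod (f (Suc n) x - f n x))"
    proof (rule summable_comparison_test')
      show "summable (\<lambda>n. ?d n x + (2/3) ^ n)"
        by (intro summable_add s summable_geometric) auto
      fix n :: nat
      let ?a = "cmod (f (Suc n) x - f n x)" and ?r = "(2/3 :: real) ^ n"
      have r: "?r > 0" "(3/2 :: real) ^ n = 1 / ?r" by (auto simp: power_divide)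
      have "0 \<le> (?a - ?r)\<^sup>2 / ?r" using r by simp
      also have "\<dots> = ?d n x + ?r - 2 * ?a" unfolding r(2) using r(1) by (simp add: field_simps power2_eq_square)
      finally show "norm ?a \<le> ?d n x + ?r" by (smt (verit) norm_ge_zero real_norm_def)
    qed
    then have "summable (\<lambda>n. f (Suc n) x - f n x)" by (rule summable_norm_cancel)
    then have "convergent (\<lambda>n. \<Sum>i<n. f (Suc i) x - f i x)" by (simp add: summable_iff_convergent)
    then have "convergent (\<lambda>n. f n x - f 0 x)" using sum_lessThan_telescope[of "\<lambda>n. f n x"] by simp
    then show ?case using convergent_add_const_right_iff[of "\<lambda>n. f n x" "- f 0 x"] by simp
  qed
qed

theorem l2_complete:
  assumes f: "\<And>n. f n \<in> L2"
    and cauchy: "\<And>e. e > 0 \<Longrightarrow> \<exists>N. \<forall>m\<ge>N. \<forall>n\<ge>N. l2_norm (\<lambda>x. f m x - f n x) < e"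
  obtains g where "g \<in> L2" "(\<lambda>n. l2_norm (\<lambda>x. f n x - g x)) \<longlonglongrightarrow> 0"
proof -
  obtain N where N: "\<And>k m n. m \<ge> N k \<Longrightarrow> n \<ge> N k \<Longrightarrow> l2_norm (\<lambda>x. f m x - f n x) < (1/2 :: real) ^ k"
  proof -
    have "\<forall>k. \<exists>N. \<forall>m\<ge>N. \<forall>n\<ge>N. l2_norm (\<lambda>x. f m x - f n x) < (1/2 :: real) ^ k"
      by (intro allI cauchy) simp
    then show ?thesis using that by metis
  qed
  \<comment> \<open>Summing all \<open>N i\<close> makes the subsequence monotone while it dominates
    \<open>N k\<close>. The extra k gives \<open>r k \<ge> k\<close>, which later leads from
    \<open>j \<ge> N k\<close> to \<open>r j \<ge> N k\<close>.\<close>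
  define r where "r k = (\<Sum>i\<le>k. N i) + k" for k
  have r: "r k \<ge> N k" "r k \<le> r (Suc k)" "r k \<ge> k" for k
  proof -
    have "N k \<le> (\<Sum>i\<le>k. N i)" by (rule member_le_sum) auto
    then show "r k \<ge> N k" by (simp add: r_def)
  qed (auto simp: r_def)
  note [measurable] = f[THEN L2_measurable]
  have conv: "AE x in lborel. convergent (\<lambda>k. f (r k) x)"
    by (rule l2_subseq_AE_convergent[OF f less_imp_le[OF N[OF order_trans[OF r(1) r(2)] r(1)]]])
  define g where "g x = lim (\<lambda>k. f (r k) x)" for x
  have [measurable]: "g \<in> borel_measurable borel" unfolding g_def by measurable
  have lim: "AE x in lborel. (\<lambda>k. f (r k) x) \<longlonglongrightarrow> g x"
    using conv by eventually_elim (simp add: g_def convergent_LIMSEQ_iff)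
  \<comment> \<open>Fatou along the subsequence with n fixed: \<open>f n - f (r j)\<close> tends to
    \<open>f n - g\<close>, so the Cauchy bound passes to the limit.\<close>
  have *: "(\<lambda>x. f n x - g x) \<in> L2 \<and> l2_norm (\<lambda>x. f n x - g x) \<le> (1/2) ^ k" if n: "n \<ge> N k" for n k
  proof -
    have ev: "\<forall>\<^sub>F j in sequentially. l2_norm (\<lambda>x. f n x - f (r j) x) \<le> (1/2) ^ k"
      using eventually_ge_at_top[of "N k"]
    proof eventually_elim
      case (elim j)
      show ?case by (rule less_imp_le[OF N[OF n order_trans[OF elim r(3)]]])
    qed
    have "AE x in lborel. (\<lambda>j. f n x - f (r j) x) \<longlonglongrightarrow> f n x - g x"
      using lim by eventually_elim (intro tendsto_intros)
    then show ?thesis using l2_fatou[OF L2_diff[OF f f] _ _ ev, of "\<lambda>x. f n x - g x"] by auto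
  qed
  have "(\<lambda>x. f (N 0) x - (f (N 0) x - g x)) \<in> L2"
    by (rule L2_diff[OF f conjunct1[OF *[OF order_refl]]])
  then have g: "g \<in> L2" by simp
  have "(\<lambda>n. l2_norm (\<lambda>x. f n x - g x)) \<longlonglongrightarrow> 0"
  proof (rule LIMSEQ_I)
    fix e :: real assume "e > 0"
    then obtain k where k: "(1/2) ^ k < e" using real_arch_pow_inv[of e "1/2"] by auto
    have "norm (l2_norm (\<lambda>x. f n x - g x) - 0) < e" if "n \<ge> N k" for n
      using *[OF that] k by simp
    then show "\<exists>no. \<forall>n\<ge>no. norm (l2_norm (\<lambda>x. f n x - g x) - 0) < e" by blast
  qed
  with g show ?thesis by (rule that)
qed


subsection \<open>The Fourier transform of integrable functions\<close>

text \<open>The symmetric normalization \<open>(2 pi)^(-3/2)\<close>, for which the transform is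
  isometric.\<close>

definition fourier_const :: real where "fourier_const = 1 / sqrt (2 * pi) ^ 3"

definition fourier_L1 :: "wavefun \<Rightarrow> wavefun" where
  "fourier_L1 f \<xi> = of_real fourier_const * (LINT x|lborel. cis (- (\<xi> \<bullet> x)) * f x)"

lemma fourier_const_pos: "fourier_const > 0" by (simp add: fourier_const_def)

lemma fourier_const_square: "fourier_const\<^sup>2 = 1 / (2 * pi) ^ 3"
proof -
  have "(sqrt (2 * pi) ^ 3)\<^sup>2 = ((sqrt (2 * pi))\<^sup>2) ^ 3" by (simp only: power_mult[symmetric] mult.commute)
  also have "(sqrt (2 * pi))\<^sup>2 = 2 * pi" by simp
  finally show ?thesis by (simp only: fourier_const_def power_divide power_one)
qed

lemma integrable_cis_mult:
  fixes f :: "'a::euclidean_space \<Rightarrow> complex"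
  assumes "integrable lborel f" "g \<in> borel_measurable borel"
  shows "integrable lborel (\<lambda>x. cis (g x) * f x)"
proof -
  note [measurable] = assms(2) borel_measurable_integrable[OF assms(1)]
  show ?thesis
    by (rule Bochner_Integration.integrable_bound[OF assms(1)]) (auto simp: norm_mult)
qed

lemma fourier_L1_norm_le:
  assumes "integrable lborel f"
  shows "cmod (fourier_L1 f \<xi>) \<le> fourier_const * (LINT x|lborel. cmod (f x))"
proof -
  have "cmod (LINT x|lborel. cis (- (\<xi> \<bullet> x)) * f x) \<le> (LINT x|lborel. cmod (cis (- (\<xi> \<bullet> x)) * f x))"
    by (rule integral_norm_bound)
  then show ?thesis using fourier_const_pos by (simp add: fourier_L1_def norm_mult)
qed

lemma continuous_on_fourier_L1:
  assumes "integrable lborel f"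
  shows "continuous_on UNIV (fourier_L1 f)"
proof -
  note [measurable] = borel_measurable_integrable[OF assms]
  have "(\<lambda>n. LINT x|lborel. cis (- (u n \<bullet> x)) * f x) \<longlonglongrightarrow> (LINT x|lborel. cis (- (\<xi> \<bullet> x)) * f x)"
    if u: "u \<longlonglongrightarrow> \<xi>" for u :: "nat \<Rightarrow> R3" and \<xi>
  proof (rule integral_dominated_convergence)
    show "integrable lborel (\<lambda>x. cmod (f x))" using assms by simp
    show "AE x in lborel. (\<lambda>n. cis (- (u n \<bullet> x)) * f x) \<longlonglongrightarrow> cis (- (\<xi> \<bullet> x)) * f x"
      unfolding cis_conv_exp by (intro AE_I2 tendsto_intros u)
  qed (auto simp: norm_mult)
  then show ?thesis
    unfolding fourier_L1_def by (intro continuous_on_mult_left continuous_on_sequentiallyI) auto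
qed

lemma fourier_L1_measurable: "integrable lborel f \<Longrightarrow> fourier_L1 f \<in> borel_measurable borel"
  by (intro borel_measurable_continuous_onI continuous_on_fourier_L1)

lemma fourier_L1_add: "integrable lborel f \<Longrightarrow> integrable lborel g \<Longrightarrow>
    fourier_L1 (\<lambda>x. f x + g x) \<xi> = fourier_L1 f \<xi> + fourier_L1 g \<xi>"
  by (simp add: fourier_L1_def distrib_left integrable_cis_mult)

lemma fourier_L1_diff: "integrable lborel f \<Longrightarrow> integrable lborel g \<Longrightarrow>
    fourier_L1 (\<lambda>x. f x - g x) \<xi> = fourier_L1 f \<xi> - fourier_L1 g \<xi>"
  by (simp add: fourier_L1_def right_diff_distrib integrable_cis_mult)

lemma fourier_L1_scale: "fourier_L1 (\<lambda>x. c * f x) \<xi> = c * fourier_L1 f \<xi>"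
  by (simp add: fourier_L1_def mult.left_commute)

lemma integrable_product_mult:
  fixes f :: "'a::euclidean_space \<Rightarrow> complex" and g :: "'b::euclidean_space \<Rightarrow> complex"
  assumes "integrable lborel f" "integrable lborel g"
  shows "integrable (lborel \<Otimes>\<^sub>M lborel) (\<lambda>(x, y). f x * g y)"
proof (rule lborel_pair.Fubini_integrable)
  note [measurable] = assms[THEN borel_measurable_integrable]
  show "(\<lambda>(x, y). f x * g y) \<in> borel_measurable (lborel \<Otimes>\<^sub>M lborel)" by measurable
  show "integrable lborel (\<lambda>x. LINT y|lborel. norm (case (x, y) of (x, y) \<Rightarrow> f x * g y))"
    using assms by (simp add: norm_mult)
  show "AE x in lborel. integrable lborel (\<lambda>y. case (x, y) of (x, y) \<Rightarrow> f x * g y)"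
    using assms by simp
qed

text \<open>Fubini and the symmetry of the kernel \<open>cis (- (x \<bullet> y))\<close> in x and y.
  This is what later identifies the adjoint of the transform.\<close>

lemma fourier_L1_mult_formula:
  assumes "integrable lborel f" "integrable lborel g"
  shows "(LINT x|lborel. fourier_L1 f x * g x) = (LINT x|lborel. f x * fourier_L1 g x)"
proof -
  note [measurable] = assms[THEN borel_measurable_integrable]
  have "integrable (lborel \<Otimes>\<^sub>M lborel) (\<lambda>(x, y). cis (- (x \<bullet> y)) * (f y * g x))"
    by (rule Bochner_Integration.integrable_bound[OF integrable_product_mult[OF assms(2,1)]])
       (auto simp: norm_mult)
  from lborel_pair.Fubini_integral[OF this]
  have *: "(LINT y|lborel. LINT x|lborel. cis (- (x \<bullet> y)) * (f y * g x))
     = (LINT x|lborel. LINT y|lborel. cis (- (x \<bullet> y)) * (f y * g x))" .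
  have "(LINT x|lborel. fourier_L1 f x * g x)
      = (LINT x|lborel. of_real fourier_const * (LINT y|lborel. cis (- (x \<bullet> y)) * (f y * g x)))"
    unfolding fourier_L1_def by (simp add: mult.assoc[symmetric])
  also have "\<dots> = of_real fourier_const * (LINT x|lborel. LINT y|lborel. cis (- (x \<bullet> y)) * (f y * g x))"
    by (rule integral_mult_right_zero)
  also have "\<dots> = of_real fourier_const * (LINT y|lborel. LINT x|lborel. cis (- (x \<bullet> y)) * (f y * g x))"
    by (simp only: *)
  also have "\<dots> = (LINT y|lborel. of_real fourier_const * (LINT x|lborel. cis (- (x \<bullet> y)) * (f y * g x)))"
    by (rule integral_mult_right_zero[symmetric])
  also have "\<dots> = (LINT y|lborel. f y * fourier_L1 g y)"
  proof (rule Bochner_Integration.integral_cong)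
    fix y :: R3
    have "(LINT x|lborel. cis (- (x \<bullet> y)) * (f y * g x)) = (LINT x|lborel. f y * (cis (- (y \<bullet> x)) * g x))"
      by (simp add: inner_commute mult_ac)
    also have "\<dots> = f y * (LINT x|lborel. cis (- (y \<bullet> x)) * g x)" by (rule integral_mult_right_zero)
    finally show "of_real fourier_const * (LINT x|lborel. cis (- (x \<bullet> y)) * (f y * g x)) = f y * fourier_L1 g y"
      by (simp add: fourier_L1_def)
  qed simp
  finally show ?thesis .
qed

section \<open>Gaussian regularization and the isometry on integrable functions\<close>

text \<open>The density of the centred normal law with standard deviation s in each coordinate. It
  equals \<open>fourier_const\<^sup>2\<close> times the integral of the weight
  \<open>exp (- s\<^sup>2 * (norm \<xi>)\<^sup>2 / 2)\<close> against the character at z.\<close>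

definition gauss_kernel :: "real \<Rightarrow> R3 \<Rightarrow> real" where
  "gauss_kernel s z = (1 / (sqrt (2 * pi) * s)) ^ 3 * exp (- (norm z)\<^sup>2 / (2 * s\<^sup>2))"

lemma gauss_kernel_measurable [measurable]: "gauss_kernel s \<in> borel_measurable borel"
  unfolding gauss_kernel_def by measurable

lemma gauss_kernel_nonneg: "s > 0 \<Longrightarrow> gauss_kernel s z \<ge> 0"
  by (simp add: gauss_kernel_def)

lemma gauss_kernel_integral:
  assumes "s > 0"
  shows "integrable lborel (gauss_kernel s)" "(LINT z|lborel. gauss_kernel s z) = 1"
proof -
  let ?e = "\<lambda>x::R3. exp (- (norm x)\<^sup>2 / (2 * s\<^sup>2))"
  have eq: "cis (0 \<bullet> x) * complex_of_real (exp (- (1/s)\<^sup>2 * (norm x)\<^sup>2 / 2)) = of_real (?e x)" for x :: R3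
    using assms by (simp add: power_divide)
  have i: "integrable lborel ?e"
    using gauss_fourier(1)[of "1/s" "0::R3"] assms unfolding eq by (simp add: complex_of_real_integrable_eq)
  then show "integrable lborel (gauss_kernel s)" unfolding gauss_kernel_def by simp
  have "complex_of_real (LINT x|lborel. ?e x) = of_real ((sqrt (2*pi) * s) ^ 3)"
    using gauss_fourier(2)[of "1/s" "0::R3"] assms unfolding eq by simp
  then have "(LINT x|lborel. ?e x) = (sqrt (2*pi) * s) ^ 3" by (simp only: of_real_eq_iff)
  then show "(LINT z|lborel. gauss_kernel s z) = 1"
    unfolding gauss_kernel_def using assms by (simp add: power_divide)
qed

text \<open>
  Regularizing with a Gaussian turns \<open>\<parallel>fourier_L1 f\<parallel>\<^sup>2\<close> into a double integral of \<open>f\<close> against the heat kernel.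
  Estimating it by \<open>2 |f x| |f y| \<le> |f x|\<^sup>2 + |f y|\<^sup>2\<close> gives a contraction for all \<open>f\<close>, so that equality has to be
  checked on a dense class only.
\<close>

lemma fourier_L1_gauss_identity:
  assumes f: "integrable lborel f" and s: "s > 0"
  shows "integrable lborel (\<lambda>\<xi>. (cmod (fourier_L1 f \<xi>))\<^sup>2 * exp (- s\<^sup>2 * (norm \<xi>)\<^sup>2 / 2))"
    and "integrable (lborel \<Otimes>\<^sub>M lborel) (\<lambda>(x, y). f x * cnj (f y) * of_real (gauss_kernel s (x - y)))"
    and "of_real (LINT \<xi>|lborel. (cmod (fourier_L1 f \<xi>))\<^sup>2 * exp (- s\<^sup>2 * (norm \<xi>)\<^sup>2 / 2))
       = (LINT p|(lborel \<Otimes>\<^sub>M lborel). f (fst p) * cnj (f (snd p)) * of_real (gauss_kernel s (fst p - snd p)))"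
proof -
  note [measurable] = borel_measurable_integrable[OF f] fourier_L1_measurable[OF f]
  let ?e = "\<lambda>\<xi>::R3. exp (- s\<^sup>2 * (norm \<xi>)\<^sup>2 / 2)"
  let ?P = "\<lambda>p. f (fst p) * cnj (f (snd p))"
  have e: "integrable lborel (\<lambda>\<xi>::R3. complex_of_real (?e \<xi>))"
    using gauss_fourier(1)[of s "0::R3"] s by simp
  then have er: "integrable lborel ?e" by (simp add: complex_of_real_integrable_eq)
  have "integrable (lborel \<Otimes>\<^sub>M lborel) (\<lambda>(x, y). f x * cnj (f y))"
    using f by (intro integrable_product_mult) auto
  then have P': "integrable (lborel \<Otimes>\<^sub>M lborel) ?P" by (simp add: split_beta')
  then have P: "integrable lborel ?P" by (simp add: lborel_prod)
  show "integrable lborel (\<lambda>\<xi>. (cmod (fourier_L1 f \<xi>))\<^sup>2 * ?e \<xi>)"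
  proof (rule Bochner_Integration.integrable_bound)
    show "integrable lborel (\<lambda>\<xi>. (fourier_const * (LINT x|lborel. cmod (f x)))\<^sup>2 * ?e \<xi>)" using er by simp
    show "AE \<xi> in lborel. norm ((cmod (fourier_L1 f \<xi>))\<^sup>2 * ?e \<xi>) \<le> norm ((fourier_const * (LINT x|lborel. cmod (f x)))\<^sup>2 * ?e \<xi>)"
      using fourier_L1_norm_le[OF f] by (intro AE_I2) (auto simp: abs_mult intro!: mult_right_mono power_mono)
  qed measurable
  \<comment> \<open>The kernel is bounded by its value at 0, so a multiple of \<open>?P\<close>
    dominates the double integrand.\<close>
  have g_le: "gauss_kernel s z \<le> (1 / (sqrt (2 * pi) * s)) ^ 3" for z
    using s unfolding gauss_kernel_def by (intro mult_left_le) auto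
  show "integrable (lborel \<Otimes>\<^sub>M lborel) (\<lambda>(x, y). f x * cnj (f y) * of_real (gauss_kernel s (x - y)))"
  proof (rule Bochner_Integration.integrable_bound)
    show "integrable (lborel \<Otimes>\<^sub>M lborel) (\<lambda>p. of_real ((1 / (sqrt (2 * pi) * s)) ^ 3) * ?P p)"
      using P' by simp
    show "AE p in lborel \<Otimes>\<^sub>M lborel. cmod (case p of (x, y) \<Rightarrow> f x * cnj (f y) * of_real (gauss_kernel s (x - y)))
        \<le> cmod (of_real ((1 / (sqrt (2 * pi) * s)) ^ 3) * ?P p)"
    proof (rule AE_I2, clarify)
      fix x y
      have "\<bar>gauss_kernel s (x - y)\<bar> * (cmod (f x) * cmod (f y)) \<le> \<bar>(1 / (sqrt (2 * pi) * s)) ^ 3\<bar> * (cmod (f x) * cmod (f y))"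
        using g_le[of "x - y"] gauss_kernel_nonneg[OF s, of "x - y"] by (intro mult_right_mono) auto
      then show "cmod (f x * cnj (f y) * of_real (gauss_kernel s (x - y)))
        \<le> cmod (of_real ((1 / (sqrt (2 * pi) * s)) ^ 3) * ?P (x, y))"
        by (simp only: norm_mult norm_of_real complex_mod_cnj fst_conv snd_conv mult_ac)
    qed
  qed measurable
  have sq: "complex_of_real ((cmod (fourier_L1 f \<xi>))\<^sup>2)
      = of_real (fourier_const\<^sup>2) * (LINT p|lborel. cis (- (\<xi> \<bullet> (fst p - snd p))) * ?P p)" for \<xi>
  proof -
    let ?f = "\<lambda>x. cis (- (\<xi> \<bullet> x)) * f x"
    have fi: "integrable lborel ?f" by (rule integrable_cis_mult[OF f]) measurable
    have i: "integrable (lborel \<Otimes>\<^sub>M lborel) (\<lambda>(x, y). ?f x * cnj (?f y))"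
      by (intro integrable_product_mult fi Bochner_Integration.integrable_cnj)
    have "(LINT x|lborel. ?f x) * cnj (LINT x|lborel. ?f x) = (LINT x|lborel. ?f x * (LINT y|lborel. cnj (?f y)))"
      by (simp only: Bochner_Integration.integral_cnj integral_mult_left_zero)
    also have "\<dots> = (LINT x|lborel. LINT y|lborel. ?f x * cnj (?f y))"
      by (simp only: integral_mult_right_zero)
    also have "\<dots> = (LINT p|(lborel \<Otimes>\<^sub>M lborel). (\<lambda>(x, y). ?f x * cnj (?f y)) p)"
      using lborel_pair.integral_fst[OF i] by simp
    also have "\<dots> = (LINT p|lborel. cis (- (\<xi> \<bullet> (fst p - snd p))) * ?P p)"
      unfolding lborel_prod
    proof (rule Bochner_Integration.integral_cong)
      fix p :: "R3 \<times> R3"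
      have "cis (- (\<xi> \<bullet> (fst p - snd p))) = cis (- (\<xi> \<bullet> fst p)) * cis (\<xi> \<bullet> snd p)"
        by (simp add: cis_mult inner_diff_right)
      then show "(\<lambda>(x, y). ?f x * cnj (?f y)) p = cis (- (\<xi> \<bullet> (fst p - snd p))) * ?P p"
        by (simp add: split_beta cis_cnj mult_ac)
    qed simp
    finally have "(LINT x|lborel. ?f x) * cnj (LINT x|lborel. ?f x)
        = (LINT p|lborel. cis (- (\<xi> \<bullet> (fst p - snd p))) * ?P p)" .
    then show ?thesis
      unfolding complex_norm_square fourier_L1_def by (simp add: power2_eq_square mult_ac)
  qed
  \<comment> \<open>The pair p is kept as a single variable, so that one Fubini exchange with \<xi>,
    dominated by the product of \<open>?e\<close> and \<open>?P\<close>, replaces a threefold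
    one.\<close>
  let ?H = "\<lambda>\<xi> p. complex_of_real (?e \<xi>) * (cis (- (\<xi> \<bullet> (fst p - snd p))) * ?P p)"
  have "integrable (lborel \<Otimes>\<^sub>M lborel) (\<lambda>(\<xi>, p). ?H \<xi> p)"
  proof (rule Bochner_Integration.integrable_bound[OF integrable_product_mult[OF e P]])
    have 1: "(\<lambda>q::R3 \<times> (R3 \<times> R3). complex_of_real (?e (fst q)) * cis (- (fst q \<bullet> (fst (snd q) - snd (snd q)))))
        \<in> borel_measurable borel"
      by (intro borel_measurable_continuous_onI continuous_intros) auto
    have 2: "(\<lambda>q::R3 \<times> (R3 \<times> R3). ?P (snd q)) \<in> borel_measurable borel"
    proof (rule measurable_compose[of snd borel borel ?P])
      show "(snd :: R3 \<times> (R3 \<times> R3) \<Rightarrow> _) \<in> borel_measurable borel"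
        by (intro borel_measurable_continuous_onI continuous_intros)
      show "?P \<in> borel_measurable borel" using borel_measurable_integrable[OF P] by simp
    qed
    show "(\<lambda>(\<xi>, p). ?H \<xi> p) \<in> borel_measurable (lborel \<Otimes>\<^sub>M lborel)"
      using borel_measurable_times[OF 1 2] by (simp add: lborel_prod split_beta' mult.assoc)
  qed (auto simp: norm_mult)
  from lborel_pair.Fubini_integral[OF this]
  have swap: "(LINT p|lborel. LINT \<xi>|lborel. ?H \<xi> p) = (LINT \<xi>|lborel. LINT p|lborel. ?H \<xi> p)" .
  have "of_real (LINT \<xi>|lborel. (cmod (fourier_L1 f \<xi>))\<^sup>2 * ?e \<xi>)
      = (LINT \<xi>|lborel. of_real (fourier_const\<^sup>2) * (LINT p|lborel. ?H \<xi> p))"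
    unfolding integral_complex_of_real[symmetric] of_real_mult sq
    by (intro Bochner_Integration.integral_cong refl, simp only: integral_mult_right_zero) (simp only: mult_ac)
  also have "\<dots> = of_real (fourier_const\<^sup>2) * (LINT p|lborel. LINT \<xi>|lborel. ?H \<xi> p)"
    unfolding swap by (rule integral_mult_right_zero)
  also have "\<dots> = (LINT p|lborel. of_real (fourier_const\<^sup>2) * (LINT \<xi>|lborel. ?H \<xi> p))"
    by (rule integral_mult_right_zero[symmetric])
  also have "\<dots> = (LINT p|lborel. ?P p * of_real (gauss_kernel s (fst p - snd p)))"
  proof (rule Bochner_Integration.integral_cong)
    fix p :: "R3 \<times> R3"
    \<comment> \<open>Reversing the difference removes the minus sign in the character; the kernel
      is even, so the sign is lost in the result.\<close>
    let ?z = "snd p - fst p"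
    have "(LINT \<xi>|lborel. ?H \<xi> p) = (LINT \<xi>|lborel. ?P p * (cis (?z \<bullet> \<xi>) * complex_of_real (?e \<xi>)))"
      by (intro Bochner_Integration.integral_cong refl)
         (simp add: inner_commute inner_diff_right mult_ac)
    also have "\<dots> = ?P p * of_real ((sqrt (2*pi) / s) ^ 3 * exp (- (norm ?z)\<^sup>2 / (2 * s\<^sup>2)))"
      using gauss_fourier(2)[OF s, of ?z] by (simp only: integral_mult_right_zero) simp
    finally have *: "(LINT \<xi>|lborel. ?H \<xi> p) = \<dots>" .
    have k: "fourier_const\<^sup>2 * ((sqrt (2*pi) / s) ^ 3 * exp (- (norm ?z)\<^sup>2 / (2 * s\<^sup>2))) = gauss_kernel s (fst p - snd p)"
      unfolding gauss_kernel_def fourier_const_def using s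
      by (simp add: norm_minus_commute field_simps power2_eq_square)
    show "of_real (fourier_const\<^sup>2) * (LINT \<xi>|lborel. ?H \<xi> p) = ?P p * of_real (gauss_kernel s (fst p - snd p))"
      unfolding * k[symmetric] by (simp only: of_real_mult mult_ac)
  qed simp
  finally show "of_real (LINT \<xi>|lborel. (cmod (fourier_L1 f \<xi>))\<^sup>2 * ?e \<xi>)
       = (LINT p|(lborel \<Otimes>\<^sub>M lborel). ?P p * of_real (gauss_kernel s (fst p - snd p)))"
    by (simp only: lborel_prod)
qed

lemma gauss_kernel_shift:
  assumes s: "s > 0"
  shows "(\<integral>\<^sup>+y. ennreal (gauss_kernel s (x - y)) \<partial>lborel) = 1" "(\<integral>\<^sup>+x. ennreal (gauss_kernel s (x - y)) \<partial>lborel) = 1"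
proof -
  have *: "(\<integral>\<^sup>+y. ennreal (gauss_kernel s (t + c *\<^sub>R y)) \<partial>lborel) = 1" if "c \<in> {1, -1}" for c t
  proof -
    have c: "c \<noteq> 0" "\<bar>c\<bar> = 1" using that by auto
    have "integrable lborel (\<lambda>y. gauss_kernel s (t + c *\<^sub>R y))"
      using lborel_integral_affine(1)[OF c(1), of "gauss_kernel s" t] gauss_kernel_integral(1)[OF s] by simp
    moreover have "(LINT y|lborel. gauss_kernel s (t + c *\<^sub>R y)) = 1"
      using lborel_integral_affine(2)[OF c(1), of "gauss_kernel s" t] gauss_kernel_integral(2)[OF s] c by simp
    ultimately show ?thesis
      using gauss_kernel_nonneg[OF s] by (subst nn_integral_eq_integral) auto
  qed
  show "(\<integral>\<^sup>+y. ennreal (gauss_kernel s (x - y)) \<partial>lborel) = 1" using *[of "-1" x] by simp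
  show "(\<integral>\<^sup>+x. ennreal (gauss_kernel s (x - y)) \<partial>lborel) = 1" using *[of 1 "- y"] by simp
qed

text \<open>A Schur test: the kernel has mass 1 in either variable, so each half square contributes
  \<open>(l2_norm f)\<^sup>2 / 2\<close>. Nonnegative integrals allow Tonelli for f that is merely
  square integrable.\<close>

lemma gauss_kernel_form_le:
  assumes f: "f \<in> L2" and s: "s > 0"
  shows "(\<integral>\<^sup>+p. ennreal (cmod (f (fst p)) * cmod (f (snd p)) * gauss_kernel s (fst p - snd p)) \<partial>(lborel \<Otimes>\<^sub>M lborel))
     \<le> ennreal ((l2_norm f)\<^sup>2)"
proof -
  note [measurable] = L2_measurable[OF f]
  let ?M = "(lborel :: R3 measure) \<Otimes>\<^sub>M (lborel :: R3 measure)"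
  let ?g = "\<lambda>p. gauss_kernel s (fst p - snd p)"
  let ?q = "\<lambda>x. ennreal ((cmod (f x))\<^sup>2 / 2)"
  have half: "(\<integral>\<^sup>+x. ?q x \<partial>lborel) = ennreal ((l2_norm f)\<^sup>2 / 2)"
    using L2_integrable_square[OF f] by (subst nn_integral_eq_integral) (auto simp: l2_norm_square)
  have "(\<integral>\<^sup>+p. ?q (fst p) * ennreal (?g p) \<partial>?M) = (\<integral>\<^sup>+x. \<integral>\<^sup>+y. ?q x * ennreal (gauss_kernel s (x - y)) \<partial>lborel \<partial>lborel)"
    by (subst lborel.nn_integral_fst[symmetric]) auto
  also have "\<dots> = ennreal ((l2_norm f)\<^sup>2 / 2)"
    by (simp add: nn_integral_cmult gauss_kernel_shift s half)
  finally have 1: "(\<integral>\<^sup>+p. ?q (fst p) * ennreal (?g p) \<partial>?M) = ennreal ((l2_norm f)\<^sup>2 / 2)" .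
  have "(\<integral>\<^sup>+p. ?q (snd p) * ennreal (?g p) \<partial>?M) = (\<integral>\<^sup>+y. \<integral>\<^sup>+x. ?q y * ennreal (gauss_kernel s (x - y)) \<partial>lborel \<partial>lborel)"
    by (subst lborel_pair.nn_integral_snd[symmetric]) auto
  also have "\<dots> = ennreal ((l2_norm f)\<^sup>2 / 2)"
    by (simp add: nn_integral_cmult gauss_kernel_shift s half)
  finally have 2: "(\<integral>\<^sup>+p. ?q (snd p) * ennreal (?g p) \<partial>?M) = ennreal ((l2_norm f)\<^sup>2 / 2)" .
  have "(\<integral>\<^sup>+p. ennreal (cmod (f (fst p)) * cmod (f (snd p)) * ?g p) \<partial>?M)
      \<le> (\<integral>\<^sup>+p. ?q (fst p) * ennreal (?g p) + ?q (snd p) * ennreal (?g p) \<partial>?M)"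
  proof (rule nn_integral_mono)
    fix p :: "R3 \<times> R3"
    have "cmod (f (fst p)) * cmod (f (snd p)) \<le> (cmod (f (fst p)))\<^sup>2 / 2 + (cmod (f (snd p)))\<^sup>2 / 2"
      using sum_squares_bound[of "cmod (f (fst p))" "cmod (f (snd p))"] by simp
    then have "cmod (f (fst p)) * cmod (f (snd p)) * ?g p \<le> ((cmod (f (fst p)))\<^sup>2 / 2 + (cmod (f (snd p)))\<^sup>2 / 2) * ?g p"
      using gauss_kernel_nonneg[OF s] by (intro mult_right_mono) auto
    moreover have e: "ennreal ((u + v) * w) = ennreal u * ennreal w + ennreal v * ennreal w"
      if "u \<ge> 0" "v \<ge> 0" "w \<ge> 0" for u v w :: real
      using that by (simp add: ennreal_mult distrib_right)
    have "?q (fst p) * ennreal (?g p) + ?q (snd p) * ennreal (?g p)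
        = ennreal (((cmod (f (fst p)))\<^sup>2 / 2 + (cmod (f (snd p)))\<^sup>2 / 2) * ?g p)"
      by (rule e[symmetric]) (auto intro: gauss_kernel_nonneg[OF s])
    ultimately show "ennreal (cmod (f (fst p)) * cmod (f (snd p)) * ?g p) \<le> ?q (fst p) * ennreal (?g p) + ?q (snd p) * ennreal (?g p)"
      by (simp only: ennreal_leI)
  qed
  also have "\<dots> = ennreal ((l2_norm f)\<^sup>2 / 2) + ennreal ((l2_norm f)\<^sup>2 / 2)"
    by (subst nn_integral_add) (auto simp: 1 2)
  also have "\<dots> = ennreal ((l2_norm f)\<^sup>2)" by (simp add: ennreal_plus[symmetric] del: ennreal_plus)
  finally show ?thesis .
qed

lemma fourier_L1_gauss_le:
  assumes f: "integrable lborel f" "f \<in> L2" and s: "s > 0"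
  shows "(LINT \<xi>|lborel. (cmod (fourier_L1 f \<xi>))\<^sup>2 * exp (- s\<^sup>2 * (norm \<xi>)\<^sup>2 / 2)) \<le> (l2_norm f)\<^sup>2"
proof -
  let ?I = "LINT \<xi>|lborel. (cmod (fourier_L1 f \<xi>))\<^sup>2 * exp (- s\<^sup>2 * (norm \<xi>)\<^sup>2 / 2)"
  let ?h = "\<lambda>p. f (fst p) * cnj (f (snd p)) * of_real (gauss_kernel s (fst p - snd p))"
  have "ennreal (cmod (LINT p|(lborel \<Otimes>\<^sub>M lborel). ?h p)) \<le> (\<integral>\<^sup>+p. ennreal (cmod (?h p)) \<partial>(lborel \<Otimes>\<^sub>M lborel))"
    using fourier_L1_gauss_identity(2)[OF f(1) s] by (intro integral_norm_bound_ennreal) (simp add: split_beta')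
  also have "\<dots> = (\<integral>\<^sup>+p. ennreal (cmod (f (fst p)) * cmod (f (snd p)) * gauss_kernel s (fst p - snd p)) \<partial>(lborel \<Otimes>\<^sub>M lborel))"
    using gauss_kernel_nonneg[OF s] by (simp add: norm_mult)
  also have "\<dots> \<le> ennreal ((l2_norm f)\<^sup>2)" by (rule gauss_kernel_form_le[OF f(2) s])
  finally have "cmod (LINT p|(lborel \<Otimes>\<^sub>M lborel). ?h p) \<le> (l2_norm f)\<^sup>2" by simp
  then have "cmod (of_real ?I) \<le> (l2_norm f)\<^sup>2" unfolding fourier_L1_gauss_identity(3)[OF f(1) s] .
  then show ?thesis by simp
qed

text \<open>The Gaussian weight tends to 1 along \<open>1 / Suc n\<close>, and Fatou's lemma yields
  square integrability together with the bound.\<close>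

lemma fourier_L1_contraction:
  assumes f: "integrable lborel f" "f \<in> L2"
  shows "fourier_L1 f \<in> L2" "l2_norm (fourier_L1 f) \<le> l2_norm f"
proof -
  note [measurable] = fourier_L1_measurable[OF f(1)]
  let ?s = "\<lambda>n. 1 / real (Suc n)"
  \<comment> \<open>The exponent is divided by 4 rather than 2 because this factor is squared inside
    the norm.\<close>
  let ?u = "\<lambda>n \<xi>. of_real (exp (- (?s n)\<^sup>2 * (norm \<xi>)\<^sup>2 / 4)) * fourier_L1 f \<xi>"
  have eq: "(cmod (?u n \<xi>))\<^sup>2 = (cmod (fourier_L1 f \<xi>))\<^sup>2 * exp (- (?s n)\<^sup>2 * (norm \<xi>)\<^sup>2 / 2)" for n \<xi>
    by (simp add: norm_mult power_mult_distrib exp_double[symmetric] mult.commute)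
  have u: "?u n \<in> L2" for n
  proof (rule L2I)
    show "integrable lborel (\<lambda>\<xi>. (cmod (?u n \<xi>))\<^sup>2)"
      unfolding eq by (rule fourier_L1_gauss_identity(1)[OF f(1)]) simp
  qed measurable
  have le: "l2_norm (?u n) \<le> l2_norm f" for n
  proof (rule power2_le_imp_le)
    show "(l2_norm (?u n))\<^sup>2 \<le> (l2_norm f)\<^sup>2"
      unfolding l2_norm_square[of "?u n"] eq by (rule fourier_L1_gauss_le[OF f]) simp
  qed simp
  have lim: "AE \<xi> in lborel. (\<lambda>n. ?u n \<xi>) \<longlonglongrightarrow> fourier_L1 f \<xi>"
  proof (rule AE_I2)
    fix \<xi> :: R3
    have "(\<lambda>n. ?u n \<xi>) \<longlonglongrightarrow> of_real (exp (- 0\<^sup>2 * (norm \<xi>)\<^sup>2 / 4)) * fourier_L1 f \<xi>"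
      by (intro tendsto_intros LIMSEQ_Suc lim_1_over_n) auto
    then show "(\<lambda>n. ?u n \<xi>) \<longlonglongrightarrow> fourier_L1 f \<xi>" by simp
  qed
  show "fourier_L1 f \<in> L2" "l2_norm (fourier_L1 f) \<le> l2_norm f"
    using l2_fatou[OF u _ lim, of "l2_norm f"] le by auto
qed

lemma l2_dominated_convergence:
  assumes w: "w \<in> L2" and [measurable]: "\<And>n. f n \<in> borel_measurable borel" "g \<in> borel_measurable borel"
    and lim: "AE x in lborel. (\<lambda>n. f n x) \<longlonglongrightarrow> g x"
    and le: "\<And>n. AE x in lborel. cmod (f n x - g x) \<le> cmod (w x)"
  shows "(\<lambda>n. l2_norm (\<lambda>x. f n x - g x)) \<longlonglongrightarrow> 0"
proof -
  have "(\<lambda>n. LINT x|lborel. (cmod (f n x - g x))\<^sup>2) \<longlonglongrightarrow> integral\<^sup>L (lborel :: R3 measure) (\<lambda>x. 0 :: real)"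
  proof (rule integral_dominated_convergence[where w="\<lambda>x. (cmod (w x))\<^sup>2"])
    show "AE x in lborel. (\<lambda>n. (cmod (f n x - g x))\<^sup>2) \<longlonglongrightarrow> 0"
      using lim
    proof eventually_elim
      case (elim x)
      have "(\<lambda>n. (cmod (f n x - g x))\<^sup>2) \<longlonglongrightarrow> (cmod (g x - g x))\<^sup>2" by (intro tendsto_intros elim)
      then show ?case by simp
    qed
    show "AE x in lborel. norm ((cmod (f n x - g x))\<^sup>2) \<le> (cmod (w x))\<^sup>2" for n
      using le[of n] by eventually_elim (simp add: power_mono)
  qed (use L2_integrable_square[OF w] in auto)
  from tendsto_real_sqrt[OF this] show ?thesis
    unfolding l2_norm_def by (simp only: Bochner_Integration.integral_zero real_sqrt_zero)
qed

lemma continuous_compact_support: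
  fixes f :: "'a::euclidean_space \<Rightarrow> complex"
  assumes c: "continuous_on UNIV f" and z: "\<And>x. norm x > R \<Longrightarrow> f x = 0"
  obtains M where "\<And>x. cmod (f x) \<le> M" "M > 0" "integrable lborel f" "integrable lborel (\<lambda>x. (cmod (f x))\<^sup>2)"
proof -
  have c': "continuous_on (cball 0 R) f" using c continuous_on_subset by blast
  have "bounded (f ` cball 0 R)" by (intro compact_imp_bounded compact_continuous_image c') auto
  then obtain M where M': "\<forall>w\<in>f ` cball 0 R. cmod w \<le> M" and M0: "M > 0"
    unfolding bounded_pos by blast
  then have M: "cmod (f x) \<le> M" if "norm x \<le> R" for x using that by simp
  have "cmod (f x) \<le> M" for x using M M0 z[of x] by (cases "norm x \<le> R") auto
  moreover have "integrable lborel (\<lambda>x. indicator (cball 0 R) x *\<^sub>R f x)"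
    by (rule borel_integrable_compact[OF _ c']) auto
  then have "integrable lborel f"
    by (rule Bochner_Integration.integrable_bound) (use c z in \<open>auto simp: indicator_def intro!: borel_measurable_continuous_onI\<close>)
  moreover have "integrable lborel (\<lambda>x. indicator (cball 0 R) x *\<^sub>R (cmod (f x))\<^sup>2)"
    by (rule borel_integrable_compact) (auto intro!: continuous_intros c')
  then have "integrable lborel (\<lambda>x. (cmod (f x))\<^sup>2)"
    by (rule Bochner_Integration.integrable_bound)
       (use c z in \<open>auto simp: indicator_def intro!: borel_measurable_continuous_onI continuous_intros\<close>)
  ultimately show ?thesis using M0 that by blast
qed

text \<open>After the substitution \<open>x = y + s z\<close> the kernel is independent of s, and
  continuity lets \<open>f (y + s z)\<close> tend to \<open>f y\<close>. The double integral thus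
  tends to the squared norm of f, while the Gaussian weight on the frequency side is at most 1. This
  is the inequality opposite to the contraction.\<close>

lemma fourier_L1_isometry_continuous:
  assumes c: "continuous_on UNIV f" and z: "\<And>x. norm x > R \<Longrightarrow> f x = 0"
  shows "l2_norm (fourier_L1 f) = l2_norm f"
proof -
  obtain M where M: "\<And>x. cmod (f x) \<le> M" "M > 0" and f1: "integrable lborel f"
    and f2': "integrable lborel (\<lambda>x. (cmod (f x))\<^sup>2)"
    by (rule continuous_compact_support[OF c z]) (simp, rule that)
  have [measurable]: "f \<in> borel_measurable borel" using c by (rule borel_measurable_continuous_onI)
  have f2: "f \<in> L2" using f2' by (intro L2I) auto
  let ?s = "\<lambda>n. 1 / real (Suc n)"
  let ?a = "\<lambda>n y. LINT z|lborel. f (y + ?s n *\<^sub>R z) * cnj (f y) * of_real (gauss_kernel 1 z)"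
  have s: "?s n > 0" for n by simp
  have g1: "integrable lborel (\<lambda>z. complex_of_real (gauss_kernel 1 z))" "(LINT z|lborel. complex_of_real (gauss_kernel 1 z)) = 1"
    using gauss_kernel_integral[of 1] by (auto simp: complex_of_real_integrable_eq)
  have eq: "of_real (LINT \<xi>|lborel. (cmod (fourier_L1 f \<xi>))\<^sup>2 * exp (- (?s n)\<^sup>2 * (norm \<xi>)\<^sup>2 / 2)) = (LINT y|lborel. ?a n y)" for n
  proof -
    let ?h = "\<lambda>x y. f x * cnj (f y) * complex_of_real (gauss_kernel (?s n) (x - y))"
    note i = fourier_L1_gauss_identity(2)[OF f1 s[of n]]
    have "(LINT p|(lborel \<Otimes>\<^sub>M lborel). f (fst p) * cnj (f (snd p)) * of_real (gauss_kernel (?s n) (fst p - snd p)))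
        = (LINT p|(lborel \<Otimes>\<^sub>M lborel). (\<lambda>(x, y). ?h x y) p)"
      by (simp add: split_beta')
    also have "\<dots> = (LINT x|lborel. LINT y|lborel. ?h x y)" using lborel_pair.integral_fst[OF i] by simp
    also have "\<dots> = (LINT y|lborel. LINT x|lborel. ?h x y)" using lborel_pair.Fubini_integral[OF i] by simp
    also have "\<dots> = (LINT y|lborel. ?a n y)"
    proof (rule Bochner_Integration.integral_cong)
      fix y :: R3
      have "(LINT x|lborel. ?h x y) = \<bar>?s n\<bar> ^ DIM(R3) *\<^sub>R (LINT z|lborel. ?h (y + ?s n *\<^sub>R z) y)"
        by (rule lborel_integral_affine(2)) auto
      also have "\<dots> = (LINT z|lborel. \<bar>?s n\<bar> ^ DIM(R3) *\<^sub>R ?h (y + ?s n *\<^sub>R z) y)"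
        by (rule integral_scaleR_right[symmetric])
      also have "\<dots> = ?a n y"
      proof (rule Bochner_Integration.integral_cong)
        fix z :: R3
        \<comment> \<open>The Jacobian turns the kernel of width \<open>?s n\<close> into the kernel
          of width 1.\<close>
        have "\<bar>?s n\<bar> ^ 3 * gauss_kernel (?s n) (?s n *\<^sub>R z) = gauss_kernel 1 z"
          using s[of n] by (simp add: gauss_kernel_def power_mult_distrib power_divide)
        then have k: "complex_of_real (\<bar>?s n\<bar> ^ 3) * of_real (gauss_kernel (?s n) (?s n *\<^sub>R z)) = of_real (gauss_kernel 1 z)"
          by (simp only: of_real_mult[symmetric])
        show "\<bar>?s n\<bar> ^ DIM(R3) *\<^sub>R ?h (y + ?s n *\<^sub>R z) y = f (y + ?s n *\<^sub>R z) * cnj (f y) * of_real (gauss_kernel 1 z)"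
          unfolding k[symmetric] scaleR_conv_of_real by simp
      qed simp
      finally show "(LINT x|lborel. ?h x y) = ?a n y" .
    qed simp
    finally show ?thesis unfolding fourier_L1_gauss_identity(3)[OF f1 s] .
  qed
  have inner: "(\<lambda>n. ?a n y) \<longlonglongrightarrow> f y * cnj (f y)" for y
  proof -
    have "(\<lambda>n. ?a n y) \<longlonglongrightarrow> (LINT z|lborel. f y * cnj (f y) * of_real (gauss_kernel 1 z))"
    proof (rule integral_dominated_convergence)
      show "integrable lborel (\<lambda>z. M * M * gauss_kernel 1 z)" using gauss_kernel_integral(1)[of 1] by simp
      show "AE z in lborel. (\<lambda>n. f (y + ?s n *\<^sub>R z) * cnj (f y) * of_real (gauss_kernel 1 z))
          \<longlonglongrightarrow> f y * cnj (f y) * of_real (gauss_kernel 1 z)"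
      proof (rule AE_I2)
        fix z :: R3
        have "(\<lambda>n. y + ?s n *\<^sub>R z) \<longlonglongrightarrow> y + 0 *\<^sub>R z" by (intro tendsto_intros LIMSEQ_Suc lim_1_over_n)
        then have "(\<lambda>n. f (y + ?s n *\<^sub>R z)) \<longlonglongrightarrow> f y"
          using c by (intro continuous_on_tendsto_compose[OF c]) auto
        then show "(\<lambda>n. f (y + ?s n *\<^sub>R z) * cnj (f y) * of_real (gauss_kernel 1 z))
          \<longlonglongrightarrow> f y * cnj (f y) * of_real (gauss_kernel 1 z)" by (intro tendsto_intros)
      qed
      show "AE z in lborel. norm (f (y + ?s n *\<^sub>R z) * cnj (f y) * of_real (gauss_kernel 1 z)) \<le> M * M * gauss_kernel 1 z" for n
      proof (rule AE_I2)
        fix z :: R3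
        show "norm (f (y + ?s n *\<^sub>R z) * cnj (f y) * of_real (gauss_kernel 1 z)) \<le> M * M * gauss_kernel 1 z"
          using M gauss_kernel_nonneg[of 1 z] unfolding norm_mult
          by (intro mult_mono) (auto intro: mult_nonneg_nonneg)
      qed
    qed measurable
    then show ?thesis using g1 by simp
  qed
  have "(\<lambda>n. LINT y|lborel. ?a n y) \<longlonglongrightarrow> (LINT y|lborel. f y * cnj (f y))"
  proof (rule integral_dominated_convergence)
    \<comment> \<open>Only the shifted factor is replaced by its bound M; the factor
      \<open>f y\<close> stays and keeps the dominator integrable.\<close>
    show "integrable lborel (\<lambda>y. M * cmod (f y))" using f1 by simp
    show "AE y in lborel. (\<lambda>n. ?a n y) \<longlonglongrightarrow> f y * cnj (f y)" using inner by simp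
    show "AE y in lborel. norm (?a n y) \<le> M * cmod (f y)" for n
    proof (rule AE_I2)
      fix y :: R3
      have "norm (?a n y) \<le> (LINT z|lborel. cmod (f y) * M * gauss_kernel 1 z)"
      proof (rule Bochner_Integration.integral_norm_bound_integral)
        show "integrable lborel (\<lambda>z. cmod (f y) * M * gauss_kernel 1 z)" using gauss_kernel_integral(1)[of 1] by simp
        show le: "norm (f (y + ?s n *\<^sub>R z) * cnj (f y) * of_real (gauss_kernel 1 z)) \<le> cmod (f y) * M * gauss_kernel 1 z" for z
        proof -
          have "cmod (f (y + ?s n *\<^sub>R z)) * (cmod (f y) * gauss_kernel 1 z) \<le> M * (cmod (f y) * gauss_kernel 1 z)"
            using M gauss_kernel_nonneg[of 1 z] by (intro mult_right_mono) auto
          then show ?thesis using gauss_kernel_nonneg[of 1 z] by (simp add: norm_mult mult_ac)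
        qed
        show "integrable lborel (\<lambda>z. f (y + ?s n *\<^sub>R z) * cnj (f y) * of_real (gauss_kernel 1 z))"
        proof (rule Bochner_Integration.integrable_bound)
          show "integrable lborel (\<lambda>z. cmod (f y) * M * gauss_kernel 1 z)" using gauss_kernel_integral(1)[of 1] by simp
          show "AE z in lborel. norm (f (y + ?s n *\<^sub>R z) * cnj (f y) * of_real (gauss_kernel 1 z)) \<le> norm (cmod (f y) * M * gauss_kernel 1 z)"
            unfolding real_norm_def by (rule AE_I2, rule order_trans[OF le abs_ge_self])
        qed measurable
      qed
      also have "\<dots> = M * cmod (f y)" using gauss_kernel_integral(2)[of 1] by simp
      finally show "norm (?a n y) \<le> M * cmod (f y)" .
    qed
  qed measurable
  then have lim: "(\<lambda>n. complex_of_real (LINT \<xi>|lborel. (cmod (fourier_L1 f \<xi>))\<^sup>2 * exp (- (?s n)\<^sup>2 * (norm \<xi>)\<^sup>2 / 2)))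
      \<longlonglongrightarrow> of_real ((l2_norm f)\<^sup>2)"
    unfolding eq l2_inner_self[symmetric] l2_inner_def .
  have lim': "(\<lambda>n. LINT \<xi>|lborel. (cmod (fourier_L1 f \<xi>))\<^sup>2 * exp (- (?s n)\<^sup>2 * (norm \<xi>)\<^sup>2 / 2)) \<longlonglongrightarrow> (l2_norm f)\<^sup>2"
    using tendsto_Re[OF lim] by simp
  have "(l2_norm f)\<^sup>2 \<le> (l2_norm (fourier_L1 f))\<^sup>2"
  proof (rule tendsto_upperbound[OF lim'])
    show "\<forall>\<^sub>F n in sequentially. (LINT \<xi>|lborel. (cmod (fourier_L1 f \<xi>))\<^sup>2 * exp (- (?s n)\<^sup>2 * (norm \<xi>)\<^sup>2 / 2)) \<le> (l2_norm (fourier_L1 f))\<^sup>2"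
      unfolding l2_norm_square[of "fourier_L1 f"]
      using fourier_L1_gauss_identity(1)[OF f1 s] L2_integrable_square[OF fourier_L1_contraction(1)[OF f1 f2]]
      by (intro always_eventually allI integral_mono) (auto intro!: mult_left_le)
  qed simp
  then have "l2_norm f \<le> l2_norm (fourier_L1 f)" by (rule power2_le_imp_le) simp
  with fourier_L1_contraction(2)[OF f1 f2] show ?thesis by simp
qed


subsection \<open>The Fourier transform on L2\<close>

lemma cball_measurable [measurable]: "cball (a::'a::metric_space) r \<in> sets borel" by simp

text \<open>Truncation makes f bounded with bounded support, and measurability supplies continuous
  \<open>G k\<close> that tend to the truncation off a negligible set. Size and support of the
  \<open>G k\<close> are uncontrolled, so they are clipped before dominated convergence
  applies.\<close>

lemma l2_dense_continuous:
  assumes f: "f \<in> L2" and e: "e > 0"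
  obtains g R where "continuous_on UNIV g" "\<And>x. norm x > R \<Longrightarrow> g x = 0" "l2_norm (\<lambda>x. f x - g x) < e"
proof -
  note [measurable] = L2_measurable[OF f]
  define h where "h n x = (if norm x \<le> real n \<and> cmod (f x) \<le> real n then f x else 0)" for n x
  have [measurable]: "h n \<in> borel_measurable borel" for n unfolding h_def by measurable
  have "(\<lambda>n. l2_norm (\<lambda>x. h n x - f x)) \<longlonglongrightarrow> 0"
  proof (rule l2_dominated_convergence[OF f])
    show "AE x in lborel. (\<lambda>n. h n x) \<longlonglongrightarrow> f x"
    proof (rule AE_I2)
      fix x
      obtain N where "max (norm x) (cmod (f x)) \<le> real N" using real_arch_simple by blast
      then have "h n x = f x" if "n \<ge> N" for n using that by (auto simp: h_def)
      then show "(\<lambda>n. h n x) \<longlonglongrightarrow> f x"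
        by (intro tendsto_eventually eventually_sequentiallyI)
    qed
  qed (auto simp: h_def)
  from LIMSEQ_D[OF this, of "e / 2"] e obtain n where "norm (l2_norm (\<lambda>x. h n x - f x) - 0) < e / 2"
    by auto
  then have n: "l2_norm (\<lambda>x. h n x - f x) < e / 2" by simp
  \<comment> \<open>Adding 1 keeps M positive even for n = 0.\<close>
  define M where "M = real n + 1"
  have hM: "cmod (h n x) \<le> M" "norm x > M \<Longrightarrow> h n x = 0" for x by (auto simp: h_def M_def)
  have M: "M > 0" by (simp add: M_def)
  have "h n measurable_on UNIV"
    by (rule lebesgue_measurable_imp_measurable_on) (auto intro!: measurable_completion)
  then obtain N G where N: "negligible N" and G: "\<And>k. continuous_on UNIV (G k)"
    and lim: "\<And>x. x \<notin> N \<Longrightarrow> (\<lambda>k. G k x) \<longlonglongrightarrow> h n x"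
    unfolding measurable_on_def by auto
  have m: "max M w > 0" for w using M by simp
  \<comment> \<open>A tent that is 1 on the ball of radius M and 0 beyond radius M + 1, times a
    radial clipping to modulus at most M. Both are continuous and leave the limit
    \<open>h n x\<close> unchanged.\<close>
  define c where "c k x = of_real (max 0 (1 - max 0 (norm x - M)) * (M / max M (cmod (G k x)))) * G k x" for k x
  have c_cont: "continuous_on UNIV (c k)" for k
    unfolding c_def using m by (intro continuous_intros G) (metis less_irrefl)
  have c0: "c k x = 0" if "norm x > M + 1" for k x using that by (simp add: c_def)
  have c_bd: "cmod (c k x) \<le> M" for k x
  proof -
    have a: "\<bar>max 0 (1 - max 0 (norm x - M))\<bar> \<le> 1" by auto
    have b: "M / max M (cmod (G k x)) * cmod (G k x) \<le> M"
    proof -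
      have "M * cmod (G k x) \<le> M * max M (cmod (G k x))" using M by (intro mult_left_mono) auto
      then show ?thesis using m[of "cmod (G k x)"] by (simp add: divide_le_eq)
    qed
    have "cmod (c k x) = \<bar>max 0 (1 - max 0 (norm x - M))\<bar> * (M / max M (cmod (G k x)) * cmod (G k x))"
      using M by (simp only: c_def norm_mult norm_of_real abs_mult) (simp add: abs_mult)
    also have "\<dots> \<le> 1 * M" using a b M by (intro mult_mono) auto
    finally show ?thesis by simp
  qed
  have [measurable]: "c k \<in> borel_measurable borel" for k by (rule borel_measurable_continuous_onI[OF c_cont])
  let ?w = "\<lambda>x::R3. complex_of_real (2 * M * indicator (cball 0 (M + 1)) x)"
  have w: "?w \<in> L2"
  proof (rule L2I)
    have "integrable lborel (\<lambda>x::R3. (2 * M)\<^sup>2 * indicator (cball 0 (M + 1)) x)"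
      by (intro integrable_mult_right integrable_real_indicator emeasure_lborel_cball_finite) simp
    then show "integrable lborel (\<lambda>x. (cmod (?w x))\<^sup>2)"
      by (rule Bochner_Integration.integrable_bound) (auto simp: indicator_def)
  qed measurable
  have "(\<lambda>k. l2_norm (\<lambda>x. c k x - h n x)) \<longlonglongrightarrow> 0"
  proof (rule l2_dominated_convergence[OF w])
    have "AE x in lborel. x \<notin> N"
      using AE_not_in[of N lebesgue] N by (simp add: negligible_iff_null_sets AE_completion_iff)
    then show "AE x in lborel. (\<lambda>k. c k x) \<longlonglongrightarrow> h n x"
    proof eventually_elim
      case (elim x)
      have "(\<lambda>k. c k x) \<longlonglongrightarrow> of_real (max 0 (1 - max 0 (norm x - M)) * (M / max M (cmod (h n x)))) * h n x"
        unfolding c_def using m by (intro tendsto_intros lim elim) (metis less_irrefl)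
      also have "of_real (max 0 (1 - max 0 (norm x - M)) * (M / max M (cmod (h n x)))) * h n x = h n x"
      proof (cases "norm x > M")
        case False
        then have "max 0 (norm x - M) = 0" "max M (cmod (h n x)) = M" using hM(1)[of x] by auto
        then show ?thesis using M by simp
      qed (simp add: hM(2))
      finally show ?case .
    qed
    show "AE x in lborel. cmod (c k x - h n x) \<le> cmod (?w x)" for k
    proof (rule AE_I2)
      fix x
      have "cmod (c k x - h n x) \<le> M + M" using norm_triangle_ineq4[of "c k x" "h n x"] c_bd[of k x] hM(1)[of x] by linarith
      moreover have "c k x - h n x = 0" if "norm x > M + 1" using c0[OF that] hM(2)[of x] that by simp
      ultimately show "cmod (c k x - h n x) \<le> cmod (?w x)" using M by (auto simp: indicator_def)
    qed
  qed measurable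
  from LIMSEQ_D[OF this, of "e / 2"] e obtain k where "norm (l2_norm (\<lambda>x. c k x - h n x) - 0) < e / 2"
    by auto
  then have k: "l2_norm (\<lambda>x. c k x - h n x) < e / 2" by simp
  have hL: "h n \<in> L2" by (rule L2_bound[OF f, of _ 1]) (auto simp: h_def)
  have "integrable lborel (\<lambda>x. (cmod (c k x))\<^sup>2)"
    by (rule continuous_compact_support[OF c_cont[of k] c0])
  then have cL: "c k \<in> L2" by (intro L2I) auto
  have "l2_norm (\<lambda>x. f x - c k x) < e"
    using l2_norm_triangle_diff[OF f hL cL] n k
      l2_norm_minus_commute[of f "h n"] l2_norm_minus_commute[of "h n" "c k"] by linarith
  then show ?thesis using that[OF c_cont c0] by blast
qed

text \<open>Contraction applied to \<open>f - g\<close> makes both sides continuous in the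
  \<open>L2\<close> norm, so equality extends from the dense class.\<close>

theorem fourier_L1_isometry:
  assumes f: "integrable lborel f" "f \<in> L2"
  shows "l2_norm (fourier_L1 f) = l2_norm f"
proof (rule antisym)
  show "l2_norm (fourier_L1 f) \<le> l2_norm f" by (rule fourier_L1_contraction[OF f])
  show "l2_norm f \<le> l2_norm (fourier_L1 f)"
  proof (rule field_le_epsilon)
    fix e :: real assume "e > 0"
    then have "e / 2 > 0" by simp
    then obtain g R where g: "continuous_on UNIV g" "\<And>x. norm x > R \<Longrightarrow> g x = 0" "l2_norm (\<lambda>x. f x - g x) < e / 2"
      by (rule l2_dense_continuous[OF f(2)]) (rule that)
    have g1: "integrable lborel g" by (rule continuous_compact_support[OF g(1,2)])
    have g2': "integrable lborel (\<lambda>x. (cmod (g x))\<^sup>2)" by (rule continuous_compact_support[OF g(1,2)])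
    have g2: "g \<in> L2" using g1 g2' by (intro L2I) auto
    have fg: "integrable lborel (\<lambda>x. f x - g x)" "(\<lambda>x. f x - g x) \<in> L2" using f g1 g2 by (auto intro: L2_diff)
    have "\<bar>l2_norm (fourier_L1 f) - l2_norm (fourier_L1 g)\<bar> \<le> l2_norm (\<lambda>x. fourier_L1 f x - fourier_L1 g x)"
      by (intro l2_norm_diff_ge fourier_L1_contraction f g1 g2)
    also have "\<dots> = l2_norm (fourier_L1 (\<lambda>x. f x - g x))"
      by (simp only: fourier_L1_diff[OF f(1) g1, symmetric])
    also have "\<dots> \<le> l2_norm (\<lambda>x. f x - g x)" by (rule fourier_L1_contraction[OF fg])
    finally have "l2_norm (fourier_L1 g) \<le> l2_norm (fourier_L1 f) + e / 2" using g(3) by linarith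
    moreover have "l2_norm (fourier_L1 g) = l2_norm g" by (rule fourier_L1_isometry_continuous[OF g(1,2)])
    moreover have "\<bar>l2_norm f - l2_norm g\<bar> \<le> l2_norm (\<lambda>x. f x - g x)" by (rule l2_norm_diff_ge[OF f(2) g2])
    ultimately show "l2_norm f \<le> l2_norm (fourier_L1 f) + e" using g(3) by linarith
  qed
qed

section \<open>Extension of the transform to \<open>L2\<close> and its unitarity\<close>

definition cutoff :: "nat \<Rightarrow> wavefun \<Rightarrow> wavefun" where
  "cutoff n f x = of_real (indicator (cball 0 (real n)) x) * f x"

text \<open>A square integrable function is integrable on balls, and the transform is the norm limit
  over growing balls. \<open>SOME\<close> selects one representative of that limit, so identities
  between transforms as functions are stated up to \<open>ae_eq\<close>.\<close>

definition fourier :: "wavefun \<Rightarrow> wavefun" where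
  "fourier f = (SOME g. g \<in> L2 \<and> (\<lambda>n. l2_norm (\<lambda>\<xi>. fourier_L1 (cutoff n f) \<xi> - g \<xi>)) \<longlonglongrightarrow> 0)"

lemma cutoff_L2: "f \<in> L2 \<Longrightarrow> cutoff n f \<in> L2"
  unfolding cutoff_def by (rule L2_indicator) auto

lemma cutoff_integrable:
  assumes "f \<in> L2" shows "integrable lborel (cutoff n f)"
proof -
  have "(\<lambda>x::R3. complex_of_real (indicator (cball 0 (real n)) x)) \<in> L2"
  proof (rule L2I)
    have "integrable lborel (indicator (cball 0 (real n)) :: R3 \<Rightarrow> real)"
      by (intro integrable_real_indicator emeasure_lborel_cball_finite) simp
    then show "integrable lborel (\<lambda>x::R3. (cmod (complex_of_real (indicator (cball 0 (real n)) x)))\<^sup>2)"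
      by (rule Bochner_Integration.integrable_bound) (auto simp: indicator_def)
  qed measurable
  from L2_integrable_mult[OF this assms] show ?thesis by (simp add: cutoff_def[abs_def])
qed

lemma cutoff_tendsto: "(\<lambda>n. cutoff n f x) \<longlonglongrightarrow> f x"
proof -
  obtain N where "norm x \<le> real N" using real_arch_simple by blast
  then have "cutoff n f x = f x" if "n \<ge> N" for n using that by (auto simp: cutoff_def)
  then show ?thesis by (intro tendsto_eventually eventually_sequentiallyI)
qed

lemma cutoff_tendsto_l2:
  assumes "f \<in> L2" shows "(\<lambda>n. l2_norm (\<lambda>x. cutoff n f x - f x)) \<longlonglongrightarrow> 0"
proof (rule l2_dominated_convergence[OF assms])
  show "AE x in lborel. cmod (cutoff n f x - f x) \<le> cmod (f x)" for n
    by (intro AE_I2) (simp add: cutoff_def indicator_def)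
qed (simp_all add: assms L2_measurable cutoff_L2 cutoff_tendsto)

lemma fourier_L1_cutoff_L2: "f \<in> L2 \<Longrightarrow> fourier_L1 (cutoff n f) \<in> L2"
  by (intro fourier_L1_contraction cutoff_integrable cutoff_L2)

lemma fourier_L1_cutoff_diff:
  assumes "f \<in> L2"
  shows "l2_norm (\<lambda>\<xi>. fourier_L1 (cutoff m f) \<xi> - fourier_L1 (cutoff n f) \<xi>) = l2_norm (\<lambda>x. cutoff m f x - cutoff n f x)"
  unfolding fourier_L1_diff[OF cutoff_integrable[OF assms] cutoff_integrable[OF assms], symmetric]
  by (intro fourier_L1_isometry Bochner_Integration.integrable_diff cutoff_integrable L2_diff cutoff_L2 assms)

text \<open>The transforms of the cutoffs are Cauchy, since the distances between them are those
  between the cutoffs, which converge to f.\<close>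

lemma fourier_limit:
  assumes f: "f \<in> L2"
  shows "fourier f \<in> L2 \<and> (\<lambda>n. l2_norm (\<lambda>\<xi>. fourier_L1 (cutoff n f) \<xi> - fourier f \<xi>)) \<longlonglongrightarrow> 0"
proof -
  let ?P = "\<lambda>g. g \<in> L2 \<and> (\<lambda>n. l2_norm (\<lambda>\<xi>. fourier_L1 (cutoff n f) \<xi> - g \<xi>)) \<longlonglongrightarrow> 0"
  obtain g where "g \<in> L2" "(\<lambda>n. l2_norm (\<lambda>\<xi>. fourier_L1 (cutoff n f) \<xi> - g \<xi>)) \<longlonglongrightarrow> 0"
  proof (rule l2_complete[OF fourier_L1_cutoff_L2[OF f]])
    fix e :: real assume "e > 0"
    then obtain N where N: "\<And>n. n \<ge> N \<Longrightarrow> l2_norm (\<lambda>x. cutoff n f x - f x) < e / 2"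
      using LIMSEQ_D[OF cutoff_tendsto_l2[OF f], of "e/2"] by auto
    have "l2_norm (\<lambda>\<xi>. fourier_L1 (cutoff m f) \<xi> - fourier_L1 (cutoff n f) \<xi>) < e" if "m \<ge> N" "n \<ge> N" for m n
      using l2_norm_triangle_diff[OF cutoff_L2[OF f] f cutoff_L2[OF f], of m n] N[OF that(1)] N[OF that(2)]
        l2_norm_minus_commute[of f "cutoff n f"]
      unfolding fourier_L1_cutoff_diff[OF f] by linarith
    then show "\<exists>N. \<forall>m\<ge>N. \<forall>n\<ge>N. l2_norm (\<lambda>\<xi>. fourier_L1 (cutoff m f) \<xi> - fourier_L1 (cutoff n f) \<xi>) < e" by blast
  qed
  then have "?P g" by simp
  then show ?thesis unfolding fourier_def by (rule someI[of ?P])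
qed

lemmas fourier_L2 = fourier_limit[THEN conjunct1] and fourier_tendsto = fourier_limit[THEN conjunct2]

lemma fourier_unique:
  assumes "f \<in> L2" "h \<in> L2" "(\<lambda>n. l2_norm (\<lambda>\<xi>. fourier_L1 (cutoff n f) \<xi> - h \<xi>)) \<longlonglongrightarrow> 0"
  shows "ae_eq (fourier f) h"
  by (rule l2_limit_unique[OF fourier_L1_cutoff_L2[OF assms(1)] fourier_L2[OF assms(1)] assms(2)
        fourier_tendsto[OF assms(1)] assms(3)])

lemma fourier_norm:
  assumes f: "f \<in> L2" shows "l2_norm (fourier f) = l2_norm f"
proof (rule LIMSEQ_unique)
  show "(\<lambda>n. l2_norm (fourier_L1 (cutoff n f))) \<longlonglongrightarrow> l2_norm (fourier f)"
    by (rule l2_norm_tendsto[OF fourier_L1_cutoff_L2[OF f] fourier_L2[OF f] fourier_tendsto[OF f]])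
  show "(\<lambda>n. l2_norm (fourier_L1 (cutoff n f))) \<longlonglongrightarrow> l2_norm f"
    unfolding fourier_L1_isometry[OF cutoff_integrable[OF f] cutoff_L2[OF f]]
    by (rule l2_norm_tendsto[OF cutoff_L2[OF f] f cutoff_tendsto_l2[OF f]])
qed

lemma fourier_eq_fourier_L1:
  assumes f: "integrable lborel f" "f \<in> L2"
  shows "ae_eq (fourier f) (fourier_L1 f)"
proof (rule fourier_unique[OF f(2) fourier_L1_contraction(1)[OF f]])
  have "l2_norm (\<lambda>\<xi>. fourier_L1 (cutoff n f) \<xi> - fourier_L1 f \<xi>) = l2_norm (\<lambda>x. cutoff n f x - f x)" for n
    unfolding fourier_L1_diff[OF cutoff_integrable[OF f(2)] f(1), symmetric]
    by (intro fourier_L1_isometry Bochner_Integration.integrable_diff cutoff_integrable L2_diff cutoff_L2 f)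
  then show "(\<lambda>n. l2_norm (\<lambda>\<xi>. fourier_L1 (cutoff n f) \<xi> - fourier_L1 f \<xi>)) \<longlonglongrightarrow> 0"
    using cutoff_tendsto_l2[OF f(2)] by simp
qed

lemma fourier_add:
  assumes f: "f \<in> L2" and g: "g \<in> L2"
  shows "ae_eq (fourier (\<lambda>x. f x + g x)) (\<lambda>\<xi>. fourier f \<xi> + fourier g \<xi>)"
proof (rule fourier_unique)
  let ?F = "\<lambda>n f. fourier_L1 (cutoff n f)"
  have eq: "?F n (\<lambda>x. f x + g x) \<xi> - (fourier f \<xi> + fourier g \<xi>) = (?F n f \<xi> - fourier f \<xi>) + (?F n g \<xi> - fourier g \<xi>)" for n \<xi>
  proof -
    have "cutoff n (\<lambda>x. f x + g x) = (\<lambda>x. cutoff n f x + cutoff n g x)"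
      by (simp add: cutoff_def distrib_left fun_eq_iff)
    then show ?thesis
      using fourier_L1_add[OF cutoff_integrable[OF f, of n] cutoff_integrable[OF g, of n], of \<xi>] by simp
  qed
  show "(\<lambda>n. l2_norm (\<lambda>\<xi>. ?F n (\<lambda>x. f x + g x) \<xi> - (fourier f \<xi> + fourier g \<xi>))) \<longlonglongrightarrow> 0"
    unfolding eq
  proof (rule Lim_null_comparison)
    show "(\<lambda>n. l2_norm (\<lambda>\<xi>. ?F n f \<xi> - fourier f \<xi>) + l2_norm (\<lambda>\<xi>. ?F n g \<xi> - fourier g \<xi>)) \<longlonglongrightarrow> 0"
      using tendsto_add[OF fourier_tendsto[OF f] fourier_tendsto[OF g]] by simp
    show "\<forall>\<^sub>F n in sequentially. norm (l2_norm (\<lambda>\<xi>. (?F n f \<xi> - fourier f \<xi>) + (?F n g \<xi> - fourier g \<xi>)))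
       \<le> l2_norm (\<lambda>\<xi>. ?F n f \<xi> - fourier f \<xi>) + l2_norm (\<lambda>\<xi>. ?F n g \<xi> - fourier g \<xi>)"
      by (intro always_eventually allI)
         (simp add: l2_norm_triangle L2_diff fourier_L2 fourier_L1_cutoff_L2 f g)
  qed
qed (intro L2_add f g fourier_L2)+

lemma fourier_scale:
  assumes f: "f \<in> L2" shows "ae_eq (fourier (\<lambda>x. c * f x)) (\<lambda>\<xi>. c * fourier f \<xi>)"
proof (rule fourier_unique)
  have eq: "fourier_L1 (cutoff n (\<lambda>x. c * f x)) \<xi> - c * fourier f \<xi> = c * (fourier_L1 (cutoff n f) \<xi> - fourier f \<xi>)" for n \<xi>
  proof -
    have "cutoff n (\<lambda>x. c * f x) = (\<lambda>x. c * cutoff n f x)"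
      by (simp add: cutoff_def mult.left_commute fun_eq_iff)
    then show ?thesis using fourier_L1_scale[of c "cutoff n f" \<xi>] by (simp add: right_diff_distrib)
  qed
  show "(\<lambda>n. l2_norm (\<lambda>\<xi>. fourier_L1 (cutoff n (\<lambda>x. c * f x)) \<xi> - c * fourier f \<xi>)) \<longlonglongrightarrow> 0"
    unfolding eq l2_norm_scale using tendsto_mult_left[OF fourier_tendsto[OF f], of "cmod c"] by simp
qed (intro L2_scale f fourier_L2)+

lemma fourier_diff:
  assumes f: "f \<in> L2" and g: "g \<in> L2"
  shows "ae_eq (fourier (\<lambda>x. f x - g x)) (\<lambda>\<xi>. fourier f \<xi> - fourier g \<xi>)"
  using fourier_add[OF f L2_scale[OF g, of "-1"]] fourier_scale[OF g, of "-1"]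
  unfolding ae_eq_def by eventually_elim simp

lemma fourier_cong:
  assumes f: "f \<in> L2" and g: "g \<in> L2" and fg: "ae_eq f g"
  shows "ae_eq (fourier f) (fourier g)"
proof -
  have "ae_eq (\<lambda>x. f x - g x) (\<lambda>x. 0)" using fg by (auto simp: ae_eq_def)
  then have "l2_norm (fourier (\<lambda>x. f x - g x)) = 0"
    using l2_norm_eq_0_iff[OF L2_diff[OF f g]] fourier_norm[OF L2_diff[OF f g]] by simp
  then have "ae_eq (fourier (\<lambda>x. f x - g x)) (\<lambda>x. 0)"
    using l2_norm_eq_0_iff fourier_L2[OF L2_diff[OF f g]] by blast
  with fourier_diff[OF f g] show ?thesis unfolding ae_eq_def by eventually_elim auto
qed

lemma fourier_mult_formula:
  assumes f: "f \<in> L2" and g: "g \<in> L2"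
  shows "(LINT x|lborel. fourier f x * g x) = (LINT x|lborel. f x * fourier g x)"
proof (rule LIMSEQ_unique)
  show "(\<lambda>n. LINT x|lborel. fourier_L1 (cutoff n f) x * cutoff n g x) \<longlonglongrightarrow> (LINT x|lborel. fourier f x * g x)"
    by (rule l2_pairing_tendsto[OF fourier_L1_cutoff_L2[OF f] fourier_L2[OF f] fourier_tendsto[OF f]
          cutoff_L2[OF g] g cutoff_tendsto_l2[OF g]])
  show "(\<lambda>n. LINT x|lborel. fourier_L1 (cutoff n f) x * cutoff n g x) \<longlonglongrightarrow> (LINT x|lborel. f x * fourier g x)"
    unfolding fourier_L1_mult_formula[OF cutoff_integrable[OF f] cutoff_integrable[OF g]]
    by (rule l2_pairing_tendsto[OF cutoff_L2[OF f] f cutoff_tendsto_l2[OF f]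
          fourier_L1_cutoff_L2[OF g] fourier_L2[OF g] fourier_tendsto[OF g]])
qed

text \<open>By \<open>fourier_mult_formula\<close> the transform conjugated on both sides is the
  adjoint of \<open>fourier\<close>, and in this form it is visibly isometric.\<close>

definition fourier_inv :: "wavefun \<Rightarrow> wavefun" where
  "fourier_inv g x = cnj (fourier (\<lambda>y. cnj (g y)) x)"

lemma fourier_inv_L2: "g \<in> L2 \<Longrightarrow> fourier_inv g \<in> L2"
  unfolding fourier_inv_def by (intro L2_cnj fourier_L2)

lemma fourier_inv_norm: "g \<in> L2 \<Longrightarrow> l2_norm (fourier_inv g) = l2_norm g"
  unfolding fourier_inv_def by (simp add: l2_norm_cnj fourier_norm L2_cnj)

lemma fourier_inner_left:
  assumes f: "f \<in> L2" and g: "g \<in> L2"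
  shows "l2_inner (fourier f) g = l2_inner f (fourier_inv g)"
  unfolding l2_inner_def fourier_inv_def using fourier_mult_formula[OF f L2_cnj[OF g]] by simp

text \<open>The equality case of Cauchy-Schwarz, read off from the expansion of the squared norm of
  the difference.\<close>

lemma l2_norm_diff_eq_0:
  assumes "f \<in> L2" "g \<in> L2" "l2_inner f g = of_real ((l2_norm g)\<^sup>2)" "l2_norm f = l2_norm g"
  shows "ae_eq f g"
proof -
  have "(l2_norm (\<lambda>x. f x - g x))\<^sup>2 = 0" using l2_norm_diff_square[OF assms(1,2)] assms(3,4) by simp
  then have "ae_eq (\<lambda>x. f x - g x) (\<lambda>x. 0)" using l2_norm_eq_0_iff[OF L2_diff[OF assms(1,2)]] by simp
  then show ?thesis by (auto simp: ae_eq_def)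
qed

text \<open>Surjectivity of the transform. Moving \<open>fourier\<close> to the other side of the
  inner product gives \<open>(l2_norm (fourier_inv g))\<^sup>2\<close>, which is
  \<open>(l2_norm g)\<^sup>2\<close>; all norms agree, so the equality case applies.\<close>

lemma fourier_fourier_inv:
  assumes g: "g \<in> L2" shows "ae_eq (fourier (fourier_inv g)) g"
proof (rule l2_norm_diff_eq_0)
  show "l2_inner (fourier (fourier_inv g)) g = of_real ((l2_norm g)\<^sup>2)"
    using fourier_inner_left[OF fourier_inv_L2[OF g] g] by (simp add: l2_inner_self fourier_inv_norm g)
qed (simp_all add: g fourier_L2 fourier_inv_L2 fourier_norm fourier_inv_norm)

lemma fourier_inv_fourier:
  assumes f: "f \<in> L2" shows "ae_eq (fourier_inv (fourier f)) f"
proof (rule l2_norm_diff_eq_0)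
  have "l2_inner f (fourier_inv (fourier f)) = of_real ((l2_norm f)\<^sup>2)"
    using fourier_inner_left[OF f fourier_L2[OF f]] by (simp add: l2_inner_self fourier_norm f)
  then show "l2_inner (fourier_inv (fourier f)) f = of_real ((l2_norm f)\<^sup>2)"
    by (subst l2_inner_commute) simp
qed (simp_all add: f fourier_L2 fourier_inv_L2 fourier_norm fourier_inv_norm)

lemma fourier_inner:
  assumes f: "f \<in> L2" and g: "g \<in> L2"
  shows "l2_inner (fourier f) (fourier g) = l2_inner f g"
  unfolding fourier_inner_left[OF f fourier_L2[OF g]]
  by (rule l2_inner_cong) (simp_all add: f g L2_measurable fourier_inv_L2 fourier_L2 fourier_inv_fourier)

lemma fourier_eqD:
  assumes f: "f \<in> L2" and g: "g \<in> L2" and fg: "ae_eq (fourier f) (fourier g)"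
  shows "ae_eq f g"
proof -
  have "ae_eq (fourier (\<lambda>x. f x - g x)) (\<lambda>x. 0)"
    using fg fourier_diff[OF f g] unfolding ae_eq_def by eventually_elim simp
  then have "l2_norm (fourier (\<lambda>x. f x - g x)) = 0"
    using l2_norm_eq_0_iff[OF fourier_L2[OF L2_diff[OF f g]]] by simp
  then have "ae_eq (\<lambda>x. f x - g x) (\<lambda>x. 0)"
    using l2_norm_eq_0_iff[OF L2_diff[OF f g]] fourier_norm[OF L2_diff[OF f g]] by simp
  then show ?thesis by (auto simp: ae_eq_def)
qed


subsection \<open>Functional calculus of Fourier multipliers\<close>

lemma fourier_sum:
  fixes N :: nat
  assumes "\<And>i. f i \<in> L2"
  shows "ae_eq (fourier (\<lambda>x. \<Sum>i<N. f i x)) (\<lambda>\<xi>. \<Sum>i<N. fourier (f i) \<xi>)"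
proof (induction N)
  case 0
  have "ae_eq (fourier (\<lambda>x. 0 * 0)) (\<lambda>\<xi>. 0 * fourier (\<lambda>x. 0) \<xi>)" by (rule fourier_scale) simp
  then show ?case by simp
next
  case (Suc N)
  have "ae_eq (fourier (\<lambda>x. (\<Sum>i<N. f i x) + f N x)) (\<lambda>\<xi>. fourier (\<lambda>x. \<Sum>i<N. f i x) \<xi> + fourier (f N) \<xi>)"
    by (intro fourier_add L2_sum assms)
  with Suc show ?case unfolding ae_eq_def by eventually_elim simp
qed

text \<open>The graph has the maximal domain: the condition \<open>h \<in> L2\<close> admits exactly
  those f whose transform stays square integrable after multiplication by m.\<close>

definition fourier_multiplier :: "(R3 \<Rightarrow> real) \<Rightarrow> l2_op" where
  "fourier_multiplier m = {(f, h). f \<in> L2 \<and> h \<in> L2 \<and> ae_eq (fourier h) (\<lambda>\<xi>. of_real (m \<xi>) * fourier f \<xi>)}"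

definition spectral_projection :: "(R3 \<Rightarrow> real) \<Rightarrow> real set \<Rightarrow> wavefun \<Rightarrow> wavefun" where
  "spectral_projection t B f = fourier_inv (\<lambda>\<xi>. of_real (indicator B (t \<xi>)) * fourier f \<xi>)"

lemma linear_operator_fourier_multiplier: "linear_operator (fourier_multiplier m)"
  unfolding linear_operator_def
proof (intro conjI allI impI)
  show "fourier_multiplier m \<subseteq> L2 \<times> L2" by (auto simp: fourier_multiplier_def)
next
  fix f g f' g'
  assume a: "(f, g) \<in> fourier_multiplier m" "f' \<in> L2" "g' \<in> L2" "ae_eq f f'" "ae_eq g g'"
  then have f: "f \<in> L2" "g \<in> L2" and e: "ae_eq (fourier g) (\<lambda>\<xi>. of_real (m \<xi>) * fourier f \<xi>)"
    by (auto simp: fourier_multiplier_def)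
  have "ae_eq (fourier g') (\<lambda>\<xi>. of_real (m \<xi>) * fourier f' \<xi>)"
    using e fourier_cong[OF f(1) a(2,4)] fourier_cong[OF f(2) a(3,5)]
    unfolding ae_eq_def by eventually_elim simp
  then show "(f', g') \<in> fourier_multiplier m" using a by (simp add: fourier_multiplier_def)
next
  fix f g g' assume a: "(f, g) \<in> fourier_multiplier m" "(f, g') \<in> fourier_multiplier m"
  then have "ae_eq (fourier g) (\<lambda>\<xi>. of_real (m \<xi>) * fourier f \<xi>)" "ae_eq (fourier g') (\<lambda>\<xi>. of_real (m \<xi>) * fourier f \<xi>)"
    by (auto simp: fourier_multiplier_def)
  then have "ae_eq (fourier g) (fourier g')"
    unfolding ae_eq_def by eventually_elim simp
  then show "ae_eq g g'" using a fourier_eqD[of g g'] by (auto simp: fourier_multiplier_def)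
next
  have "ae_eq (fourier (\<lambda>x. 0)) (\<lambda>\<xi>. 0)" using fourier_sum[of "\<lambda>_ _. 0" 0] by simp
  then have "ae_eq (fourier (\<lambda>x. 0)) (\<lambda>\<xi>. of_real (m \<xi>) * fourier (\<lambda>x. 0) \<xi>)"
    unfolding ae_eq_def by eventually_elim simp
  then show "(\<lambda>x. 0, \<lambda>x. 0) \<in> fourier_multiplier m" by (simp add: fourier_multiplier_def)
next
  fix f g f' g' assume a: "(f, g) \<in> fourier_multiplier m" "(f', g') \<in> fourier_multiplier m"
  then have L: "f \<in> L2" "g \<in> L2" "f' \<in> L2" "g' \<in> L2"
    and e: "ae_eq (fourier g) (\<lambda>\<xi>. of_real (m \<xi>) * fourier f \<xi>)" "ae_eq (fourier g') (\<lambda>\<xi>. of_real (m \<xi>) * fourier f' \<xi>)"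
    by (auto simp: fourier_multiplier_def)
  have "ae_eq (fourier (\<lambda>x. g x + g' x)) (\<lambda>\<xi>. of_real (m \<xi>) * fourier (\<lambda>x. f x + f' x) \<xi>)"
    using e fourier_add[OF L(1,3)] fourier_add[OF L(2,4)]
    unfolding ae_eq_def by eventually_elim (simp add: distrib_left)
  then show "(\<lambda>x. f x + f' x, \<lambda>x. g x + g' x) \<in> fourier_multiplier m"
    using L by (auto simp: fourier_multiplier_def intro: L2_add)
next
  fix c f g assume a: "(f, g) \<in> fourier_multiplier m"
  then have L: "f \<in> L2" "g \<in> L2" and e: "ae_eq (fourier g) (\<lambda>\<xi>. of_real (m \<xi>) * fourier f \<xi>)"
    by (auto simp: fourier_multiplier_def)
  have "ae_eq (fourier (\<lambda>x. c * g x)) (\<lambda>\<xi>. of_real (m \<xi>) * fourier (\<lambda>x. c * f x) \<xi>)"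
    using e fourier_scale[OF L(1), of c] fourier_scale[OF L(2), of c]
    unfolding ae_eq_def by eventually_elim simp
  then show "(\<lambda>x. c * f x, \<lambda>x. c * g x) \<in> fourier_multiplier m"
    using L by (auto simp: fourier_multiplier_def intro: L2_scale)
qed

section \<open>The spectral measure of a Fourier multiplier with real symbol\<close>

context
  fixes t :: "R3 \<Rightarrow> real"
  assumes t[measurable]: "t \<in> borel_measurable borel"
begin

abbreviation cut :: "real set \<Rightarrow> wavefun \<Rightarrow> wavefun" where
  "cut B f \<equiv> (\<lambda>\<xi>. of_real (indicator B (t \<xi>)) * f \<xi>)"

lemma cut_L2:
  assumes "f \<in> L2" "B \<in> sets borel" shows "cut B f \<in> L2"
proof (rule L2_mult_bounded[OF assms(1), of _ 1])
  note [measurable] = assms(2)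
  show "(\<lambda>\<xi>. complex_of_real (indicator B (t \<xi>))) \<in> borel_measurable borel" by measurable
qed (auto simp: indicator_def)

lemma spectral_projection_L2: "f \<in> L2 \<Longrightarrow> B \<in> sets borel \<Longrightarrow> spectral_projection t B f \<in> L2"
  unfolding spectral_projection_def by (rule fourier_inv_L2[OF cut_L2[OF fourier_L2]])

lemma fourier_spectral_projection:
  "f \<in> L2 \<Longrightarrow> B \<in> sets borel \<Longrightarrow> ae_eq (fourier (spectral_projection t B f)) (cut B (fourier f))"
  unfolding spectral_projection_def by (rule fourier_fourier_inv[OF cut_L2[OF fourier_L2]])

text \<open>Projections are identified on the Fourier side, where they act by indicators; the laws
  of a projection-valued measure then become pointwise algebra.\<close>

lemma spectral_projection_eqI:
  assumes "f \<in> L2" "B \<in> sets borel" "h \<in> L2" "ae_eq (fourier h) (cut B (fourier f))"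
  shows "ae_eq (spectral_projection t B f) h"
  by (rule fourier_eqD[OF spectral_projection_L2[OF assms(1,2)] assms(3)
        ae_eq_trans[OF fourier_spectral_projection[OF assms(1,2)] ae_eq_sym[OF assms(4)]]])

lemma orthogonal_projection_spectral_projection:
  assumes B: "B \<in> sets borel" shows "orthogonal_projection (spectral_projection t B)"
  unfolding orthogonal_projection_def
proof (intro conjI allI ballI impI)
  let ?P = "spectral_projection t B"
  note P = spectral_projection_L2[OF _ B] and FP = fourier_spectral_projection[OF _ B]
  { fix f assume f: "f \<in> L2" show "?P f \<in> L2" by (rule P[OF f]) }
  { fix f g assume f: "f \<in> L2" and g: "g \<in> L2" and fg: "ae_eq f g"
    show "ae_eq (?P f) (?P g)"
    proof (rule spectral_projection_eqI[OF f B P[OF g]])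
      show "ae_eq (fourier (?P g)) (cut B (fourier f))"
        using FP[OF g] fourier_cong[OF f g fg] unfolding ae_eq_def by eventually_elim simp
    qed }
  { fix f g assume f: "f \<in> L2" and g: "g \<in> L2"
    show "ae_eq (?P (\<lambda>x. f x + g x)) (\<lambda>x. ?P f x + ?P g x)"
    proof (rule spectral_projection_eqI[OF L2_add[OF f g] B L2_add[OF P[OF f] P[OF g]]])
      show "ae_eq (fourier (\<lambda>x. ?P f x + ?P g x)) (cut B (fourier (\<lambda>x. f x + g x)))"
        using fourier_add[OF P[OF f] P[OF g]] fourier_add[OF f g] FP[OF f] FP[OF g]
        unfolding ae_eq_def by eventually_elim (simp add: distrib_left)
    qed }
  { fix c f assume f: "f \<in> L2"
    show "ae_eq (?P (\<lambda>x. c * f x)) (\<lambda>x. c * ?P f x)"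
    proof (rule spectral_projection_eqI[OF L2_scale[OF f] B L2_scale[OF P[OF f]]])
      show "ae_eq (fourier (\<lambda>x. c * ?P f x)) (cut B (fourier (\<lambda>x. c * f x)))"
        using fourier_scale[OF P[OF f], of c] fourier_scale[OF f, of c] FP[OF f]
        unfolding ae_eq_def by eventually_elim simp
    qed }
  { fix f assume f: "f \<in> L2"
    show "ae_eq (?P (?P f)) (?P f)"
    proof (rule spectral_projection_eqI[OF P[OF f] B P[OF f]])
      show "ae_eq (fourier (?P f)) (cut B (fourier (?P f)))"
        using FP[OF f] unfolding ae_eq_def by eventually_elim (simp add: indicator_def)
    qed }
  { fix f g assume f: "f \<in> L2" and g: "g \<in> L2"
    have "l2_inner (?P f) g = l2_inner (fourier (?P f)) (fourier g)"
      by (rule fourier_inner[OF P[OF f] g, symmetric])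
    also have "\<dots> = l2_inner (cut B (fourier f)) (fourier g)"
      by (rule l2_inner_cong[OF FP[OF f] ae_eq_refl]) (intro L2_measurable cut_L2 B fourier_L2 f g P)+
    also have "\<dots> = l2_inner (fourier f) (cut B (fourier g))"
      unfolding l2_inner_def by (simp add: mult_ac)
    also have "\<dots> = l2_inner (fourier f) (fourier (?P g))"
      by (rule l2_inner_cong[OF ae_eq_refl ae_eq_sym[OF FP[OF g]]]) (intro L2_measurable cut_L2 B fourier_L2 f g P)+
    also have "\<dots> = l2_inner f (?P g)" by (rule fourier_inner[OF f P[OF g]])
    finally show "l2_inner (?P f) g = l2_inner f (?P g)" . }
qed

text \<open>The isometry moves the claim to the Fourier side. There disjointness makes the partial
  sums constant from some index on at every point, and their distance from the limit never exceeds
  \<open>cmod (fourier f \<xi>)\<close>, so dominated convergence applies.\<close>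

lemma spectral_projection_countably_additive:
  assumes B: "range B \<subseteq> sets borel" and disj: "disjoint_family B" and f: "f \<in> L2"
  shows "(\<lambda>N. l2_norm (\<lambda>x. spectral_projection t (\<Union>i::nat. B i) f x - (\<Sum>i<N. spectral_projection t (B i) f x))) \<longlonglongrightarrow> 0"
proof -
  have Bi[measurable]: "B i \<in> sets borel" for i using B by auto
  then have U: "(\<Union>i. B i) \<in> sets borel" by auto
  note [measurable] = L2_measurable[OF fourier_L2[OF f]]
  let ?P = "\<lambda>B. spectral_projection t B f"
  have "l2_norm (\<lambda>x. ?P (\<Union>i. B i) x - (\<Sum>i<N. ?P (B i) x))
      = l2_norm (\<lambda>\<xi>. (\<Sum>i<N. cut (B i) (fourier f) \<xi>) - cut (\<Union>i. B i) (fourier f) \<xi>)" for N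
  proof -
    have S: "(\<lambda>x. \<Sum>i<N. ?P (B i) x) \<in> L2" by (intro L2_sum spectral_projection_L2 f Bi)
    note PU = spectral_projection_L2[OF f U]
    have "AE \<xi> in lborel. \<forall>i\<in>{..<N}. fourier (?P (B i)) \<xi> = cut (B i) (fourier f) \<xi>"
      using fourier_spectral_projection[OF f Bi] by (intro AE_finite_allI) (auto simp: ae_eq_def)
    then have "ae_eq (fourier (\<lambda>x. ?P (\<Union>i. B i) x - (\<Sum>i<N. ?P (B i) x)))
       (\<lambda>\<xi>. cut (\<Union>i. B i) (fourier f) \<xi> - (\<Sum>i<N. cut (B i) (fourier f) \<xi>))"
      using fourier_diff[OF PU S] fourier_sum[of "\<lambda>i. ?P (B i)" N, OF spectral_projection_L2[OF f Bi]]
        fourier_spectral_projection[OF f U]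
      unfolding ae_eq_def by eventually_elim simp
    then have "l2_norm (fourier (\<lambda>x. ?P (\<Union>i. B i) x - (\<Sum>i<N. ?P (B i) x)))
      = l2_norm (\<lambda>\<xi>. cut (\<Union>i. B i) (fourier f) \<xi> - (\<Sum>i<N. cut (B i) (fourier f) \<xi>))"
      by (rule l2_norm_cong) (intro L2_measurable fourier_L2 L2_diff PU S cut_L2 L2_sum f U Bi)+
    then show ?thesis
      unfolding fourier_norm[OF L2_diff[OF PU S]] by (simp only: l2_norm_minus_commute)
  qed
  moreover have "(\<lambda>N. l2_norm (\<lambda>\<xi>. (\<Sum>i<N. cut (B i) (fourier f) \<xi>) - cut (\<Union>i. B i) (fourier f) \<xi>)) \<longlonglongrightarrow> 0"
  proof (rule l2_dominated_convergence[OF fourier_L2[OF f]])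
    have part: "(\<Sum>i<N. indicator (B i) s) = (if \<exists>i<N. s \<in> B i then 1 else 0 :: complex)" for N s
    proof (cases "\<exists>i<N. s \<in> B i")
      case True
      then obtain i where i: "i < N" "s \<in> B i" by blast
      have "(\<Sum>j<N. indicator (B j) s) = (\<Sum>j\<in>{i}. indicator (B j) s :: complex)"
        using i disj by (intro sum.mono_neutral_right) (auto simp: disjoint_family_on_def indicator_def)
      then show ?thesis using i True by simp
    qed (auto intro!: sum.neutral)
    have eq: "(\<Sum>i<N. cut (B i) (fourier f) \<xi>) = (if \<exists>i<N. t \<xi> \<in> B i then 1 else 0) * fourier f \<xi>" for N \<xi>
      unfolding part[symmetric] sum_distrib_right by (simp add: of_real_indicator)
    show "AE \<xi> in lborel. (\<lambda>N. \<Sum>i<N. cut (B i) (fourier f) \<xi>) \<longlonglongrightarrow> cut (\<Union>i. B i) (fourier f) \<xi>"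
    proof (rule AE_I2)
      fix \<xi>
      \<comment> \<open>If \<open>t \<xi>\<close> lies in no \<open>B i\<close>, any M will do.
        Otherwise M is the only index that hits, and every partial sum of at least
        \<open>Suc M\<close> terms contains it.\<close>
      obtain M where M: "\<forall>i. t \<xi> \<in> B i \<longrightarrow> t \<xi> \<in> B M" by blast
      have "(\<Sum>i<N. cut (B i) (fourier f) \<xi>) = cut (\<Union>i. B i) (fourier f) \<xi>" if "N \<ge> Suc M" for N
        unfolding eq using that M by (auto simp: indicator_def)
      then show "(\<lambda>N. \<Sum>i<N. cut (B i) (fourier f) \<xi>) \<longlonglongrightarrow> cut (\<Union>i. B i) (fourier f) \<xi>"
        by (intro tendsto_eventually eventually_sequentiallyI)
    qed
    show "AE \<xi> in lborel. cmod ((\<Sum>i<N. cut (B i) (fourier f) \<xi>) - cut (\<Union>i. B i) (fourier f) \<xi>) \<le> cmod (fourier f \<xi>)" for N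
      unfolding eq by (intro AE_I2) (auto simp: indicator_def)
  qed (use U in measurable)
  ultimately show ?thesis by simp
qed

lemma projection_valued_measure_spectral_projection: "projection_valued_measure (spectral_projection t)"
  unfolding projection_valued_measure_def
proof (intro conjI ballI allI impI)
  fix B :: "real set" assume "B \<in> sets borel"
  then show "orthogonal_projection (spectral_projection t B)" by (rule orthogonal_projection_spectral_projection)
next
  fix f assume f: "f \<in> L2"
  show "ae_eq (spectral_projection t {} f) (\<lambda>x. 0)"
  proof (rule spectral_projection_eqI[OF f])
    show "ae_eq (fourier (\<lambda>x. 0)) (cut {} (fourier f))" using fourier_sum[of "\<lambda>_ _. 0" 0] by simp
  qed simp_all
  show "ae_eq (spectral_projection t UNIV f) f"
    by (rule spectral_projection_eqI[OF f]) (simp_all add: f)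
next
  fix B C :: "real set" and f assume B: "B \<in> sets borel" and C: "C \<in> sets borel" and f: "f \<in> L2"
  show "ae_eq (spectral_projection t (B \<inter> C) f) (spectral_projection t B (spectral_projection t C f))"
  proof (rule spectral_projection_eqI[OF f sets.Int[OF B C]])
    note Cf = spectral_projection_L2[OF f C]
    show "spectral_projection t B (spectral_projection t C f) \<in> L2" by (rule spectral_projection_L2[OF Cf B])
    show "ae_eq (fourier (spectral_projection t B (spectral_projection t C f))) (cut (B \<inter> C) (fourier f))"
      using fourier_spectral_projection[OF Cf B] fourier_spectral_projection[OF f C]
      unfolding ae_eq_def by eventually_elim (simp add: indicator_def)
  qed
next
  fix B :: "nat \<Rightarrow> real set" and f assume "range B \<subseteq> sets borel" "disjoint_family B" "f \<in> L2"
  then show "(\<lambda>N. l2_norm (\<lambda>x. spectral_projection t (\<Union>i. B i) f x - (\<Sum>i<N. spectral_projection t (B i) f x))) \<longlonglongrightarrow> 0"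
    by (rule spectral_projection_countably_additive)
qed

lemma scalar_measure_spectral_projection:
  assumes f: "f \<in> L2"
  shows "scalar_measure (spectral_projection t) f
    = distr (density lborel (\<lambda>\<xi>. ennreal ((cmod (fourier f \<xi>))\<^sup>2))) borel t" (is "_ = ?M")
proof -
  note [measurable] = L2_measurable[OF fourier_L2[OF f]]
  have "ennreal ((l2_norm (spectral_projection t B f))\<^sup>2) = emeasure ?M B" if B[measurable]: "B \<in> sets borel" for B
  proof -
    note L = spectral_projection_L2[OF f B]
    have "l2_norm (spectral_projection t B f) = l2_norm (cut B (fourier f))"
      unfolding fourier_norm[OF L, symmetric]
      by (rule l2_norm_cong[OF fourier_spectral_projection[OF f B]]) (intro L2_measurable fourier_L2 L cut_L2 f B)+
    then have "ennreal ((l2_norm (spectral_projection t B f))\<^sup>2) = (\<integral>\<^sup>+\<xi>. ennreal ((cmod (cut B (fourier f) \<xi>))\<^sup>2) \<partial>lborel)"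
      by (simp add: nn_integral_l2_norm cut_L2 fourier_L2 f B)
    also have "\<dots> = (\<integral>\<^sup>+\<xi>. ennreal ((cmod (fourier f \<xi>))\<^sup>2) * indicator (t -` B) \<xi> \<partial>lborel)"
      by (intro nn_integral_cong) (auto simp: indicator_def)
    also have "\<dots> = emeasure ?M B"
      using measurable_sets_borel[OF t B] by (subst emeasure_distr) (auto simp: emeasure_density)
    finally show ?thesis .
  qed
  \<comment> \<open>\<open>measure_of\<close> depends only on the values on the sigma-algebra, so
    agreement on Borel sets is enough.\<close>
  then have "scalar_measure (spectral_projection t) f = measure_of UNIV (sets borel) (emeasure ?M)"
    unfolding scalar_measure_def
    by (intro measure_of_eq) (auto simp: sets.sigma_sets_eq[of borel, simplified])
  also have "\<dots> = ?M" using measure_of_of_measure[of ?M] by simp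
  finally show ?thesis .
qed

text \<open>With the scalar measure as a push-forward, the integral of \<open>(g s)\<^sup>2\<close>
  is the squared norm of \<open>g (t \<xi>) * fourier f \<xi>\<close>. Hence the spectral domain is
  the maximal domain of the multiplier, and Parseval gives the quadratic form.\<close>

lemma is_spectral_integral_fourier_multiplier:
  assumes g[measurable]: "g \<in> borel_measurable borel"
  shows "is_spectral_integral (spectral_projection t) g (fourier_multiplier (\<lambda>\<xi>. g (t \<xi>)))"
proof -
  have int: "integrable (scalar_measure (spectral_projection t) f) (\<lambda>s. (g s)\<^sup>2)
      \<longleftrightarrow> integrable lborel (\<lambda>\<xi>. (cmod (of_real (g (t \<xi>)) * fourier f \<xi>))\<^sup>2)" if f: "f \<in> L2" for f
  proof -
    note [measurable] = L2_measurable[OF fourier_L2[OF f]]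
    show ?thesis unfolding scalar_measure_spectral_projection[OF f]
      by (subst integrable_distr_eq) (auto simp: integrable_density norm_mult power_mult_distrib mult.commute)
  qed
  have 1: "f \<in> L2 \<and> integrable (scalar_measure (spectral_projection t) f) (\<lambda>s. (g s)\<^sup>2)"
    if fh: "(f, h) \<in> fourier_multiplier (\<lambda>\<xi>. g (t \<xi>))" for f h
  proof -
    have f: "f \<in> L2" and h: "h \<in> L2" and e: "ae_eq (fourier h) (\<lambda>\<xi>. of_real (g (t \<xi>)) * fourier f \<xi>)"
      using fh by (auto simp: fourier_multiplier_def)
    note [measurable] = L2_measurable[OF fourier_L2[OF f]]
    have "(\<lambda>\<xi>. of_real (g (t \<xi>)) * fourier f \<xi>) \<in> L2"
      by (rule L2_ae_eq[OF fourier_L2[OF h] _ e]) measurable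
    then show ?thesis using f L2_integrable_square by (simp add: int)
  qed
  have 2: "\<exists>h. (f, h) \<in> fourier_multiplier (\<lambda>\<xi>. g (t \<xi>))"
    if f: "f \<in> L2" and i: "integrable (scalar_measure (spectral_projection t) f) (\<lambda>s. (g s)\<^sup>2)" for f
  proof -
    note [measurable] = L2_measurable[OF fourier_L2[OF f]]
    have m: "(\<lambda>\<xi>. of_real (g (t \<xi>)) * fourier f \<xi>) \<in> L2"
      using i unfolding int[OF f] by (intro L2I) measurable
    have "(f, fourier_inv (\<lambda>\<xi>. of_real (g (t \<xi>)) * fourier f \<xi>)) \<in> fourier_multiplier (\<lambda>\<xi>. g (t \<xi>))"
      using f m by (simp add: fourier_multiplier_def fourier_inv_L2 fourier_fourier_inv)
    then show ?thesis by blast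
  qed
  have 3: "l2_inner h f = of_real (LINT s|scalar_measure (spectral_projection t) f. g s)"
    if fh: "(f, h) \<in> fourier_multiplier (\<lambda>\<xi>. g (t \<xi>))" for f h
  proof -
    have f: "f \<in> L2" and h: "h \<in> L2" and e: "ae_eq (fourier h) (\<lambda>\<xi>. of_real (g (t \<xi>)) * fourier f \<xi>)"
      using fh by (auto simp: fourier_multiplier_def)
    note [measurable] = L2_measurable[OF fourier_L2[OF f]] L2_measurable[OF fourier_L2[OF h]]
    have "l2_inner h f = l2_inner (fourier h) (fourier f)" by (rule fourier_inner[OF h f, symmetric])
    also have "\<dots> = l2_inner (\<lambda>\<xi>. of_real (g (t \<xi>)) * fourier f \<xi>) (fourier f)"
      by (rule l2_inner_cong[OF e ae_eq_refl]) measurable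
    also have "\<dots> = (LINT \<xi>|lborel. complex_of_real ((cmod (fourier f \<xi>))\<^sup>2 * g (t \<xi>)))"
      unfolding l2_inner_def of_real_mult complex_norm_square by (simp add: mult_ac)
    also have "\<dots> = of_real (LINT \<xi>|lborel. (cmod (fourier f \<xi>))\<^sup>2 * g (t \<xi>))" by (rule integral_complex_of_real)
    also have "(LINT \<xi>|lborel. (cmod (fourier f \<xi>))\<^sup>2 * g (t \<xi>)) = (LINT s|scalar_measure (spectral_projection t) f. g s)"
      unfolding scalar_measure_spectral_projection[OF f]
      by (subst integral_distr) (auto simp: integral_density)
    finally show ?thesis .
  qed
  show ?thesis
    unfolding is_spectral_integral_def
  proof (intro conjI)
    show "Domain (fourier_multiplier (\<lambda>\<xi>. g (t \<xi>)))
      = {f \<in> L2. integrable (scalar_measure (spectral_projection t) f) (\<lambda>t. (g t)\<^sup>2)}"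
      using 1 2 by blast
    show "\<forall>(f, h)\<in>fourier_multiplier (\<lambda>\<xi>. g (t \<xi>)). l2_inner h f = of_real (integral\<^sup>L (scalar_measure (spectral_projection t) f) g)"
      using 3 by auto
  qed (rule linear_operator_fourier_multiplier)
qed

text \<open>One projection-valued measure serves both operators, since the identity function
  recovers the multiplier by t.\<close>

lemma is_function_of_op_fourier_multiplier:
  assumes "g \<in> borel_measurable borel"
  shows "is_function_of_op g (fourier_multiplier t) (fourier_multiplier (\<lambda>\<xi>. g (t \<xi>)))"
  unfolding is_function_of_op_def
proof (intro exI conjI)
  show "projection_valued_measure (spectral_projection t)" by (rule projection_valued_measure_spectral_projection)
  show "is_spectral_integral (spectral_projection t) (\<lambda>s. s) (fourier_multiplier t)"
    by (rule is_spectral_integral_fourier_multiplier) simp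
  show "is_spectral_integral (spectral_projection t) g (fourier_multiplier (\<lambda>\<xi>. g (t \<xi>)))"
    by (rule is_spectral_integral_fourier_multiplier[OF assms])
qed

end


subsection \<open>The Laplacian as a Fourier multiplier\<close>

text \<open>The steps \<open>1 / Suc n\<close> turn the derivative into a limit of a sequence, the
  form in which dominated convergence is applied to difference quotients.\<close>

lemma has_derivative_difference_quotient:
  fixes f :: "'a::real_normed_vector \<Rightarrow> 'b::real_normed_vector"
  assumes "(f has_derivative D) (at x)"
  shows "(\<lambda>n. real (Suc n) *\<^sub>R (f (x + (1 / real (Suc n)) *\<^sub>R v) - f x)) \<longlonglongrightarrow> D v"
\<comment> \<open>The filter \<open>at 0\<close> excludes 0, so the increments must not
  vanish.\<close>
proof (cases "v = 0")
  case True
  then show ?thesis using assms by (simp add: has_derivative_zero_unique linear_simps has_derivative_bounded_linear)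
next
  case False
  let ?h = "\<lambda>n. (1 / real (Suc n)) *\<^sub>R v"
  have "?h \<longlonglongrightarrow> 0 *\<^sub>R v" by (intro tendsto_intros LIMSEQ_Suc lim_1_over_n)
  then have h: "filterlim ?h (at 0) sequentially"
    using False by (auto simp: filterlim_at)
  have bl: "bounded_linear D" using assms by (rule has_derivative_bounded_linear)
  have "((\<lambda>h. norm (f (x + h) - f x - D h) / norm h) \<longlongrightarrow> 0) (at 0)"
    using assms unfolding has_derivative_at by simp
  from filterlim_compose[OF this h]
  have "(\<lambda>n. norm (f (x + ?h n) - f x - D (?h n)) / norm (?h n) * norm v) \<longlonglongrightarrow> 0 * norm v"
    by (intro tendsto_intros)
  moreover have "norm (f (x + ?h n) - f x - D (?h n)) / norm (?h n) * norm v
      = norm (real (Suc n) *\<^sub>R (f (x + ?h n) - f x) - D v)" for n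
  proof -
    have "real (Suc n) *\<^sub>R (f (x + ?h n) - f x) - D v = real (Suc n) *\<^sub>R (f (x + ?h n) - f x - D (?h n))"
      using bl by (simp add: linear_simps scaleR_diff_right del: of_nat_Suc)
    moreover have "e / norm (?h n) * norm v = real (Suc n) * e" for e using False by simp
    ultimately show ?thesis by simp
  qed
  ultimately have "(\<lambda>n. norm (real (Suc n) *\<^sub>R (f (x + ?h n) - f x) - D v)) \<longlonglongrightarrow> 0" by simp
  then show ?thesis by (simp add: tendsto_norm_zero_iff LIM_zero_iff del: of_nat_Suc)
qed

lemma C_k_imp_continuous: "C_k n f \<Longrightarrow> continuous_on UNIV f"
proof (cases n)
  case (Suc m)
  assume "C_k n f"
  then have "\<forall>x. f differentiable (at x)" using Suc by simp
  then show ?thesis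
    by (intro continuous_at_imp_continuous_on ballI differentiable_imp_continuous_within) simp
qed simp

lemma test_functionD:
  assumes "test_function \<eta>"
  shows "continuous_on UNIV \<eta>" "\<eta> differentiable (at x)"
proof -
  have "\<forall>n. C_k n \<eta>" using assms unfolding test_function_def by (rule conjunct1)
  then have C: "C_k (Suc 0) \<eta>" by (rule spec)
  show "continuous_on UNIV \<eta>" using C by (rule C_k_imp_continuous)
  show "\<eta> differentiable (at x)" using C by simp
qed

lemma test_function_support:
  assumes "test_function \<eta>" shows "\<exists>R. \<forall>x. norm x > R \<longrightarrow> \<eta> x = 0"
proof -
  have "compact (closure {x. \<eta> x \<noteq> 0})" using assms by (simp only: test_function_def)
  then have "bounded (closure {x. \<eta> x \<noteq> 0})" by (rule compact_imp_bounded)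
  then obtain R where R: "\<forall>x\<in>closure {x. \<eta> x \<noteq> 0}. norm x \<le> R" unfolding bounded_iff by blast
  have "\<eta> x = 0" if "norm x > R" for x
  proof (rule ccontr)
    assume "\<eta> x \<noteq> 0"
    then have "x \<in> closure {x. \<eta> x \<noteq> 0}" by (intro subsetD[OF closure_subset]) simp
    with R have "norm x \<le> R" by (rule bspec)
    with that show False by simp
  qed
  then show ?thesis by (intro exI[of _ R] allI impI)
qed

lemma test_function_bounds:
  assumes "test_function \<eta>"
  shows "\<exists>M>0. \<forall>x. cmod (\<eta> x) \<le> M" "integrable lborel \<eta>" "integrable lborel (\<lambda>x. (cmod (\<eta> x))\<^sup>2)"
proof -
  obtain R where R: "\<forall>x. norm x > R \<longrightarrow> \<eta> x = 0" using test_function_support[OF assms] by (rule exE)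
  have "(\<exists>M>0. \<forall>x. cmod (\<eta> x) \<le> M) \<and> integrable lborel \<eta> \<and> integrable lborel (\<lambda>x. (cmod (\<eta> x))\<^sup>2)"
  proof (rule continuous_compact_support[where f=\<eta> and R=R])
    fix M assume "\<And>x. cmod (\<eta> x) \<le> M" "M > 0" "integrable lborel \<eta>" "integrable lborel (\<lambda>x. (cmod (\<eta> x))\<^sup>2)"
    then show ?thesis by auto
  qed (use R test_functionD(1)[OF assms] in simp_all)
  then show "\<exists>M>0. \<forall>x. cmod (\<eta> x) \<le> M" "integrable lborel \<eta>" "integrable lborel (\<lambda>x. (cmod (\<eta> x))\<^sup>2)"
    by simp_all
qed

lemmas test_function_integrable = test_function_bounds(2)

lemma test_function_L2: "test_function \<eta> \<Longrightarrow> \<eta> \<in> L2"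
  by (rule L2I[OF borel_measurable_continuous_onI[OF test_functionD(1)] test_function_bounds(3)])

lemma test_function_partial:
  assumes \<eta>: "test_function \<eta>" shows "test_function (partial i \<eta>)"
  unfolding test_function_def
proof (intro conjI allI)
  fix n
  have "\<forall>n. C_k n \<eta>" using \<eta> unfolding test_function_def by (rule conjunct1)
  then have "C_k (Suc n) \<eta>" by (rule spec)
  then show "C_k n (partial i \<eta>)" by simp
next
  let ?S = "closure {x. \<eta> x \<noteq> 0}"
  \<comment> \<open>Off its closed support \<eta> vanishes in a whole neighbourhood, and so does its
    derivative.\<close>
  have "partial i \<eta> x = 0" if "x \<notin> ?S" for x
  proof -
    have "(\<eta> has_derivative (\<lambda>_. 0)) (at x)"
    proof (rule has_derivative_transform_within_open[of "\<lambda>_. 0"])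
      show "open (- ?S)" by (rule open_Compl[OF closed_closure])
      show "x \<in> - ?S" using that by simp
      show "0 = \<eta> y" if "y \<in> - ?S" for y using that closure_subset[of "{x. \<eta> x \<noteq> 0}"] by auto
    qed simp
    then show ?thesis by (simp add: partial_def frechet_derivative_at[symmetric])
  qed
  then have "closure {x. partial i \<eta> x \<noteq> 0} \<subseteq> ?S" by (intro closure_minimal) auto
  moreover have "compact ?S" using \<eta> by (simp add: test_function_def)
  ultimately show "compact (closure {x. partial i \<eta> x \<noteq> 0})"
    using compact_Int_closed[of ?S "closure {x. partial i \<eta> x \<noteq> 0}"] by (simp add: Int_absorb1)
qed

lemma partial_has_derivative:
  assumes "f differentiable (at x)" shows "(f has_derivative frechet_derivative f (at x)) (at x)"
  using assms by (simp add: frechet_derivative_works)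

text \<open>The mean value inequality along the line in direction i. It bounds all difference
  quotients at once and so supplies the dominator for the transform of a partial derivative.\<close>

lemma partial_increment_bound:
  fixes f :: "R3 \<Rightarrow> complex"
  assumes d: "\<And>x. f differentiable (at x)" and B: "\<And>x. cmod (partial i f x) \<le> B"
  shows "cmod (f (x + h *\<^sub>R axis i 1) - f x) \<le> B * \<bar>h\<bar>"
proof -
  let ?g = "\<lambda>s. f (x + s *\<^sub>R axis i 1)"
  have D: "(?g has_derivative (\<lambda>u. u *\<^sub>R partial i f (x + s *\<^sub>R axis i 1))) (at s within UNIV)" for s
  proof -
    let ?D = "frechet_derivative f (at (x + s *\<^sub>R axis i 1))"
    have bl: "bounded_linear ?D" using partial_has_derivative[OF d] by (rule has_derivative_bounded_linear)
    have "(?g has_derivative (\<lambda>u. ?D (u *\<^sub>R axis i 1))) (at s)"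
      by (rule has_derivative_compose[of "\<lambda>s. x + s *\<^sub>R axis i 1" "\<lambda>u. u *\<^sub>R axis i 1" s UNIV f, OF _ partial_has_derivative[OF d]])
         (auto intro!: derivative_eq_intros)
    then show ?thesis using bl by (simp add: partial_def linear_simps)
  qed
  have "norm (?g h - ?g 0) \<le> B * norm (h - 0)"
  proof (rule differentiable_bound[of UNIV ?g "\<lambda>s u. u *\<^sub>R partial i f (x + s *\<^sub>R axis i 1)"])
    show "onorm (\<lambda>u. u *\<^sub>R partial i f (x + s *\<^sub>R axis i 1)) \<le> B" for s
    proof (rule onorm_le)
      fix u
      have "\<bar>u\<bar> * cmod (partial i f (x + s *\<^sub>R axis i 1)) \<le> \<bar>u\<bar> * B" by (intro mult_left_mono B) simp
      then show "norm (u *\<^sub>R partial i f (x + s *\<^sub>R axis i 1)) \<le> B * norm u" by (simp add: mult.commute)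
    qed
  qed (use D in auto)
  then show ?thesis by simp
qed

lemma fourier_L1_translate:
  assumes [measurable]: "f \<in> borel_measurable borel"
  shows "fourier_L1 (\<lambda>x. f (x + a)) \<xi> = cis (\<xi> \<bullet> a) * fourier_L1 f \<xi>"
proof -
  let ?F = "\<lambda>x. cis (- (\<xi> \<bullet> (x - a))) * f x"
  have "(LINT x|lborel. cis (- (\<xi> \<bullet> x)) * f (x + a)) = (LINT x|lborel. ?F (a + 1 *\<^sub>R x))"
    by (simp add: add.commute)
  also have "\<dots> = (LINT x|lborel. ?F x)"
    using lborel_integral_affine(2)[of 1 ?F a] by simp
  also have "\<dots> = (LINT x|lborel. cis (\<xi> \<bullet> a) * (cis (- (\<xi> \<bullet> x)) * f x))"
  proof (rule Bochner_Integration.integral_cong)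
    fix x
    have "cis (- (\<xi> \<bullet> (x - a))) = cis (\<xi> \<bullet> a) * cis (- (\<xi> \<bullet> x))" by (simp add: cis_mult inner_diff_right)
    then show "?F x = cis (\<xi> \<bullet> a) * (cis (- (\<xi> \<bullet> x)) * f x)" by simp
  qed simp
  also have "\<dots> = cis (\<xi> \<bullet> a) * (LINT x|lborel. cis (- (\<xi> \<bullet> x)) * f x)" by (rule integral_mult_right_zero)
  finally show ?thesis by (simp add: fourier_L1_def mult_ac)
qed

text \<open>Both sides are limits of the transforms of difference quotients: in space by dominated
  convergence, in frequency because a translation by h acts as multiplication by
  \<open>cis (h * \<xi> $ i)\<close>.\<close>

lemma fourier_L1_partial:
  assumes \<eta>: "test_function \<eta>"
  shows "fourier_L1 (partial i \<eta>) \<xi> = \<i> * of_real (\<xi> $ i) * fourier_L1 \<eta> \<xi>"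
proof (rule LIMSEQ_unique)
  let ?h = "\<lambda>n. 1 / real (Suc n)"
  let ?D = "\<lambda>n x. real (Suc n) *\<^sub>R (\<eta> (x + ?h n *\<^sub>R axis i 1) - \<eta> x)"
  note d = test_functionD(2)[OF \<eta>]
  have int: "integrable lborel \<eta>" by (rule test_function_integrable[OF \<eta>])
  have [measurable]: "\<eta> \<in> borel_measurable borel" using borel_measurable_integrable[OF int] by simp
  have pm[measurable]: "partial i \<eta> \<in> borel_measurable borel"
    using L2_measurable[OF test_function_L2[OF test_function_partial[OF \<eta>]]] .
  obtain R where R: "\<And>x. norm x > R \<Longrightarrow> \<eta> x = 0" using test_function_support[OF \<eta>] by blast
  obtain B where B: "\<And>x. cmod (partial i \<eta> x) \<le> B" "B > 0"
    using test_function_bounds(1)[OF test_function_partial[OF \<eta>]] by blast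
  \<comment> \<open>The steps have length at most 1, so every difference quotient vanishes outside
    radius R + 1.\<close>
  have bound: "cmod (?D n x) \<le> B * indicator (cball 0 (R + 1)) x" for n x
  proof (cases "norm x \<le> R + 1")
    case True
    have "cmod (?D n x) = real (Suc n) * cmod (\<eta> (x + ?h n *\<^sub>R axis i 1) - \<eta> x)" by simp
    also have "\<dots> \<le> real (Suc n) * (B * \<bar>?h n\<bar>)"
      by (intro mult_left_mono partial_increment_bound d B) auto
    also have "\<dots> = B" by simp
    finally show ?thesis using True by simp
  next
    case False
    have "norm (?h n *\<^sub>R axis i 1 :: R3) \<le> 1" by simp
    then have "norm (x + ?h n *\<^sub>R axis i 1) > R" using False norm_diff_ineq[of x "?h n *\<^sub>R axis i 1"] by linarith
    moreover have "norm x > R" using False by simp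
    ultimately show ?thesis using R B(2) by simp
  qed
  have "(\<lambda>n. LINT x|lborel. cis (- (\<xi> \<bullet> x)) * ?D n x) \<longlonglongrightarrow> (LINT x|lborel. cis (- (\<xi> \<bullet> x)) * partial i \<eta> x)"
  proof (rule integral_dominated_convergence)
    show "integrable lborel (\<lambda>x::R3. B * indicator (cball 0 (R + 1)) x)"
      by (intro integrable_mult_right integrable_real_indicator emeasure_lborel_cball_finite) simp
    show "AE x in lborel. (\<lambda>n. cis (- (\<xi> \<bullet> x)) * ?D n x) \<longlonglongrightarrow> cis (- (\<xi> \<bullet> x)) * partial i \<eta> x"
      unfolding partial_def
      by (intro AE_I2 tendsto_mult[OF tendsto_const] has_derivative_difference_quotient partial_has_derivative d)
    show "AE x in lborel. norm (cis (- (\<xi> \<bullet> x)) * ?D n x) \<le> B * indicator (cball 0 (R + 1)) x" for n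
      using bound[of n] by (intro AE_I2) (simp add: norm_mult)
  qed measurable
  then have "(\<lambda>n. fourier_L1 (?D n) \<xi>) \<longlonglongrightarrow> fourier_L1 (partial i \<eta>) \<xi>"
    unfolding fourier_L1_def by (intro tendsto_intros)
  \<comment> \<open>The terms \<open>0 + ?h n *\<^sub>R 1\<close> and \<open>0 * \<xi> $ i\<close>
    are left unsimplified to match the difference quotient of \<open>cis\<close> at 0 in direction
    1.\<close>
  moreover have "fourier_L1 (?D n) \<xi> = real (Suc n) *\<^sub>R (cis ((0 + ?h n *\<^sub>R 1) * \<xi> $ i) - cis (0 * \<xi> $ i)) * fourier_L1 \<eta> \<xi>" for n
  proof -
    have i2: "integrable lborel (\<lambda>x. \<eta> (x + ?h n *\<^sub>R axis i 1))"
      using lborel_integral_affine(1)[of 1 \<eta> "?h n *\<^sub>R axis i 1"] int by (simp add: add.commute)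
    have "fourier_L1 (?D n) \<xi> = fourier_L1 (\<lambda>x. of_real (real (Suc n)) * (\<eta> (x + ?h n *\<^sub>R axis i 1) - \<eta> x)) \<xi>"
      by (simp add: scaleR_conv_of_real)
    also have "\<dots> = of_real (real (Suc n)) * (cis (\<xi> \<bullet> (?h n *\<^sub>R axis i 1)) * fourier_L1 \<eta> \<xi> - fourier_L1 \<eta> \<xi>)"
      unfolding fourier_L1_scale fourier_L1_diff[OF i2 int] by (subst fourier_L1_translate) auto
    also have "\<xi> \<bullet> (?h n *\<^sub>R axis i 1) = ?h n * \<xi> $ i" by (simp add: inner_axis)
    finally show ?thesis by (simp add: algebra_simps scaleR_conv_of_real del: of_nat_Suc)
  qed
  ultimately show "(\<lambda>n. real (Suc n) *\<^sub>R (cis ((0 + ?h n *\<^sub>R 1) * \<xi> $ i) - cis (0 * \<xi> $ i)) * fourier_L1 \<eta> \<xi>)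
      \<longlonglongrightarrow> fourier_L1 (partial i \<eta>) \<xi>" by simp
  have "((\<lambda>s. \<i> * complex_of_real (s * \<xi> $ i)) has_derivative (\<lambda>u. \<i> * of_real (u * \<xi> $ i))) (at 0)"
    by (intro bounded_linear_imp_has_derivative bounded_linear_const_mult bounded_linear_compose[OF bounded_linear_of_real] bounded_linear_mult_left)
  from has_derivative_compose[OF this DERIV_exp[unfolded has_field_derivative_def]]
  have "((\<lambda>s. cis (s * \<xi> $ i)) has_derivative (\<lambda>u. \<i> * of_real (u * \<xi> $ i))) (at 0)"
    by (simp add: cis_conv_exp)
  from tendsto_mult[OF has_derivative_difference_quotient[OF this, of 1] tendsto_const[of "fourier_L1 \<eta> \<xi>"]]
  show "(\<lambda>n. real (Suc n) *\<^sub>R (cis ((0 + ?h n *\<^sub>R 1) * \<xi> $ i) - cis (0 * \<xi> $ i)) * fourier_L1 \<eta> \<xi>)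
      \<longlonglongrightarrow> \<i> * of_real (\<xi> $ i) * fourier_L1 \<eta> \<xi>" by simp
qed

lemma test_function_laplacian_integrable:
  assumes \<eta>: "test_function \<eta>" shows "integrable lborel (laplacian \<eta>)" "laplacian \<eta> \<in> L2"
proof -
  note p = test_function_partial[OF test_function_partial[OF \<eta>]]
  show "integrable lborel (laplacian \<eta>)" unfolding laplacian_def[abs_def]
    by (intro Bochner_Integration.integrable_sum test_function_integrable p)
  show "laplacian \<eta> \<in> L2" unfolding laplacian_def[abs_def] by (intro L2_sum test_function_L2 p)
qed

lemma fourier_L1_laplacian:
  assumes \<eta>: "test_function \<eta>"
  shows "fourier_L1 (laplacian \<eta>) \<xi> = - of_real ((norm \<xi>)\<^sup>2) * fourier_L1 \<eta> \<xi>"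
proof -
  note p = test_function_partial[OF test_function_partial[OF \<eta>]]
  have "fourier_L1 (laplacian \<eta>) \<xi> = (\<Sum>i\<in>UNIV. fourier_L1 (partial i (partial i \<eta>)) \<xi>)"
    unfolding fourier_L1_def laplacian_def sum_distrib_left
    by (subst Bochner_Integration.integral_sum)
       (simp_all add: sum_distrib_left integrable_cis_mult[OF test_function_integrable[OF p]])
  also have "\<dots> = (\<Sum>i\<in>UNIV. - of_real ((\<xi> $ i)\<^sup>2) * fourier_L1 \<eta> \<xi>)"
  proof (intro sum.cong refl)
    fix i :: 3
    have "\<i> * a * (\<i> * a * z) = (\<i> * \<i>) * (a\<^sup>2 * z)" for a z :: complex
      by (simp only: power2_eq_square mult_ac)
    then show "fourier_L1 (partial i (partial i \<eta>)) \<xi> = - of_real ((\<xi> $ i)\<^sup>2) * fourier_L1 \<eta> \<xi>"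
      by (simp add: fourier_L1_partial test_function_partial \<eta>)
  qed
  also have "\<dots> = - of_real (\<Sum>i\<in>UNIV. (\<xi> $ i)\<^sup>2) * fourier_L1 \<eta> \<xi>"
    by (simp add: sum_distrib_right sum_negf)
  also have "(\<Sum>i\<in>UNIV. (\<xi> $ i)\<^sup>2) = (norm \<xi>)\<^sup>2"
    unfolding power2_norm_eq_inner inner_vec_def by (simp add: power2_eq_square)
  finally show ?thesis .
qed

section \<open>Smooth bump functions and their transforms\<close>

text \<open>The polynomial is a parameter because all derivatives of \<open>exp (- 1/u)\<close> have
  this form, each with another polynomial.\<close>

definition bump_piece :: "real poly \<Rightarrow> real \<Rightarrow> real" where
  "bump_piece p u = (if u > 0 then poly p (inverse u) * exp (- inverse u) else 0)"

lemma poly_times_exp_minus_tendsto_0: "((\<lambda>y. poly p y * exp (- y)) \<longlongrightarrow> (0::real)) at_top"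
proof -
  have "((\<lambda>y. \<Sum>i\<le>degree p. coeff p i * (y ^ i / exp y)) \<longlongrightarrow> (\<Sum>i\<le>degree p. coeff p i * 0)) at_top"
    by (intro tendsto_sum tendsto_mult tendsto_const tendsto_power_div_exp_0)
  moreover have "(\<lambda>y. \<Sum>i\<le>degree p. coeff p i * (y ^ i / exp y)) = (\<lambda>y. poly p y * exp (- y))"
    by (simp add: poly_altdef sum_distrib_right exp_minus divide_inverse mult.assoc fun_eq_iff)
  ultimately show ?thesis by simp
qed

text \<open>Away from 0 this is the chain rule, where \<open>[:0, 0, 1:]\<close> stands for the
  factor \<open>1 / u\<^sup>2\<close>. At 0 the exponential decay beats every power of
  \<open>1 / u\<close>.\<close>

lemma bump_piece_has_derivative:
  "(bump_piece p has_real_derivative bump_piece ([:0, 0, 1:] * (p - pderiv p)) u) (at u)"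
proof (cases u "0::real" rule: linorder_cases)
  case less
  have "(bump_piece p has_real_derivative 0) (at u)"
  proof (rule has_field_derivative_transform_within_open[of "\<lambda>_. 0"])
    show "open {..<0::real}" by simp
  qed (use less in \<open>auto simp: bump_piece_def\<close>)
  then show ?thesis using less by (simp add: bump_piece_def)
next
  case greater
  have "((\<lambda>u. poly p (inverse u) * exp (- inverse u)) has_real_derivative
      bump_piece ([:0, 0, 1:] * (p - pderiv p)) u) (at u)"
    using greater
    by (auto intro!: derivative_eq_intros DERIV_chain2[OF poly_DERIV] simp: bump_piece_def field_simps power2_eq_square)
  then show ?thesis
  proof (rule has_field_derivative_transform_within_open)
    show "open {0<..<u + 1}" by simp
  qed (use greater in \<open>auto simp: bump_piece_def\<close>)
next
  case equal
  have "((\<lambda>h. bump_piece p h / h) \<longlongrightarrow> 0) (at 0)"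
    unfolding filterlim_at_split
  proof
    have "((\<lambda>h. 0) \<longlongrightarrow> (0::real)) (at_left (0::real))" by simp
    then show "((\<lambda>h. bump_piece p h / h) \<longlongrightarrow> 0) (at_left 0)"
      by (rule Lim_transform_eventually) (auto simp: bump_piece_def eventually_at_filter)
  next
    \<comment> \<open>The factor \<open>[:0, 1:]\<close> accounts for the division by h.\<close>
    have "((\<lambda>h. poly (p * [:0, 1:]) (inverse h) * exp (- inverse h)) \<longlongrightarrow> 0) (at_right (0::real))"
      using filterlim_compose[OF poly_times_exp_minus_tendsto_0[of "p * [:0, 1:]"] filterlim_inverse_at_top_right] .
    then show "((\<lambda>h. bump_piece p h / h) \<longlongrightarrow> 0) (at_right 0)"
      by (rule Lim_transform_eventually) (auto simp: bump_piece_def eventually_at_filter field_simps)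
  qed
  then show ?thesis using equal by (simp add: DERIV_def bump_piece_def)
qed

text \<open>A syntactic class containing the coordinate pieces and closed under derivatives in any
  fixed direction, so that \<open>C_k\<close> of every order follows by one induction on the order.
  Constants enter as the inner derivatives \<open>s * v $ i\<close>.\<close>

inductive smooth :: "wavefun \<Rightarrow> bool" where
  base: "smooth (\<lambda>x. of_real (bump_piece p (s * x $ i + c)))"
| const: "smooth (\<lambda>x. k)"
| add: "smooth f \<Longrightarrow> smooth g \<Longrightarrow> smooth (\<lambda>x. f x + g x)"
| mult: "smooth f \<Longrightarrow> smooth g \<Longrightarrow> smooth (\<lambda>x. f x * g x)"

lemma smooth_derivative:
  assumes "smooth f"
  shows "\<exists>D. (\<forall>x. (f has_derivative D x) (at x)) \<and> (\<forall>v. smooth (\<lambda>x. D x v))"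
  using assms
proof induction
  case (base p s i c)
  let ?q = "[:0, 0, 1:] * (p - pderiv p)"
  let ?D = "\<lambda>(x::R3) (v::R3). complex_of_real (bump_piece ?q (s * x $ i + c)) * of_real (s * v $ i)"
  have "((\<lambda>x. complex_of_real (bump_piece p (s * x $ i + c))) has_derivative ?D x) (at x)" for x
  proof -
    have 1: "((\<lambda>x::R3. s * x $ i + c) has_derivative (\<lambda>v. s * v $ i)) (at x)"
      by (auto intro!: derivative_eq_intros bounded_linear_imp_has_derivative bounded_linear_vec_nth)
    have "((\<lambda>x. bump_piece p (s * x $ i + c)) has_derivative (\<lambda>v. s * v $ i * bump_piece ?q (s * x $ i + c))) (at x)"
      by (rule DERIV_compose_FDERIV[OF bump_piece_has_derivative 1])
    moreover have "(\<lambda>v. s * v $ i * bump_piece ?q (s * x $ i + c)) = (\<lambda>v::R3. bump_piece ?q (s * x $ i + c) * (s * v $ i))"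
      by (rule ext) (rule mult.commute)
    ultimately have "((\<lambda>x. bump_piece p (s * x $ i + c)) has_derivative (\<lambda>v. bump_piece ?q (s * x $ i + c) * (s * v $ i))) (at x)"
      by (simp only:)
    from bounded_linear.has_derivative[OF bounded_linear_of_real this] show ?thesis by (simp only: of_real_mult)
  qed
  moreover have "smooth (\<lambda>x. ?D x v)" for v by (intro smooth.intros)
  ultimately show ?case by (intro exI[of _ ?D]) simp
next
  case (const k)
  then show ?case by (intro exI[of _ "\<lambda>_ _. 0"]) (auto intro: smooth.const)
next
  case (add f g)
  then obtain D E where D: "\<And>x. (f has_derivative D x) (at x)" "\<And>v. smooth (\<lambda>x. D x v)"
    and E: "\<And>x. (g has_derivative E x) (at x)" "\<And>v. smooth (\<lambda>x. E x v)" by blast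
  show ?case
    by (rule exI[of _ "\<lambda>x v. D x v + E x v"]) (intro conjI allI has_derivative_add D E smooth.add)
next
  case (mult f g)
  then obtain D E where D: "\<And>x. (f has_derivative D x) (at x)" "\<And>v. smooth (\<lambda>x. D x v)"
    and E: "\<And>x. (g has_derivative E x) (at x)" "\<And>v. smooth (\<lambda>x. E x v)" by blast
  show ?case
    by (rule exI[of _ "\<lambda>x v. f x * E x v + D x v * g x"])
       (intro conjI allI has_derivative_mult smooth.add smooth.mult D E mult.hyps)
qed

lemma smooth_C_k: "smooth f \<Longrightarrow> C_k n f"
proof (induction n arbitrary: f)
  case 0
  from smooth_derivative[OF 0] obtain D where "\<And>x. (f has_derivative D x) (at x)" by blast
  then show ?case by (auto intro!: continuous_at_imp_continuous_on has_derivative_continuous)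
next
  case (Suc n)
  from smooth_derivative[OF Suc.prems] obtain D where D: "\<And>x. (f has_derivative D x) (at x)" "\<And>v. smooth (\<lambda>x. D x v)"
    by blast
  have "partial i f = (\<lambda>x. D x (axis i 1))" for i
    by (simp add: partial_def fun_eq_iff frechet_derivative_at[OF D(1), symmetric])
  then show ?case using D Suc.IH by (auto intro: differentiableI)
qed

lemma smooth_prod: "finite A \<Longrightarrow> (\<And>i. i \<in> A \<Longrightarrow> smooth (f i)) \<Longrightarrow> smooth (\<lambda>x. \<Prod>i\<in>A. f i x)"
  by (induction rule: finite_induct) (auto intro: smooth.const smooth.mult)

text \<open>For s > 0 this is positive exactly on the open cube
  \<open>\<bar>x $ i\<bar> < 1 / s\<close>, so large s concentrates it at 0.\<close>

definition bump :: "real \<Rightarrow> R3 \<Rightarrow> real" where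
  "bump s x = (\<Prod>i\<in>UNIV. bump_piece 1 (s * x $ i + 1) * bump_piece 1 (- s * x $ i + 1))"

lemma bump_nonneg: "bump s x \<ge> 0"
  unfolding bump_def by (intro prod_nonneg) (auto simp: bump_piece_def)

lemma bump_0_pos: "bump s 0 > 0"
  unfolding bump_def by (intro prod_pos) (auto simp: bump_piece_def)

text \<open>The 3 comes from bounding the norm by the sum of three coordinates, each at most 1 / s
  in modulus.\<close>

lemma bump_support:
  assumes s: "s > 0" and nz: "bump s x \<noteq> 0" shows "s * norm x \<le> 3"
proof -
  have "\<bar>x $ i\<bar> \<le> 1 / s" for i
  proof -
    have "bump_piece 1 (s * x $ i + 1) \<noteq> 0" "bump_piece 1 (- s * x $ i + 1) \<noteq> 0"
      using nz unfolding bump_def by auto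
    then have "s * x $ i + 1 > 0" "- s * x $ i + 1 > 0" by (auto simp: bump_piece_def split: if_splits)
    then show ?thesis using s by (auto simp: abs_le_iff field_simps)
  qed
  then have "(\<Sum>i\<in>UNIV. \<bar>x $ i\<bar>) \<le> (\<Sum>i\<in>(UNIV::3 set). 1 / s)" by (intro sum_mono)
  then have "norm x \<le> 3 / s" using norm_le_l1_cart[of x] by simp
  then show ?thesis using s by (simp add: field_simps)
qed

lemma test_function_bump:
  assumes s: "s > 0" shows "test_function (\<lambda>x. of_real (bump s x))"
proof -
  have "smooth (\<lambda>x. of_real (bump s x))"
    unfolding bump_def of_real_prod of_real_mult by (intro smooth_prod smooth.mult smooth.base) simp
  moreover have "bounded {x. complex_of_real (bump s x) \<noteq> 0}"
    unfolding bounded_iff using bump_support[OF s] s by (intro exI[of _ "3 / s"]) (auto simp: field_simps)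
  ultimately show ?thesis
    unfolding test_function_def by (simp add: smooth_C_k compact_closure)
qed

text \<open>On the support \<open>\<bar>\<xi> \<bullet> x\<bar> \<le> 3 * norm \<xi> / s < 1 < pi /
  2\<close>, so the cosine is positive there. The real part of the integral is that of a nonnegative
  function that is positive on a nonempty open set, and such a set is not negligible.\<close>

lemma fourier_L1_bump_nonzero:
  assumes s: "s > 3 * norm \<xi>" shows "fourier_L1 (\<lambda>x. of_real (bump s x)) \<xi> \<noteq> 0"
proof
  assume z: "fourier_L1 (\<lambda>x. of_real (bump s x)) \<xi> = 0"
  have s0: "s > 0" using s norm_ge_zero[of \<xi>] by linarith
  note T = test_function_bump[OF s0]
  let ?F = "\<lambda>x. cis (- (\<xi> \<bullet> x)) * complex_of_real (bump s x)"
  have i: "integrable lborel ?F" by (rule integrable_cis_mult[OF test_function_integrable[OF T]]) measurable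
  have "(LINT x|lborel. ?F x) = 0" using z fourier_const_pos by (simp add: fourier_L1_def)
  moreover have iR: "integrable lborel (\<lambda>x. Re (?F x))" by (rule integrable_Re[OF i])
  have "(LINT x|lborel. Re (?F x)) = Re (LINT x|lborel. ?F x)" by (rule integral_Re[OF i])
  ultimately have "(LINT x|lborel. Re (?F x)) = 0" by simp
  moreover have Re: "Re (?F x) = cos (\<xi> \<bullet> x) * bump s x" for x by simp
  have c: "cos (\<xi> \<bullet> x) > 0" if "bump s x \<noteq> 0" for x
  proof -
    have "s * \<bar>\<xi> \<bullet> x\<bar> \<le> s * (norm \<xi> * norm x)" using s0 by (intro mult_left_mono Cauchy_Schwarz_ineq2) simp
    also have "\<dots> = norm \<xi> * (s * norm x)" by simp
    also have "\<dots> \<le> norm \<xi> * 3" by (intro mult_left_mono bump_support[OF s0 that]) simp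
    also have "\<dots> < s" using s by simp
    finally have "\<bar>\<xi> \<bullet> x\<bar> < 1" using s0 by simp
    then show ?thesis using pi_gt3 by (intro cos_gt_zero_pi) auto
  qed
  have nn: "Re (?F x) \<ge> 0" for x unfolding Re using c[of x] bump_nonneg[of s x] by (cases "bump s x = 0") auto
  ultimately have ae: "AE x in lborel. Re (?F x) = 0"
    using integral_nonneg_eq_0_iff_AE[OF iR AE_I2[OF nn]] by blast
  let ?U = "{x. bump s x \<noteq> 0}"
  have cont: "continuous_on UNIV (\<lambda>x. complex_of_real (bump s x))" by (rule test_functionD(1)[OF T])
  have "open ((\<lambda>x. complex_of_real (bump s x)) -` (- {0}))"
    by (rule open_vimage[OF _ cont]) auto
  then have "open ?U" by (simp add: vimage_def)
  moreover have "?U \<noteq> {}" using bump_0_pos[of s] by (auto intro!: exI[of _ 0])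
  moreover have "negligible ?U"
  proof -
    have "AE x in lborel. x \<notin> ?U"
      using ae
    proof eventually_elim
      case (elim x)
      then show ?case using c[of x] unfolding Re by (cases "bump s x = 0") auto
    qed
    moreover have "?U \<in> sets lborel" using \<open>open ?U\<close> by simp
    ultimately have "?U \<in> null_sets lborel" by (subst AE_iff_null_sets) auto
    then show ?thesis unfolding negligible_iff_null_sets by (rule null_sets_completionI)
  qed
  ultimately show False using open_not_negligible by blast
qed

section \<open>Translated test functions and the weak Laplacian in Fourier space\<close>

lemma partial_translate:
  fixes f :: wavefun
  assumes "\<And>x. f differentiable (at x)"
  shows "(\<lambda>x. f (x + a)) differentiable (at x)" "partial i (\<lambda>x. f (x + a)) = (\<lambda>x. partial i f (x + a))"
proof -
  have D: "((\<lambda>x. f (x + a)) has_derivative frechet_derivative f (at (x + a))) (at x)" for x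
    by (rule has_derivative_compose[of "\<lambda>x. x + a" "\<lambda>v. v" x UNIV f, OF _ partial_has_derivative[OF assms]])
       (auto intro!: derivative_eq_intros)
  then show "(\<lambda>x. f (x + a)) differentiable (at x)" by (rule differentiableI)
  show "partial i (\<lambda>x. f (x + a)) = (\<lambda>x. partial i f (x + a))"
    by (simp add: partial_def fun_eq_iff frechet_derivative_at[OF D, symmetric])
qed

lemma C_k_translate: "C_k n f \<Longrightarrow> C_k n (\<lambda>x. f (x + a))" for f :: wavefun
proof (induction n arbitrary: f)
  case 0
  then show ?case by (auto intro!: continuous_on_compose2[of UNIV f] continuous_intros)
next
  case (Suc n)
  then have "\<And>x. f differentiable (at x)" by simp
  from partial_translate[OF this] Suc show ?case by simp
qed

lemma test_function_translate:
  assumes "test_function \<eta>" shows "test_function (\<lambda>x. \<eta> (x + a))"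
  unfolding test_function_def
proof (intro conjI allI)
  fix n
  have "\<forall>n. C_k n \<eta>" using assms unfolding test_function_def by (rule conjunct1)
  then show "C_k n (\<lambda>x. \<eta> (x + a))" by (intro C_k_translate) (rule spec)
  obtain R where R: "\<forall>x. norm x > R \<longrightarrow> \<eta> x = 0" using test_function_support[OF assms] by (rule exE)
  have "norm x \<le> R + norm a" if "\<eta> (x + a) \<noteq> 0" for x
  proof -
    have "norm (x + a) \<le> R" using R that by (meson not_le)
    then show ?thesis using norm_diff_ineq[of x a] by linarith
  qed
  then show "compact (closure {x. \<eta> (x + a) \<noteq> 0})"
    by (intro compact_closure[THEN iffD2]) (auto simp: bounded_iff)
qed

text \<open>Conjugating inside and outside the integral reverses the sign of the exponent, which
  reflects the frequency.\<close>

lemma fourier_inv_eq_fourier_L1: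
  assumes "integrable lborel \<psi>" "\<psi> \<in> L2"
  shows "ae_eq (fourier_inv \<psi>) (\<lambda>\<xi>. fourier_L1 \<psi> (- \<xi>))"
proof -
  have "cnj (fourier_L1 (\<lambda>x. cnj (\<psi> x)) \<xi>) = fourier_L1 \<psi> (- \<xi>)" for \<xi>
    unfolding fourier_L1_def complex_cnj_mult Bochner_Integration.integral_cnj[symmetric] by (simp add: cis_cnj)
  moreover have "ae_eq (fourier (\<lambda>x. cnj (\<psi> x))) (fourier_L1 (\<lambda>x. cnj (\<psi> x)))"
    using assms by (intro fourier_eq_fourier_L1 L2_cnj) auto
  ultimately show ?thesis unfolding ae_eq_def fourier_inv_def by (auto elim!: eventually_mono)
qed

text \<open>The pairing that defines \<open>neg_laplacian\<close> carries no conjugation, so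
  Parseval evaluates the transform of \<psi> at the reflected frequency.\<close>

lemma L2_pairing_fourier:
  assumes f: "f \<in> L2" and \<psi>: "integrable lborel \<psi>" "\<psi> \<in> L2"
  shows "(\<lambda>\<xi>. fourier_L1 \<psi> (- \<xi>)) \<in> L2"
    and "(LINT x|lborel. f x * \<psi> x) = (LINT \<xi>|lborel. fourier f \<xi> * fourier_L1 \<psi> (- \<xi>))"
proof -
  note [measurable] = fourier_L1_measurable[OF \<psi>(1)]
  show L: "(\<lambda>\<xi>. fourier_L1 \<psi> (- \<xi>)) \<in> L2"
    by (rule L2_ae_eq[OF fourier_inv_L2[OF \<psi>(2)] _ fourier_inv_eq_fourier_L1[OF \<psi>]]) measurable
  have "(LINT x|lborel. f x * \<psi> x) = l2_inner f (\<lambda>x. cnj (\<psi> x))" by (simp add: l2_inner_def)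
  also have "\<dots> = l2_inner (fourier f) (fourier (\<lambda>x. cnj (\<psi> x)))" by (rule fourier_inner[OF f L2_cnj[OF \<psi>(2)], symmetric])
  also have "\<dots> = (LINT \<xi>|lborel. fourier f \<xi> * fourier_inv \<psi> \<xi>)" by (simp add: l2_inner_def fourier_inv_def)
  also have "\<dots> = (LINT \<xi>|lborel. fourier f \<xi> * fourier_L1 \<psi> (- \<xi>))"
  proof (rule integral_cong_AE)
    note [measurable] = L2_measurable[OF fourier_L2[OF f]] L2_measurable[OF fourier_inv_L2[OF \<psi>(2)]]
    show "(\<lambda>\<xi>. fourier f \<xi> * fourier_inv \<psi> \<xi>) \<in> borel_measurable lborel"
      "(\<lambda>\<xi>. fourier f \<xi> * fourier_L1 \<psi> (- \<xi>)) \<in> borel_measurable lborel" by measurable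
    show "AE \<xi> in lborel. fourier f \<xi> * fourier_inv \<psi> \<xi> = fourier f \<xi> * fourier_L1 \<psi> (- \<xi>)"
      using fourier_inv_eq_fourier_L1[OF \<psi>] unfolding ae_eq_def by eventually_elim simp
  qed
  finally show "(LINT x|lborel. f x * \<psi> x) = (LINT \<xi>|lborel. fourier f \<xi> * fourier_L1 \<psi> (- \<xi>))" .
qed

text \<open>The weight \<open>(norm \<xi>)\<^sup>2\<close> is attached to the test function, where
  it produces the transform of \<open>- laplacian \<eta>\<close>. This is why the weighted transform
  is both square integrable and bounded.\<close>

lemma neg_laplacian_pairing:
  assumes f: "f \<in> L2" and \<eta>: "test_function \<eta>"
  shows "(\<lambda>\<xi>. of_real ((norm \<xi>)\<^sup>2) * fourier_L1 \<eta> (- \<xi>)) \<in> L2"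
    and "\<exists>C. \<forall>\<xi>. cmod (of_real ((norm \<xi>)\<^sup>2) * fourier_L1 \<eta> (- \<xi>)) \<le> C"
    and "(LINT x|lborel. f x * (- laplacian \<eta> x)) = (LINT \<xi>|lborel. fourier f \<xi> * (of_real ((norm \<xi>)\<^sup>2) * fourier_L1 \<eta> (- \<xi>)))"
proof -
  let ?\<psi> = "\<lambda>x. - laplacian \<eta> x"
  have \<psi>: "integrable lborel ?\<psi>" "?\<psi> \<in> L2"
    using test_function_laplacian_integrable[OF \<eta>] by (auto intro: L2_uminus)
  have eq: "of_real ((norm \<xi>)\<^sup>2) * fourier_L1 \<eta> (- \<xi>) = fourier_L1 ?\<psi> (- \<xi>)" for \<xi>
    using fourier_L1_scale[of "-1" "laplacian \<eta>" "- \<xi>"] by (simp add: fourier_L1_laplacian[OF \<eta>])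
  show "(\<lambda>\<xi>. of_real ((norm \<xi>)\<^sup>2) * fourier_L1 \<eta> (- \<xi>)) \<in> L2"
    unfolding eq by (rule L2_pairing_fourier(1)[OF f \<psi>])
  show "\<exists>C. \<forall>\<xi>. cmod (of_real ((norm \<xi>)\<^sup>2) * fourier_L1 \<eta> (- \<xi>)) \<le> C"
    unfolding eq using fourier_L1_norm_le[OF \<psi>(1)] by (intro exI allI)
  show "(LINT x|lborel. f x * (- laplacian \<eta> x)) = (LINT \<xi>|lborel. fourier f \<xi> * (of_real ((norm \<xi>)\<^sup>2) * fourier_L1 \<eta> (- \<xi>)))"
    unfolding eq by (rule L2_pairing_fourier(2)[OF f \<psi>])
qed

lemma fourier_L1_inj:
  assumes u: "integrable lborel u" "u \<in> L2" and z: "\<And>\<xi>. fourier_L1 u \<xi> = 0"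
  shows "ae_eq u (\<lambda>x. 0)"
proof -
  have "l2_norm u = 0" using fourier_L1_isometry[OF u] z by (simp add: l2_norm_def)
  then show ?thesis using l2_norm_eq_0_iff[OF u(2)] by simp
qed

text \<open>
  For the inclusion from left to right, testing against all translates of \<open>\<eta>\<close> shows that
  \<open>(|\<xi>|\<^sup>2 fourier f - fourier g) \<cdot> fourier_L1 \<eta> (- \<xi>)\<close> has vanishing Fourier transform. The second factor is
  removed by bumps concentrated near 0, whose transforms have no zeros on large balls.
\<close>

theorem neg_laplacian_eq_fourier_multiplier: "neg_laplacian = fourier_multiplier (\<lambda>\<xi>. (norm \<xi>)\<^sup>2)"
proof (intro set_eqI iffI)
  fix p assume "p \<in> fourier_multiplier (\<lambda>\<xi>. (norm \<xi>)\<^sup>2)"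
  then obtain f g where p: "p = (f, g)" and f: "f \<in> L2" and g: "g \<in> L2"
    and e: "ae_eq (fourier g) (\<lambda>\<xi>. of_real ((norm \<xi>)\<^sup>2) * fourier f \<xi>)"
    unfolding fourier_multiplier_def by blast
  have "(LINT x|lborel. f x * (- laplacian \<eta> x)) = (LINT x|lborel. g x * \<eta> x)" if \<eta>: "test_function \<eta>" for \<eta>
  proof -
    note i = test_function_integrable[OF \<eta>] test_function_L2[OF \<eta>]
    note [measurable] = L2_measurable[OF fourier_L2[OF f]] L2_measurable[OF fourier_L2[OF g]] fourier_L1_measurable[OF i(1)]
    have "AE \<xi> in lborel. fourier f \<xi> * (of_real ((norm \<xi>)\<^sup>2) * fourier_L1 \<eta> (- \<xi>)) = fourier g \<xi> * fourier_L1 \<eta> (- \<xi>)"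
      using e unfolding ae_eq_def by eventually_elim simp
    then show ?thesis
      unfolding neg_laplacian_pairing(3)[OF f \<eta>] L2_pairing_fourier(2)[OF g i] by (intro integral_cong_AE) measurable
  qed
  then show "p \<in> neg_laplacian" using p f g by (simp add: neg_laplacian_def)
next
  fix p assume "p \<in> neg_laplacian"
  then obtain f g where p: "p = (f, g)" and f: "f \<in> L2" and g: "g \<in> L2"
    and e: "\<And>\<eta>. test_function \<eta> \<Longrightarrow> (LINT x|lborel. f x * (- laplacian \<eta> x)) = (LINT x|lborel. g x * \<eta> x)"
    unfolding neg_laplacian_def by blast
  note [measurable] = L2_measurable[OF fourier_L2[OF f]] L2_measurable[OF fourier_L2[OF g]]
  let ?D = "\<lambda>\<xi>. of_real ((norm \<xi>)\<^sup>2) * fourier f \<xi> - fourier g \<xi>"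
  have zero: "AE \<xi> in lborel. ?D \<xi> * fourier_L1 \<eta> (- \<xi>) = 0" if \<eta>: "test_function \<eta>" for \<eta>
  proof -
    note i = test_function_integrable[OF \<eta>] test_function_L2[OF \<eta>]
    note [measurable] = fourier_L1_measurable[OF i(1)] borel_measurable_integrable[OF i(1)]
    let ?A = "\<lambda>\<xi>. of_real ((norm \<xi>)\<^sup>2) * fourier_L1 \<eta> (- \<xi>)" and ?B = "\<lambda>\<xi>. fourier_L1 \<eta> (- \<xi>)"
    \<comment> \<open>This is \<open>?D\<close> times \<open>?B\<close> with the weight moved into
      \<open>?A\<close>. As \<open>?D\<close> is not known to be square integrable, only this form
      shows that \<open>?u\<close> is integrable and square integrable.\<close>
    let ?u = "\<lambda>\<xi>. fourier f \<xi> * ?A \<xi> - fourier g \<xi> * ?B \<xi>"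
    have L: "?A \<in> L2" "?B \<in> L2" by (rule neg_laplacian_pairing(1)[OF f \<eta>], rule L2_pairing_fourier(1)[OF f i])
    have u1: "integrable lborel ?u"
      by (intro Bochner_Integration.integrable_diff L2_integrable_mult fourier_L2 f g L)
    obtain C where C: "\<And>\<xi>. cmod (?A \<xi>) \<le> C" using neg_laplacian_pairing(2)[OF f \<eta>] by blast
    have "(\<lambda>\<xi>. ?A \<xi> * fourier f \<xi>) \<in> L2" by (rule L2_mult_bounded[OF fourier_L2[OF f] _ C]) measurable
    moreover have "(\<lambda>\<xi>. ?B \<xi> * fourier g \<xi>) \<in> L2"
      by (rule L2_mult_bounded[OF fourier_L2[OF g] _ fourier_L1_norm_le[OF i(1)]]) measurable
    ultimately have u2: "?u \<in> L2" using L2_diff[of "\<lambda>\<xi>. ?A \<xi> * fourier f \<xi>" "\<lambda>\<xi>. ?B \<xi> * fourier g \<xi>"]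
      by (simp add: mult.commute)
    \<comment> \<open>The transform of \<open>?u\<close> at y is the weak equation tested with the
      translate of \<eta> by y.\<close>
    have "fourier_L1 ?u y = 0" for y
    proof -
      let ?\<eta> = "\<lambda>x. \<eta> (x + y)"
      have \<eta>y: "test_function ?\<eta>" by (rule test_function_translate[OF \<eta>])
      note iy = test_function_integrable[OF \<eta>y] test_function_L2[OF \<eta>y]
      have tr: "fourier_L1 ?\<eta> (- \<xi>) = cis (- (y \<bullet> \<xi>)) * ?B \<xi>" for \<xi>
        by (subst fourier_L1_translate) (auto simp: inner_commute)
      have "(LINT \<xi>|lborel. fourier f \<xi> * (of_real ((norm \<xi>)\<^sup>2) * fourier_L1 ?\<eta> (- \<xi>)))
          = (LINT \<xi>|lborel. fourier g \<xi> * fourier_L1 ?\<eta> (- \<xi>))"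
        using e[OF \<eta>y] unfolding neg_laplacian_pairing(3)[OF f \<eta>y] L2_pairing_fourier(2)[OF g iy] .
      moreover have "integrable lborel (\<lambda>\<xi>. fourier f \<xi> * (of_real ((norm \<xi>)\<^sup>2) * fourier_L1 ?\<eta> (- \<xi>)))"
        "integrable lborel (\<lambda>\<xi>. fourier g \<xi> * fourier_L1 ?\<eta> (- \<xi>))"
        by (intro L2_integrable_mult fourier_L2 f g neg_laplacian_pairing(1)[OF f \<eta>y] L2_pairing_fourier(1)[OF f iy])+
      ultimately have "(LINT \<xi>|lborel. fourier f \<xi> * (of_real ((norm \<xi>)\<^sup>2) * fourier_L1 ?\<eta> (- \<xi>)) - fourier g \<xi> * fourier_L1 ?\<eta> (- \<xi>)) = 0"
        by simp
      moreover have "fourier f \<xi> * (of_real ((norm \<xi>)\<^sup>2) * fourier_L1 ?\<eta> (- \<xi>)) - fourier g \<xi> * fourier_L1 ?\<eta> (- \<xi>)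
          = cis (- (y \<bullet> \<xi>)) * ?u \<xi>" for \<xi>
        unfolding tr by (simp add: algebra_simps)
      ultimately have "(LINT \<xi>|lborel. cis (- (y \<bullet> \<xi>)) * ?u \<xi>) = 0" by simp
      then show ?thesis unfolding fourier_L1_def[of ?u] by (simp only: mult_zero_right)
    qed
    then have "ae_eq ?u (\<lambda>\<xi>. 0)" by (rule fourier_L1_inj[OF u1 u2])
    then show ?thesis unfolding ae_eq_def by eventually_elim (simp add: algebra_simps)
  qed
  \<comment> \<open>Countably many bumps keep the union of the exceptional sets null, and for every
    \<xi> one of them has a nonzero transform at \<open>- \<xi>\<close>.\<close>
  have "AE \<xi> in lborel. \<forall>n. ?D \<xi> * fourier_L1 (\<lambda>x. of_real (bump (real (Suc n)) x)) (- \<xi>) = 0"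
    unfolding AE_all_countable by (intro allI zero test_function_bump) simp
  then have "ae_eq (fourier g) (\<lambda>\<xi>. of_real ((norm \<xi>)\<^sup>2) * fourier f \<xi>)"
    unfolding ae_eq_def
  proof eventually_elim
    case (elim \<xi>)
    obtain n where "real n > 3 * norm (- \<xi>)" using reals_Archimedean2 by blast
    then have "fourier_L1 (\<lambda>x. of_real (bump (real (Suc n)) x)) (- \<xi>) \<noteq> 0"
      by (intro fourier_L1_bump_nonzero) simp
    with elim have "?D \<xi> = 0" using mult_eq_0_iff by blast
    then show ?case by simp
  qed
  then show "p \<in> fourier_multiplier (\<lambda>\<xi>. (norm \<xi>)\<^sup>2)" using p f g by (simp add: fourier_multiplier_def)
qed


subsection \<open>The density of a Fourier multiplier\<close>

lemma op_scale_rhf_hamiltonian: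
  assumes \<beta>: "\<beta> \<noteq> 0"
  shows "op_scale \<beta> (rhf_hamiltonian (\<lambda>x. 0) \<mu>) = fourier_multiplier (\<lambda>\<xi>. \<beta> * ((norm \<xi>)\<^sup>2 - \<mu>))"
proof (intro set_eqI iffI)
  fix p assume "p \<in> op_scale \<beta> (rhf_hamiltonian (\<lambda>x. 0) \<mu>)"
  then obtain f h g g1 k g2 k0 where p: "p = (f, h)" and h: "h \<in> L2"
    and 1: "ae_eq h (\<lambda>x. of_real \<beta> * g x)" "ae_eq g (\<lambda>x. g1 x - k x)" "ae_eq g1 (\<lambda>x. g2 x - k0 x)"
    and 2: "(f, g2) \<in> neg_laplacian" "(f, k0) \<in> mult_op (\<lambda>x. 0)" "(f, k) \<in> mult_op (\<lambda>x. \<mu>)"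
    unfolding op_scale_def rhf_hamiltonian_def op_diff_def by blast
  have f: "f \<in> L2" and g2: "g2 \<in> L2" and F: "ae_eq (fourier g2) (\<lambda>\<xi>. of_real ((norm \<xi>)\<^sup>2) * fourier f \<xi>)"
    using 2(1) unfolding neg_laplacian_eq_fourier_multiplier fourier_multiplier_def by blast+
  have k: "ae_eq k0 (\<lambda>x. of_real 0 * f x)" "ae_eq k (\<lambda>x. of_real \<mu> * f x)"
    using 2(2,3) unfolding mult_op_def by blast+
  have L: "(\<lambda>x. of_real \<mu> * f x) \<in> L2" "(\<lambda>x. g2 x - of_real \<mu> * f x) \<in> L2"
    by (intro L2_diff L2_scale f g2)+
  have "ae_eq h (\<lambda>x. of_real \<beta> * (g2 x - of_real \<mu> * f x))"
    using 1 k unfolding ae_eq_def by eventually_elim simp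
  from fourier_cong[OF h L2_scale[OF L(2)] this] fourier_scale[OF L(2), of "of_real \<beta>"]
    fourier_diff[OF g2 L(1)] fourier_scale[OF f, of "of_real \<mu>"] F
  have "ae_eq (fourier h) (\<lambda>\<xi>. of_real (\<beta> * ((norm \<xi>)\<^sup>2 - \<mu>)) * fourier f \<xi>)"
    unfolding ae_eq_def by eventually_elim (simp add: algebra_simps)
  then show "p \<in> fourier_multiplier (\<lambda>\<xi>. \<beta> * ((norm \<xi>)\<^sup>2 - \<mu>))"
    using p f h by (simp add: fourier_multiplier_def)
next
  fix p assume "p \<in> fourier_multiplier (\<lambda>\<xi>. \<beta> * ((norm \<xi>)\<^sup>2 - \<mu>))"
  then obtain f h where p: "p = (f, h)" and f: "f \<in> L2" and h: "h \<in> L2"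
    and e: "ae_eq (fourier h) (\<lambda>\<xi>. of_real (\<beta> * ((norm \<xi>)\<^sup>2 - \<mu>)) * fourier f \<xi>)"
    unfolding fourier_multiplier_def by blast
  \<comment> \<open>The relation \<open>h = \<beta> (g2 - \<mu> f)\<close> is solved for g2. The
    solution lies in \<open>L2\<close> because h and f do, which puts f into the domain of
    \<open>neg_laplacian\<close>.\<close>
  let ?g = "\<lambda>x. of_real (1 / \<beta>) * h x" and ?k = "\<lambda>x. of_real \<mu> * f x"
  let ?g2 = "\<lambda>x. ?g x + ?k x"
  have g: "?g \<in> L2" and k: "?k \<in> L2" by (intro L2_scale h f)+
  have g2: "?g2 \<in> L2" by (rule L2_add[OF g k])
  have "ae_eq (fourier ?g2) (\<lambda>\<xi>. of_real ((norm \<xi>)\<^sup>2) * fourier f \<xi>)"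
    using fourier_add[OF g k] fourier_scale[OF h, of "of_real (1 / \<beta>)"] fourier_scale[OF f, of "of_real \<mu>"] e
    unfolding ae_eq_def
  proof eventually_elim
    case (elim \<xi>)
    have "of_real (1 / \<beta>) * (of_real (\<beta> * ((norm \<xi>)\<^sup>2 - \<mu>)) * z) + of_real \<mu> * z = complex_of_real ((norm \<xi>)\<^sup>2) * z" for z
      using \<beta> by (simp add: field_simps)
    with elim show ?case by simp
  qed
  then have "(f, ?g2) \<in> neg_laplacian"
    unfolding neg_laplacian_eq_fourier_multiplier using f g2 by (simp add: fourier_multiplier_def)
  moreover have "(f, \<lambda>x. 0) \<in> mult_op (\<lambda>x. 0)" using f by (simp add: mult_op_def)
  ultimately have "(f, ?g2) \<in> op_diff neg_laplacian (mult_op (\<lambda>x. 0))"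
    unfolding op_diff_def using g2 by (intro CollectI case_prodI conjI exI[of _ ?g2] exI[of _ "\<lambda>x. 0"]) auto
  moreover have "(f, ?k) \<in> mult_op (\<lambda>x. \<mu>)" using f k by (simp add: mult_op_def)
  ultimately have "(f, ?g) \<in> rhf_hamiltonian (\<lambda>x. 0) \<mu>"
    unfolding rhf_hamiltonian_def op_diff_def[of "op_diff _ _"] using g
    by (intro CollectI case_prodI conjI exI[of _ ?g2] exI[of _ ?k]) auto
  then show "p \<in> op_scale \<beta> (rhf_hamiltonian (\<lambda>x. 0) \<mu>)"
    unfolding op_scale_def p using h \<beta> by (intro CollectI case_prodI conjI exI[of _ ?g]) auto
qed

text \<open>The kernel is \<open>(2 pi)^(-3)\<close> times the integral of
  \<open>cis ((x - y) \<bullet> \<xi>) * m \<xi>\<close>: one factor \<open>fourier_const\<close>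
  belongs to the inverse transform, the other is inside \<open>fourier_L1\<close>. Integrability of
  m gives continuity. The bound by 1 gives \<open>m\<^sup>2 \<le> \<bar>m\<bar>\<close>, so m lies
  in \<open>L2\<close>, and it keeps the product of m with \<open>fourier f\<close> in
  \<open>L2\<close>.\<close>

lemma is_density_fourier_multiplier:
  assumes m: "integrable lborel m" and bd: "\<And>\<xi>. \<bar>m \<xi>\<bar> \<le> 1"
  shows "is_density (fourier_multiplier m) (\<lambda>x. (LINT \<xi>|lborel. m \<xi>) / (2 * pi) ^ 3)"
  unfolding is_density_def
proof (intro exI conjI allI)
  let ?m = "\<lambda>\<xi>. complex_of_real (m \<xi>)"
  let ?K = "\<lambda>x y. of_real fourier_const * fourier_L1 ?m (y - x)"
  note [measurable] = borel_measurable_integrable[OF m]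
  have m1: "integrable lborel ?m" using m by simp
  have "integrable lborel (\<lambda>\<xi>. (cmod (?m \<xi>))\<^sup>2)"
  proof (rule Bochner_Integration.integrable_bound[OF m])
    show "AE \<xi> in lborel. norm ((cmod (?m \<xi>))\<^sup>2) \<le> norm (m \<xi>)"
    proof (rule AE_I2)
      fix \<xi> :: R3
      have "\<bar>m \<xi>\<bar> * \<bar>m \<xi>\<bar> \<le> \<bar>m \<xi>\<bar> * 1" by (intro mult_left_mono bd) simp
      then show "norm ((cmod (?m \<xi>))\<^sup>2) \<le> norm (m \<xi>)" by (simp add: power2_eq_square)
    qed
  qed measurable
  then have m2: "?m \<in> L2" by (intro L2I) measurable
  show "continuous_on UNIV (\<lambda>(x, y). ?K x y)"
    unfolding split_beta'
    by (intro continuous_on_mult_left continuous_on_compose2[OF continuous_on_fourier_L1[OF m1]] continuous_intros) auto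
  have "fourier_L1 ?m 0 = of_real (fourier_const * (LINT \<xi>|lborel. m \<xi>))"
    by (simp add: fourier_L1_def)
  then show "?K x x = of_real ((LINT \<xi>|lborel. m \<xi>) / (2 * pi) ^ 3)" for x
    using fourier_const_square by (simp add: power2_eq_square flip: of_real_mult mult.assoc)
  show "is_integral_kernel (fourier_multiplier m) ?K"
    unfolding is_integral_kernel_def
  proof (intro ballI, clarify)
    fix f g assume "(f, g) \<in> fourier_multiplier m"
    then have f: "f \<in> L2" and g: "g \<in> L2" and e: "ae_eq (fourier g) (\<lambda>\<xi>. ?m \<xi> * fourier f \<xi>)"
      by (auto simp: fourier_multiplier_def)
    let ?v = "\<lambda>\<xi>. ?m \<xi> * fourier f \<xi>"
    have v1: "integrable lborel ?v" by (rule L2_integrable_mult[OF m2 fourier_L2[OF f]])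
    have v2: "?v \<in> L2" using bd by (intro L2_mult_bounded[OF fourier_L2[OF f], of _ 1]) auto
    have "ae_eq g (fourier_inv ?v)"
      by (rule fourier_eqD[OF g fourier_inv_L2[OF v2] ae_eq_trans[OF e ae_eq_sym[OF fourier_fourier_inv[OF v2]]]])
    also have "ae_eq (fourier_inv ?v) (\<lambda>x. fourier_L1 ?v (- x))" by (rule fourier_inv_eq_fourier_L1[OF v1 v2])
    finally have gv: "ae_eq g (\<lambda>x. fourier_L1 ?v (- x))" .
    have K: "integrable lborel (\<lambda>y. ?K x y * f y) \<and> fourier_L1 ?v (- x) = (LINT y|lborel. ?K x y * f y)" for x
    proof -
      \<comment> \<open>The symbol modulated by x: its transform is the kernel row at x up to a
        constant, so this row is square integrable and can be paired with f.\<close>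
      let ?w = "\<lambda>\<xi>. cis (x \<bullet> \<xi>) * ?m \<xi>"
      have w1: "integrable lborel ?w" by (rule integrable_cis_mult[OF m1]) measurable
      have w2: "?w \<in> L2" by (rule L2_mult_bounded[OF m2, of _ 1]) auto
      have w: "fourier_L1 ?w y = fourier_L1 ?m (y - x)" for y
      proof -
        have "cis (- (y \<bullet> \<xi>)) * cis (x \<bullet> \<xi>) = cis (- ((y - x) \<bullet> \<xi>))" for \<xi>
          by (simp add: cis_mult inner_diff_left)
        then show ?thesis unfolding fourier_L1_def by (simp flip: mult.assoc)
      qed
      have wL: "fourier_L1 ?w \<in> L2" by (rule fourier_L1_contraction(1)[OF w1 w2])
      have "(\<lambda>y. of_real fourier_const * (fourier_L1 ?w y * f y)) = (\<lambda>y. ?K x y * f y)"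
        unfolding w by (simp add: mult.assoc)
      moreover have "integrable lborel (\<lambda>y. of_real fourier_const * (fourier_L1 ?w y * f y))"
        by (intro integrable_mult_right L2_integrable_mult wL f)
      ultimately have i: "integrable lborel (\<lambda>y. ?K x y * f y)" by simp
      have "(LINT \<xi>|lborel. cis (- (- x \<bullet> \<xi>)) * ?v \<xi>) = (LINT \<xi>|lborel. fourier f \<xi> * ?w \<xi>)"
        by (simp add: mult_ac)
      \<comment> \<open>Since f is only square integrable, the exchange of integrals goes through
        the multiplication formula on \<open>L2\<close>.\<close>
      also have "\<dots> = (LINT y|lborel. f y * fourier ?w y)" by (rule fourier_mult_formula[OF f w2])
      also have "\<dots> = (LINT y|lborel. f y * fourier_L1 ?w y)"
      proof (rule integral_cong_AE)
        note [measurable] = L2_measurable[OF f] L2_measurable[OF fourier_L2[OF w2]] L2_measurable[OF wL]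
        show "(\<lambda>y. f y * fourier ?w y) \<in> borel_measurable lborel"
          by (intro borel_measurable_times) (simp_all add: L2_measurable f fourier_L2 w2)
        show "(\<lambda>y. f y * fourier_L1 ?w y) \<in> borel_measurable lborel"
          using L2_measurable[OF f] L2_measurable[OF wL] by (intro borel_measurable_times) simp_all
        show "AE y in lborel. f y * fourier ?w y = f y * fourier_L1 ?w y"
          using fourier_eq_fourier_L1[OF w1 w2] unfolding ae_eq_def by eventually_elim simp
      qed
      finally have "fourier_L1 ?v (- x) = of_real fourier_const * (LINT y|lborel. f y * fourier_L1 ?w y)"
        unfolding fourier_L1_def[of ?v] by (simp only:)
      also have "\<dots> = (LINT y|lborel. of_real fourier_const * (f y * fourier_L1 ?w y))"
        by (rule integral_mult_right_zero[symmetric])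
      also have "\<dots> = (LINT y|lborel. ?K x y * f y)"
        unfolding w by (simp add: mult_ac)
      finally show ?thesis using i by simp
    qed
    show "AE x in lborel. integrable lborel (\<lambda>y. ?K x y * f y) \<and> g x = (LINT y|lborel. ?K x y * f y)"
      using gv unfolding ae_eq_def by eventually_elim (use K in simp)
  qed
qed

section \<open>Bounds and continuity of the density as a function of \<mu>\<close>

lemma sqrt_cubed:
  fixes x :: real
  assumes "x \<ge> 0" shows "sqrt x ^ 3 = x powr (3 / 2)"
proof -
  have "sqrt x ^ 3 = (x powr (1 / 2)) powr 3" using assms by (simp add: powr_half_sqrt)
  then show ?thesis by (simp only: powr_powr) simp
qed

lemma gauss_integral:
  assumes "\<beta> > 0"
  shows "integrable lborel (\<lambda>\<xi>::R3. exp (- \<beta> * (norm \<xi>)\<^sup>2))"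
    and "(LINT \<xi>::R3|lborel. exp (- \<beta> * (norm \<xi>)\<^sup>2)) = (pi / \<beta>) powr (3 / 2)"
proof -
  \<comment> \<open>This width makes \<open>s\<^sup>2 / 2\<close> equal to \<beta>; frequency 0 then
    leaves the plain integral.\<close>
  have s: "sqrt (2 * \<beta>) > 0" using assms by simp
  have eq: "cis (0 \<bullet> \<xi>) * complex_of_real (exp (- (sqrt (2 * \<beta>))\<^sup>2 * (norm \<xi>)\<^sup>2 / 2)) = of_real (exp (- \<beta> * (norm \<xi>)\<^sup>2))" for \<xi> :: R3
    using assms by simp
  show "integrable lborel (\<lambda>\<xi>::R3. exp (- \<beta> * (norm \<xi>)\<^sup>2))"
    using gauss_fourier(1)[OF s, of "0::R3"] unfolding eq complex_of_real_integrable_eq .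
  have "complex_of_real (LINT \<xi>::R3|lborel. exp (- \<beta> * (norm \<xi>)\<^sup>2)) = of_real ((sqrt (2 * pi) / sqrt (2 * \<beta>)) ^ 3)"
    using gauss_fourier(2)[OF s, of "0::R3"] unfolding eq integral_complex_of_real by simp
  then have "(LINT \<xi>::R3|lborel. exp (- \<beta> * (norm \<xi>)\<^sup>2)) = (sqrt (2 * pi) / sqrt (2 * \<beta>)) ^ 3"
    by (simp only: of_real_eq_iff)
  also have "sqrt (2 * pi) / sqrt (2 * \<beta>) = sqrt (pi / \<beta>)"
    by (simp add: real_sqrt_divide[symmetric])
  finally show "(LINT \<xi>::R3|lborel. exp (- \<beta> * (norm \<xi>)\<^sup>2)) = (pi / \<beta>) powr (3 / 2)"
    using assms by (simp add: sqrt_cubed)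
qed

text \<open>Equality would force \<open>g - f\<close> to vanish almost everywhere although it is
  positive everywhere, and the whole space is not a null set.\<close>

lemma integral_lborel_strict_mono:
  fixes f g :: "'a::euclidean_space \<Rightarrow> real"
  assumes "integrable lborel f" "integrable lborel g" and less: "\<And>x. f x < g x"
  shows "(LINT x|lborel. f x) < (LINT x|lborel. g x)"
proof -
  have i: "integrable lborel (\<lambda>x. g x - f x)" using assms by simp
  have le: "(LINT x|lborel. f x) \<le> (LINT x|lborel. g x)"
    by (intro integral_mono assms less_imp_le)
  moreover have "(LINT x|lborel. f x) \<noteq> (LINT x|lborel. g x)"
  proof
    assume "(LINT x|lborel. f x) = (LINT x|lborel. g x)"
    then have "(LINT x|lborel. g x - f x) = 0" using assms by simp
    then have "AE x in lborel. g x - f x = 0"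
      using integral_nonneg_eq_0_iff_AE[OF i] less by (simp add: less_imp_le)
    then have "AE x::'a in lborel. x \<notin> UNIV" using less by (auto simp: less_imp_neq[symmetric])
    then have "UNIV \<in> null_sets (lborel :: 'a measure)" by (subst AE_iff_null_sets) auto
    then show False by (simp add: null_sets_def)
  qed
  ultimately show ?thesis by simp
qed

lemma f_FD_pos: "f_FD x > 0" by (simp add: f_FD_def add_pos_pos)

lemma f_FD_le_1: "\<bar>f_FD x\<bar> \<le> 1"
  by (simp add: f_FD_def add_pos_pos)

lemma f_FD_less_exp: "f_FD x < exp (- x)"
  by (simp add: f_FD_def exp_minus divide_inverse add_pos_pos)

lemma f_FD_antimono: "x \<le> y \<Longrightarrow> f_FD y \<le> f_FD x"
  by (simp add: f_FD_def frac_le add_pos_pos)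

lemma f_FD_measurable [measurable]: "f_FD \<in> borel_measurable borel"
  unfolding f_FD_def by measurable

lemma continuous_f_FD: "continuous_on UNIV f_FD"
  unfolding f_FD_def by (intro continuous_intros) (metis add_pos_pos exp_gt_zero less_irrefl zero_less_one)

text \<open>\<open>\<integral> f_FD (\<beta> (|\<xi>|\<^sup>2 - \<mu>)) d\<xi>\<close> is \<open>(2 \<pi>)\<^sup>3\<close> times the particle density.\<close>

context
  fixes \<beta> :: real
  assumes \<beta>: "\<beta> > 0"
begin

abbreviation FD :: "real \<Rightarrow> R3 \<Rightarrow> real" where
  "FD \<mu> \<xi> \<equiv> f_FD (\<beta> * ((norm \<xi>)\<^sup>2 - \<mu>))"

lemma FD_less: "FD \<mu> \<xi> < exp (\<beta> * \<mu>) * exp (- \<beta> * (norm \<xi>)\<^sup>2)"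
  using f_FD_less_exp[of "\<beta> * ((norm \<xi>)\<^sup>2 - \<mu>)"] by (simp add: exp_add[symmetric] algebra_simps)

lemma FD_mono: "\<mu> \<le> \<nu> \<Longrightarrow> FD \<mu> \<xi> \<le> FD \<nu> \<xi>"
  using \<beta> by (intro f_FD_antimono mult_left_mono) auto

lemma FD_bound_integrable: "integrable lborel (\<lambda>\<xi>::R3. exp (\<beta> * \<mu>) * exp (- \<beta> * (norm \<xi>)\<^sup>2))"
  by (intro integrable_mult_right gauss_integral(1) \<beta>)

lemma FD_integrable: "integrable lborel (FD \<mu>)"
proof (rule Bochner_Integration.integrable_bound[OF FD_bound_integrable[of \<mu>]])
  show "AE \<xi> in lborel. norm (FD \<mu> \<xi>) \<le> norm (exp (\<beta> * \<mu>) * exp (- \<beta> * (norm \<xi>)\<^sup>2))"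
    using FD_less[of _ \<mu>] f_FD_pos by (intro AE_I2) (simp add: less_imp_le abs_of_pos)
qed measurable

lemma FD_integral_mono: "\<mu> \<le> \<nu> \<Longrightarrow> (LINT \<xi>|lborel. FD \<mu> \<xi>) \<le> (LINT \<xi>|lborel. FD \<nu> \<xi>)"
  by (intro integral_mono FD_integrable FD_mono)

lemma FD_integral_less: "(LINT \<xi>|lborel. FD \<mu> \<xi>) < exp (\<beta> * \<mu>) * (pi / \<beta>) powr (3 / 2)"
proof -
  have "(LINT \<xi>|lborel. FD \<mu> \<xi>) < (LINT \<xi>::R3|lborel. exp (\<beta> * \<mu>) * exp (- \<beta> * (norm \<xi>)\<^sup>2))"
    by (rule integral_lborel_strict_mono[OF FD_integrable FD_bound_integrable]) (rule FD_less)
  also have "\<dots> = exp (\<beta> * \<mu>) * (pi / \<beta>) powr (3 / 2)" using gauss_integral(2)[OF \<beta>] by simp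
  finally show ?thesis .
qed

lemma FD_integral_greater:
  assumes \<mu>: "\<mu> > 0" shows "(LINT \<xi>|lborel. FD \<mu> \<xi>) > 2 / 3 * pi * \<mu> powr (3 / 2)"
proof -
  \<comment> \<open>Outside the ball the comparison function is 0 and \<open>f_FD\<close> still
    positive, so the bound is strict at every point, as strict monotonicity of the integral
    demands.\<close>
  let ?b = "\<lambda>\<xi>::R3. 1 / 2 * indicator (ball 0 (sqrt \<mu>)) \<xi> :: real"
  have less: "?b \<xi> < FD \<mu> \<xi>" for \<xi>
  proof (cases "norm \<xi> < sqrt \<mu>")
    case True
    then have "(norm \<xi>)\<^sup>2 < (sqrt \<mu>)\<^sup>2" by (rule power_strict_mono) auto
    then have "(norm \<xi>)\<^sup>2 < \<mu>" using \<mu> by simp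
    then have "exp (\<beta> * ((norm \<xi>)\<^sup>2 - \<mu>)) < 1" using \<beta> by (simp add: mult_pos_neg)
    then have "1 / 2 < FD \<mu> \<xi>" by (simp add: f_FD_def field_simps add_pos_pos)
    then show ?thesis using True by simp
  qed (simp add: f_FD_pos)
  have "(LINT \<xi>|lborel. ?b \<xi>) < (LINT \<xi>|lborel. FD \<mu> \<xi>)"
  proof (rule integral_lborel_strict_mono[OF _ FD_integrable])
    show "integrable lborel ?b"
      by (intro integrable_mult_right integrable_real_indicator emeasure_lborel_ball_finite) simp
  qed (rule less)
  moreover have "(LINT \<xi>|lborel. ?b \<xi>) = 1 / 2 * measure lborel (ball (0::R3) (sqrt \<mu>))" by simp
  moreover have "measure lborel (ball (0::R3) (sqrt \<mu>)) = 4 / 3 * pi * sqrt \<mu> ^ 3"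
    using content_ball[of "sqrt \<mu>" "0::R3"] \<mu> by (simp add: unit_ball_vol_3)
  ultimately show ?thesis using \<mu> by (simp add: sqrt_cubed)
qed

lemma continuous_FD_integral: "continuous_on UNIV (\<lambda>\<mu>. LINT \<xi>|lborel. FD \<mu> \<xi>)"
proof (rule continuous_on_sequentiallyI)
  fix u :: "nat \<Rightarrow> real" and \<mu> assume u: "u \<longlonglongrightarrow> \<mu>"
  then have "Bseq u" by (intro convergent_imp_Bseq convergentI)
  \<comment> \<open>A bound for the whole sequence: by monotonicity in \<mu>, the Gaussian belonging
    to M dominates every term.\<close>
  then obtain M where M: "\<And>n. \<bar>u n\<bar> \<le> M" unfolding Bseq_def by auto
  show "(\<lambda>n. LINT \<xi>|lborel. FD (u n) \<xi>) \<longlonglongrightarrow> (LINT \<xi>|lborel. FD \<mu> \<xi>)"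
  proof (rule integral_dominated_convergence[OF _ _ FD_bound_integrable[of M]])
    show "AE \<xi> in lborel. (\<lambda>n. FD (u n) \<xi>) \<longlonglongrightarrow> FD \<mu> \<xi>"
      by (intro AE_I2 continuous_on_tendsto_compose[OF continuous_f_FD] tendsto_intros u) auto
    show "AE \<xi> in lborel. norm (FD (u n) \<xi>) \<le> exp (\<beta> * M) * exp (- \<beta> * (norm \<xi>)\<^sup>2)" for n
    proof (rule AE_I2)
      fix \<xi> :: R3
      have "FD (u n) \<xi> \<le> FD M \<xi>" using M[of n] by (intro FD_mono) auto
      then show "norm (FD (u n) \<xi>) \<le> exp (\<beta> * M) * exp (- \<beta> * (norm \<xi>)\<^sup>2)"
        using FD_less[of \<xi> M] f_FD_pos[of "\<beta> * ((norm \<xi>)\<^sup>2 - u n)"] by simp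
    qed
  qed measurable
qed

end

section \<open>The zero potential and the choice of \<mu>\<close>

lemma C_k_zero: "C_k n (\<lambda>x. 0)" and laplacian_zero: "laplacian (\<lambda>x. 0) x = 0"
proof -
  have p: "partial i (\<lambda>x. 0) = (\<lambda>x. 0)" for i by (simp add: partial_def fun_eq_iff)
  show "C_k n (\<lambda>x. 0)" by (induction n) (simp_all add: p)
  show "laplacian (\<lambda>x. 0) x = 0" by (simp add: laplacian_def p)
qed

lemma rhf_solution_zero:
  assumes \<beta>: "\<beta> > 0" and \<kappa>: "(LINT \<xi>|lborel. FD \<beta> \<mu> \<xi>) / (2 * pi) ^ 3 = \<kappa>"
  shows "rhf_solution \<kappa> \<beta> (\<lambda>x. 0) \<mu>"
  unfolding rhf_solution_def
proof (intro conjI exI allI)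
  let ?t = "\<lambda>\<xi>::R3. \<beta> * ((norm \<xi>)\<^sup>2 - \<mu>)"
  show "C_k 2 (\<lambda>x. 0 :: real)" by (rule C_k_zero)
  have "op_scale \<beta> (rhf_hamiltonian (\<lambda>x. 0) \<mu>) = fourier_multiplier ?t" using \<beta> by (intro op_scale_rhf_hamiltonian) simp
  then show "is_function_of_op f_FD (op_scale \<beta> (rhf_hamiltonian (\<lambda>x. 0) \<mu>)) (fourier_multiplier (FD \<beta> \<mu>))"
    by (simp only:) (rule is_function_of_op_fourier_multiplier, measurable)
  show "is_density (fourier_multiplier (FD \<beta> \<mu>)) (\<lambda>x. (LINT \<xi>|lborel. FD \<beta> \<mu> \<xi>) / (2 * pi) ^ 3)"
    by (rule is_density_fourier_multiplier[OF FD_integrable[OF \<beta>] f_FD_le_1])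
  show "- (1 / (4 * pi)) * laplacian (\<lambda>x. 0) x = \<kappa> - (LINT \<xi>|lborel. FD \<beta> \<mu> \<xi>) / (2 * pi) ^ 3" for x
    using \<kappa> by (simp add: laplacian_zero)
qed

theorem theorem2:
  fixes \<kappa> \<beta> c\<^sub>1 c\<^sub>2 :: real
  assumes "\<kappa> > 0"
    and "c\<^sub>1 = 1 / (8 * pi powr (3 / 2))"
    and "c\<^sub>2 = 1 / (12 * pi\<^sup>2)"
    and "\<beta> > 0"
    and "\<kappa> > c\<^sub>1 / \<beta> powr (3 / 2)"
  shows "\<exists>\<mu>::real. rhf_solution \<kappa> \<beta> (\<lambda>x. 0) \<mu> \<and>
           0 < 1 / \<beta> * ln (\<kappa> * \<beta> powr (3 / 2) / c\<^sub>1) \<and>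
           1 / \<beta> * ln (\<kappa> * \<beta> powr (3 / 2) / c\<^sub>1) < \<mu> \<and>
           \<mu> < (\<kappa> / c\<^sub>2) powr (2 / 3)"
proof -
  note \<kappa> = assms(1) and c1 = assms(2) and c2 = assms(3) and \<beta> = assms(4)
  define \<rho> where "\<rho> \<mu> = (LINT \<xi>|lborel. FD \<beta> \<mu> \<xi>) / (2 * pi) ^ 3" for \<mu>
  \<comment> \<open>The point at which the Gaussian upper bound for \<rho> takes the value
    \<kappa>.\<close>
  define a where "a = 1 / \<beta> * ln (\<kappa> * \<beta> powr (3 / 2) / c\<^sub>1)"
  \<comment> \<open>The point at which the lower bound for \<rho> from the ball takes the value
    \<kappa>.\<close>
  define b where "b = (\<kappa> / c\<^sub>2) powr (2 / 3)"
  have c1_pos: "c\<^sub>1 > 0" and c2_pos: "c\<^sub>2 > 0" by (simp_all add: c1 c2)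
  \<comment> \<open>The assumed lower bound on \<kappa> says precisely that the argument of the
    logarithm exceeds 1.\<close>
  have gt1: "\<kappa> * \<beta> powr (3 / 2) / c\<^sub>1 > 1" using assms(5) c1_pos \<beta> by (simp add: field_simps)
  then have a_pos: "0 < a" unfolding a_def using \<beta> by simp
  have b_pos: "b > 0" unfolding b_def using \<kappa> c2_pos by simp
  \<comment> \<open>One half power cancels against \<open>c\<^sub>1\<close>, the other against the
    Gaussian integral.\<close>
  have pi3: "pi ^ 3 = pi powr (3 / 2) * pi powr (3 / 2)"
    by (simp add: powr_add[symmetric] powr_numeral[symmetric] del: powr_numeral)
  have "\<rho> a < exp (\<beta> * a) * (pi / \<beta>) powr (3 / 2) / (2 * pi) ^ 3"
    unfolding \<rho>_def using FD_integral_less[OF \<beta>, of a] by (intro divide_strict_right_mono) auto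
  also have "exp (\<beta> * a) = \<kappa> * \<beta> powr (3 / 2) / c\<^sub>1" unfolding a_def using \<beta> gt1 by simp
  also have "\<kappa> * \<beta> powr (3 / 2) / c\<^sub>1 * (pi / \<beta>) powr (3 / 2) / (2 * pi) ^ 3 = \<kappa>"
    using \<beta> unfolding power_mult_distrib pi3 c1 by (simp add: powr_divide field_simps)
  finally have \<rho>a: "\<rho> a < \<kappa>" .
  have "b powr (3 / 2) = \<kappa> / c\<^sub>2" unfolding b_def using \<kappa> c2_pos by (simp add: powr_powr)
  then have "2 / 3 * pi * b powr (3 / 2) / (2 * pi) ^ 3 = \<kappa>"
    by (simp add: c2 power3_eq_cube power2_eq_square)
  moreover have "2 / 3 * pi * b powr (3 / 2) / (2 * pi) ^ 3 < \<rho> b"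
    unfolding \<rho>_def using FD_integral_greater[OF \<beta> b_pos] by (intro divide_strict_right_mono) auto
  ultimately have \<rho>b: "\<kappa> < \<rho> b" by simp
  \<comment> \<open>The order of the two explicit endpoints is inferred from monotonicity of \<rho>
    and \<open>\<rho> a < \<kappa> < \<rho> b\<close>.\<close>
  have "a \<le> b"
  proof (rule ccontr)
    assume "\<not> a \<le> b"
    then have "\<rho> b \<le> \<rho> a" unfolding \<rho>_def by (intro divide_right_mono FD_integral_mono[OF \<beta>]) auto
    with \<rho>a \<rho>b show False by simp
  qed
  moreover have "continuous_on {a..b} \<rho>" unfolding \<rho>_def
    by (intro continuous_intros continuous_on_subset[OF continuous_FD_integral[OF \<beta>]]) auto
  ultimately obtain \<mu> where \<mu>: "a \<le> \<mu>" "\<mu> \<le> b" "\<rho> \<mu> = \<kappa>"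
    using IVT'[of \<rho> a \<kappa> b] \<rho>a \<rho>b by auto
  have "rhf_solution \<kappa> \<beta> (\<lambda>x. 0) \<mu>" using \<mu>(3) unfolding \<rho>_def by (rule rhf_solution_zero[OF \<beta>])
  \<comment> \<open>The endpoints are excluded because \<rho> differs from \<kappa> there.\<close>
  moreover have "a < \<mu>" "\<mu> < b" using \<mu> \<rho>a \<rho>b by (auto simp: less_le)
  ultimately show ?thesis using a_pos unfolding a_def b_def by blast
qed

end
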